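(* Let $L$ be a finite dimensional Lie algebra over $F$. Then $r_b(L)$ is the maximal solvable ideal of $L$, and $L = S\oplus r_b(L)$ as vector spaces, where $S$ is a semisimple Lie algebra (a Lie subalgebra of $L$).
   Context: $F$ is an algebraically closed field of characteristic zero; all Lie algebras are over $F$ and may be infinite dimensional. Baer radical. A homomorphic image of a Lie algebra $L$ is a Lie algebra onto which $L$ maps by a surjective Lie homomorphism. Let $\mathbb E$ be the class of nilpotent Lie algebras. For a well-ordered set $I$ with least element $1$ and a maximal element, define classes $\mathbb E_\alpha$ ($\alpha\in I$) by transfinite recursion: $\mathbb E_1$ is the class of all homomorphic images of members of $\mathbb E$; if $\alpha>1$ is a limit element (no immediate predecessor), $\mathbb E_\alpha=\bigcup_{\beta<\alpha}\mathbb E_\beta$; if $\alpha>1$ has an immediate predecessor $\alpha-1$, $\mathbb E_\alpha$ is the class of Lie algebras $L$ such that every non-zero homomorphic image of $L$ has a non-zero ideal belonging to $\mathbb E_{\alpha-1}$. Put $\mathbb E_I=\bigcup_{\alpha\in I}\mathbb E_\alpha$. A Lie algebra $L$ is an $r_b$-Lie algebra if $L\in\mathbb E_I$ for some such $I$ with $\operatorname{card} I>\operatorname{card} 2^L$ ($2^L$ is the power set of $L$). An $r_b$-ideal of $L$ is an ideal which is an $r_b$-Lie algebra, and $r_b(L)$, the Baer radical, denotes the largest $r_b$-ideal of $L$ (the sum of all $r_b$-ideals). Here "semisimple" for a finite dimensional Lie algebra has its usual meaning (zero solvable radical; the zero algebra is allowed). *)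

theory Defs
  imports
    "HOL-Computational_Algebra.Computational_Algebra"
    "HOL-Library.Equipollence"
begin

text \<open>
  A Lie algebra is a pair \<open>(L, br)\<close> of a subspace \<open>L\<close> of some vector space of arbitrary dimension
  and an operation \<open>br\<close> that is a Lie bracket on \<open>L\<close>.  Values of \<open>br\<close> outside \<open>L\<close> are irrelevant, so
  subalgebras and ideals inherit \<open>br\<close> unchanged.
\<close>

locale lie_algebra = vector_space scale
  for scale :: "'k::field \<Rightarrow> 'a::ab_group_add \<Rightarrow> 'a" +
  fixes L :: "'a set" and br :: "'a \<Rightarrow> 'a \<Rightarrow> 'a"
  assumes subspace_L: "subspace L"
    and br_closed: "\<lbrakk>x \<in> L; y \<in> L\<rbrakk> \<Longrightarrow> br x y \<in> L"
    and br_add_left: "\<lbrakk>x \<in> L; y \<in> L; z \<in> L\<rbrakk> \<Longrightarrow> br (x + y) z = br x z + br y z"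
    and br_add_right: "\<lbrakk>x \<in> L; y \<in> L; z \<in> L\<rbrakk> \<Longrightarrow> br x (y + z) = br x y + br x z"
    and br_scale_left: "\<lbrakk>x \<in> L; y \<in> L\<rbrakk> \<Longrightarrow> br (scale a x) y = scale a (br x y)"
    and br_scale_right: "\<lbrakk>x \<in> L; y \<in> L\<rbrakk> \<Longrightarrow> br x (scale a y) = scale a (br x y)"
    and br_self: "x \<in> L \<Longrightarrow> br x x = 0"
    and jacobi: "\<lbrakk>x \<in> L; y \<in> L; z \<in> L\<rbrakk> \<Longrightarrow>
      br x (br y z) + br y (br z x) + br z (br x y) = 0"

definition lie_subalgebra ::
    "('k::field \<Rightarrow> 'a::ab_group_add \<Rightarrow> 'a) \<Rightarrow> 'a set \<Rightarrow> ('a \<Rightarrow> 'a \<Rightarrow> 'a) \<Rightarrow> 'a set \<Rightarrow> bool" where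
  "lie_subalgebra scale L br S \<longleftrightarrow>
     module.subspace scale S \<and> S \<subseteq> L \<and> (\<forall>x\<in>S. \<forall>y\<in>S. br x y \<in> S)"

definition lie_ideal ::
    "('k::field \<Rightarrow> 'a::ab_group_add \<Rightarrow> 'a) \<Rightarrow> 'a set \<Rightarrow> ('a \<Rightarrow> 'a \<Rightarrow> 'a) \<Rightarrow> 'a set \<Rightarrow> bool" where
  "lie_ideal scale L br J \<longleftrightarrow>
     module.subspace scale J \<and> J \<subseteq> L \<and> (\<forall>x\<in>L. \<forall>y\<in>J. br x y \<in> J)"

definition bracket_space ::
    "('k::field \<Rightarrow> 'a::ab_group_add \<Rightarrow> 'a) \<Rightarrow> ('a \<Rightarrow> 'a \<Rightarrow> 'a) \<Rightarrow> 'a set \<Rightarrow> 'a set \<Rightarrow> 'a set" where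
  "bracket_space scale br A B = module.span scale {br x y | x y. x \<in> A \<and> y \<in> B}"

primrec lower_central ::
    "('k::field \<Rightarrow> 'a::ab_group_add \<Rightarrow> 'a) \<Rightarrow> 'a set \<Rightarrow> ('a \<Rightarrow> 'a \<Rightarrow> 'a) \<Rightarrow> nat \<Rightarrow> 'a set" where
  "lower_central scale L br 0 = L"
| "lower_central scale L br (Suc n) = bracket_space scale br L (lower_central scale L br n)"

primrec derived_series ::
    "('k::field \<Rightarrow> 'a::ab_group_add \<Rightarrow> 'a) \<Rightarrow> 'a set \<Rightarrow> ('a \<Rightarrow> 'a \<Rightarrow> 'a) \<Rightarrow> nat \<Rightarrow> 'a set" where
  "derived_series scale L br 0 = L"
| "derived_series scale L br (Suc n) =
     bracket_space scale br (derived_series scale L br n) (derived_series scale L br n)"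

definition nilpotent_lie ::
    "('k::field \<Rightarrow> 'a::ab_group_add \<Rightarrow> 'a) \<Rightarrow> 'a set \<Rightarrow> ('a \<Rightarrow> 'a \<Rightarrow> 'a) \<Rightarrow> bool" where
  "nilpotent_lie scale L br \<longleftrightarrow>
     lie_algebra scale L br \<and> (\<exists>n. lower_central scale L br n = {0})"

definition solvable_lie ::
    "('k::field \<Rightarrow> 'a::ab_group_add \<Rightarrow> 'a) \<Rightarrow> 'a set \<Rightarrow> ('a \<Rightarrow> 'a \<Rightarrow> 'a) \<Rightarrow> bool" where
  "solvable_lie scale L br \<longleftrightarrow>
     lie_algebra scale L br \<and> (\<exists>n. derived_series scale L br n = {0})"

definition solvable_ideal ::
    "('k::field \<Rightarrow> 'a::ab_group_add \<Rightarrow> 'a) \<Rightarrow> 'a set \<Rightarrow> ('a \<Rightarrow> 'a \<Rightarrow> 'a) \<Rightarrow> 'a set \<Rightarrow> bool" where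
  "solvable_ideal scale L br J \<longleftrightarrow> lie_ideal scale L br J \<and> solvable_lie scale J br"

text \<open>The solvable radical, as the sum of all solvable ideals.\<close>

definition solvable_radical ::
    "('k::field \<Rightarrow> 'a::ab_group_add \<Rightarrow> 'a) \<Rightarrow> 'a set \<Rightarrow> ('a \<Rightarrow> 'a \<Rightarrow> 'a) \<Rightarrow> 'a set" where
  "solvable_radical scale L br = module.span scale (\<Union>{J. solvable_ideal scale L br J})"

definition semisimple_lie ::
    "('k::field \<Rightarrow> 'a::ab_group_add \<Rightarrow> 'a) \<Rightarrow> 'a set \<Rightarrow> ('a \<Rightarrow> 'a \<Rightarrow> 'a) \<Rightarrow> bool" where
  "semisimple_lie scale L br \<longleftrightarrow> lie_algebra scale L br \<and> solvable_radical scale L br = {0}"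

definition lie_epi ::
    "('k::field \<Rightarrow> 'a::ab_group_add \<Rightarrow> 'a) \<Rightarrow> 'a set \<Rightarrow> ('a \<Rightarrow> 'a \<Rightarrow> 'a) \<Rightarrow>
     'a set \<Rightarrow> ('a \<Rightarrow> 'a \<Rightarrow> 'a) \<Rightarrow> ('a \<Rightarrow> 'a) \<Rightarrow> bool" where
  "lie_epi scale L br M c f \<longleftrightarrow>
     f ` L = M \<and>
     (\<forall>x\<in>L. \<forall>y\<in>L. f (x + y) = f x + f y) \<and>
     (\<forall>a. \<forall>x\<in>L. f (scale a x) = scale a (f x)) \<and>
     (\<forall>x\<in>L. \<forall>y\<in>L. f (br x y) = c (f x) (f y))"

text \<open>
  The homomorphic images of \<open>(L, br)\<close> are taken among the Lie algebras carried by subspaces of the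
  same ambient space, with an arbitrary bracket.  Up to isomorphism these are all of them: the
  quotient by an ideal is carried by a linear complement of the ideal, see \<open>quotient_exists\<close>
  below.
\<close>

definition lie_image ::
    "('k::field \<Rightarrow> 'a::ab_group_add \<Rightarrow> 'a) \<Rightarrow> 'a set \<Rightarrow> ('a \<Rightarrow> 'a \<Rightarrow> 'a) \<Rightarrow>
     'a set \<Rightarrow> ('a \<Rightarrow> 'a \<Rightarrow> 'a) \<Rightarrow> bool" where
  "lie_image scale L br M c \<longleftrightarrow>
     lie_algebra scale L br \<and> lie_algebra scale M c \<and> (\<exists>f. lie_epi scale L br M c f)"

lemma (in lie_algebra) quotient_exists:
  assumes J: "lie_ideal scale L br J"
  shows "\<exists>M c f. lie_algebra scale M c \<and> lie_epi scale L br M c f \<and> {x \<in> L. f x = 0} = J"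
proof -
  have sJ: "subspace J" and JL: "J \<subseteq> L" and Jbr: "\<And>x y. x \<in> L \<Longrightarrow> y \<in> J \<Longrightarrow> br x y \<in> J"
    using J by (auto simp: lie_ideal_def)
  have anti: "br x y = - br y x" if "x \<in> L" "y \<in> L" for x y
  proof -
    have xy: "x + y \<in> L" using that subspace_add[OF subspace_L] by blast
    have "0 = br (x + y) (x + y)" using br_self[OF xy] by simp
    also have "\<dots> = br x (x + y) + br y (x + y)" by (rule br_add_left) (use that xy in auto)
    also have "\<dots> = (br x x + br x y) + (br y x + br y y)" using that by (simp only: br_add_right)
    also have "\<dots> = br x y + br y x" using that by (simp add: br_self)
    finally have "br x y + br y x = 0" by simp
    then show ?thesis by (simp add: eq_neg_iff_add_eq_0)
  qed
  have Jbr': "br y x \<in> J" if "x \<in> L" "y \<in> J" for x y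
    using that Jbr[OF that] anti[of y x] JL subspace_neg[OF sJ] by auto
  obtain B where B: "B \<subseteq> J" "independent B" "J \<subseteq> span B"
    using maximal_independent_subset[of J] by auto
  have spB: "span B = J"
    using B span_minimal[OF B(1) sJ] by auto
  obtain C where C: "B \<subseteq> C" "C \<subseteq> L" "independent C" "L \<subseteq> span C"
    by (rule maximal_independent_subset_extend[OF subset_trans[OF B(1) JL] B(2)])
  interpret vp: vector_space_pair scale scale ..
  define f where "f = vp.construct C (\<lambda>x. if x \<in> B then 0 else x)"
  have lin: "Vector_Spaces.linear scale scale f"
    unfolding f_def by (rule vp.linear_construct[OF C(3)])
  have f_add: "f (x + y) = f x + f y" for x y by (rule vp.linear_add[OF lin])
  have f_scale: "f (scale a x) = scale a (f x)" for a x by (rule vp.linear_scale[OF lin])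
  have f_diff: "f (x - y) = f x - f y" for x y by (rule vp.linear_diff[OF lin])
  have f_zero: "f 0 = 0" by (rule vp.linear_0[OF lin])
  have f_C: "f x = (if x \<in> B then 0 else x)" if "x \<in> C" for x
    unfolding f_def by (rule vp.construct_basis[OF C(3) that])
  have f_J: "f x = 0" if "x \<in> J" for x
  proof -
    have "x \<in> span B" using that spB by simp
    then show ?thesis
      by (induction rule: span_induct_alt) (use C(1) in \<open>auto simp: f_zero f_add f_scale f_C\<close>)
  qed
  have f_mod: "f x - x \<in> J" if "x \<in> L" for x
  proof -
    have "x \<in> span C" using that C(4) by blast
    then show ?thesis
    proof (induction rule: span_induct_alt)
      case base
      then show ?case by (simp add: f_zero subspace_0[OF sJ])
    next
      case (step a y z)
      have "f y - y \<in> J"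
        using f_C[OF step(1)] B(1) subspace_0[OF sJ] subspace_neg[OF sJ] by auto
      then have "scale a (f y - y) + (f z - z) \<in> J"
        using step subspace_add[OF sJ] subspace_scale[OF sJ] by blast
      then show ?case by (simp add: f_add f_scale scale_right_diff_distrib algebra_simps)
    qed
  qed
  have f_L: "f x \<in> L" if "x \<in> L" for x
    using subspace_add[OF subspace_L, of "f x - x" x] f_mod[OF that] JL that by auto
  have f_ker: "x \<in> J" if "x \<in> L" "f x = 0" for x
    using f_mod[OF that(1)] that(2) subspace_neg[OF sJ, of "- x"] by simp
  have f_eq: "f x = f y" if "x - y \<in> J" for x y
    using f_J[OF that] f_diff by simp
  have f_idem: "f (f x) = f x" if "x \<in> L" for x
    by (rule f_eq) (rule f_mod[OF that])
  have br_diff_left: "br x z - br y z = br (x - y) z" if "x \<in> L" "y \<in> L" "z \<in> L" for x y z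
    using br_add_left[of "x - y" y z] that subspace_diff[OF subspace_L] by simp
  have br_diff_right: "br z x - br z y = br z (x - y)" if "x \<in> L" "y \<in> L" "z \<in> L" for x y z
    using br_add_right[of z "x - y" y] that subspace_diff[OF subspace_L] by simp
  define c where "c = (\<lambda>x y. f (br x y))"
  have f_left: "f (br (f x) y) = f (br x y)" if "x \<in> L" "y \<in> L" for x y
    by (rule f_eq) (simp add: br_diff_left that f_L Jbr' f_mod)
  have f_right: "f (br x (f y)) = f (br x y)" if "x \<in> L" "y \<in> L" for x y
    by (rule f_eq) (simp add: br_diff_right that f_L Jbr f_mod)
  have fL_sub: "f ` L \<subseteq> L" using f_L by blast
  have "lie_algebra scale (f ` L) c"
  proof (unfold_locales)
    show "subspace (f ` L)"
      by (rule vp.linear_subspace_image[OF lin subspace_L])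
    fix x y assume "x \<in> f ` L" "y \<in> f ` L"
    then have xy: "x \<in> L" "y \<in> L" using fL_sub by auto
    show "c x y \<in> f ` L" unfolding c_def using br_closed xy by blast
    show "c (scale a x) y = scale a (c x y)" for a
      unfolding c_def using xy by (simp add: br_scale_left f_scale)
    show "c x (scale a y) = scale a (c x y)" for a
      unfolding c_def using xy by (simp add: br_scale_right f_scale)
  next
    fix x assume "x \<in> f ` L"
    then show "c x x = 0" unfolding c_def using fL_sub br_self f_zero by auto
  next
    fix x y z assume "x \<in> f ` L" "y \<in> f ` L" "z \<in> f ` L"
    then have xyz: "x \<in> L" "y \<in> L" "z \<in> L" using fL_sub by auto
    show "c (x + y) z = c x z + c y z" unfolding c_def using xyz by (simp add: br_add_left f_add)
    show "c x (y + z) = c x y + c x z" unfolding c_def using xyz by (simp add: br_add_right f_add)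
    have "c x (c y z) + c y (c z x) + c z (c x y)
        = f (br x (br y z) + br y (br z x) + br z (br x y))"
      unfolding c_def using xyz by (simp add: f_right br_closed f_add)
    then show "c x (c y z) + c y (c z x) + c z (c x y) = 0"
      using jacobi[OF xyz] f_zero by simp
  qed
  moreover have "lie_epi scale L br (f ` L) c f"
    unfolding lie_epi_def c_def by (auto simp: f_add f_scale f_left f_right f_L)
  moreover have "{x \<in> L. f x = 0} = J" using f_ker f_J JL by blast
  ultimately show ?thesis by blast
qed

text \<open>
  A well-ordered set is given by its non-strict order relation \<open>r\<close>; its elements form
  \<open>Field r\<close>, and \<open>underS r \<alpha>\<close> is the set of elements strictly below \<open>\<alpha>\<close>.
\<close>

definition is_pred :: "'i rel \<Rightarrow> 'i \<Rightarrow> 'i \<Rightarrow> bool" where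
  "is_pred r p \<alpha> \<longleftrightarrow> p \<in> underS r \<alpha> \<and> (\<forall>\<beta>\<in>underS r \<alpha>. (\<beta>, p) \<in> r)"

definition baer_step ::
    "('k::field \<Rightarrow> 'a::ab_group_add \<Rightarrow> 'a) \<Rightarrow> 'i rel \<Rightarrow>
     ('i \<Rightarrow> ('a set \<times> ('a \<Rightarrow> 'a \<Rightarrow> 'a)) set) \<Rightarrow> 'i \<Rightarrow> ('a set \<times> ('a \<Rightarrow> 'a \<Rightarrow> 'a)) set" where
  "baer_step scale r E \<alpha> =
     (if underS r \<alpha> = {} then
        {(L, br). \<exists>N c. nilpotent_lie scale N c \<and> lie_image scale N c L br}
      else if \<exists>p. is_pred r p \<alpha> then
        {(L, br). lie_algebra scale L br \<and>
           (\<forall>M c. lie_image scale L br M c \<and> M \<noteq> {0} \<longrightarrow>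
              (\<exists>J. lie_ideal scale M c J \<and> J \<noteq> {0} \<and> (J, c) \<in> E (THE p. is_pred r p \<alpha>)))}
      else (\<Union>\<beta>\<in>underS r \<alpha>. E \<beta>))"

definition baer_class ::
    "('k::field \<Rightarrow> 'a::ab_group_add \<Rightarrow> 'a) \<Rightarrow> 'i rel \<Rightarrow> 'i \<Rightarrow> ('a set \<times> ('a \<Rightarrow> 'a \<Rightarrow> 'a)) set" where
  "baer_class scale r = wo_rel.worec r (baer_step scale r)"

lemma is_pred_unique:
  assumes "Well_order r" "is_pred r p \<alpha>" "is_pred r q \<alpha>"
  shows "p = q"
proof -
  interpret wo_rel r by (rule wo_rel.intro[OF assms(1)])
  have "(p, q) \<in> r" "(q, p) \<in> r" using assms(2,3) by (auto simp: is_pred_def)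
  then show ?thesis using ANTISYM by (simp add: antisym_def)
qed

lemma the_is_pred:
  assumes "Well_order r" "is_pred r p \<alpha>"
  shows "(THE p. is_pred r p \<alpha>) = p"
  using assms(2) by (rule the_equality) (rule is_pred_unique[OF assms(1) _ assms(2)])

lemma baer_class_unfold:
  fixes scale :: "'k::field \<Rightarrow> 'a::ab_group_add \<Rightarrow> 'a" and r :: "'i rel"
  assumes "Well_order r"
  shows "baer_class scale r \<alpha> = baer_step scale r (baer_class scale r) \<alpha>"
proof -
  interpret wo_rel r by (rule wo_rel.intro[OF assms])
  have "adm_wo (baer_step scale r)"
    unfolding adm_wo_def
  proof (intro allI impI)
    fix E E' :: "'i \<Rightarrow> ('a set \<times> ('a \<Rightarrow> 'a \<Rightarrow> 'a)) set" and \<alpha>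
    assume eq: "\<forall>\<beta>\<in>underS \<alpha>. E \<beta> = E' \<beta>"
    have "E (THE p. is_pred r p \<alpha>) = E' (THE p. is_pred r p \<alpha>)" if "\<exists>p. is_pred r p \<alpha>"
    proof -
      from that obtain p where p: "is_pred r p \<alpha>" ..
      then have "p \<in> underS \<alpha>" by (simp add: is_pred_def)
      then show ?thesis using eq by (simp add: the_is_pred[OF assms p])
    qed
    then show "baer_step scale r E \<alpha> = baer_step scale r E' \<alpha>"
      unfolding baer_step_def using eq by auto
  qed
  then show ?thesis
    unfolding baer_class_def by (rule fun_cong[OF worec_fixpoint])
qed

lemma baer_class_least:
  assumes "Well_order r" "underS r \<alpha> = {}"
  shows "(L, br) \<in> baer_class scale r \<alpha> \<longleftrightarrow>
    (\<exists>N c. nilpotent_lie scale N c \<and> lie_image scale N c L br)"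
  using assms by (subst baer_class_unfold) (simp_all add: baer_step_def)

lemma baer_class_succ:
  assumes "Well_order r" "is_pred r p \<alpha>"
  shows "(L, br) \<in> baer_class scale r \<alpha> \<longleftrightarrow>
    lie_algebra scale L br \<and>
    (\<forall>M c. lie_image scale L br M c \<and> M \<noteq> {0} \<longrightarrow>
       (\<exists>J. lie_ideal scale M c J \<and> J \<noteq> {0} \<and> (J, c) \<in> baer_class scale r p))"
proof -
  have "underS r \<alpha> \<noteq> {}" using assms(2) by (auto simp: is_pred_def)
  then show ?thesis
    using assms the_is_pred[OF assms]
    by (subst baer_class_unfold) (auto simp: baer_step_def)
qed

lemma baer_class_lim:
  assumes "Well_order r" "underS r \<alpha> \<noteq> {}" "\<nexists>p. is_pred r p \<alpha>"
  shows "baer_class scale r \<alpha> = (\<Union>\<beta>\<in>underS r \<alpha>. baer_class scale r \<beta>)"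
  using assms by (subst baer_class_unfold) (simp_all add: baer_step_def)

text \<open>
  The well-ordered sets in the definition of an \<open>r\<^sub>b\<close>-Lie algebra have elements in an arbitrary
  type \<open>'i\<close>, which is passed as an argument since HOL cannot quantify over it.  The type is only
  required to be large enough to contain sets of the prescribed cardinality; by
  \<open>index_type_exists\<close>, \<open>'i = 'a set set\<close> always is.
\<close>

definition rb_algebra ::
    "'i itself \<Rightarrow> ('k::field \<Rightarrow> 'a::ab_group_add \<Rightarrow> 'a) \<Rightarrow> 'a set \<Rightarrow> ('a \<Rightarrow> 'a \<Rightarrow> 'a) \<Rightarrow> bool" where
  "rb_algebra TYPE('i) scale L br \<longleftrightarrow>
     (\<exists>r :: 'i rel. Well_order r \<and> (\<exists>m\<in>Field r. \<forall>\<alpha>\<in>Field r. (\<alpha>, m) \<in> r) \<and>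
        Pow L \<prec> Field r \<and> (\<exists>\<alpha>\<in>Field r. (L, br) \<in> baer_class scale r \<alpha>))"

definition rb_ideal ::
    "'i itself \<Rightarrow> ('k::field \<Rightarrow> 'a::ab_group_add \<Rightarrow> 'a) \<Rightarrow> 'a set \<Rightarrow> ('a \<Rightarrow> 'a \<Rightarrow> 'a) \<Rightarrow> 'a set \<Rightarrow> bool"
  where
  "rb_ideal I scale L br J \<longleftrightarrow> lie_ideal scale L br J \<and> rb_algebra I scale J br"

text \<open>The order in \<open>GREATEST\<close> is set inclusion: this is the largest \<open>r\<^sub>b\<close>-ideal.\<close>

definition baer_radical ::
    "'i itself \<Rightarrow> ('k::field \<Rightarrow> 'a::ab_group_add \<Rightarrow> 'a) \<Rightarrow> 'a set \<Rightarrow> ('a \<Rightarrow> 'a \<Rightarrow> 'a) \<Rightarrow> 'a set" where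
  "baer_radical I scale L br = (GREATEST J. rb_ideal I scale L br J)"

lemma index_type_exists: "Pow (L :: 'a set) \<prec> (UNIV :: 'a set set set)"
proof -
  have "Pow L \<lesssim> (UNIV :: 'a set set)"
    by (rule subset_imp_lepoll) simp
  also have "\<dots> \<prec> Pow (UNIV :: 'a set set)"
    by (rule lesspoll_Pow_self)
  finally show ?thesis by simp
qed

end

theory Submission
  imports Defs
begin

text \<open>
  On finite dimensional Lie algebras, being an \<open>r\<^sub>b\<close>-Lie algebra is the same as being solvable.  A
  solvable algebra lies in the second class, since the last non-zero term of the derived series of
  each of its images is abelian.  Conversely, by induction on the index, if \<open>L\<close> lies in a successor
  class and \<open>R\<close> is its solvable radical, then a non-zero \<open>L/R\<close> would have a non-zero solvable ideal.

  The complement is Levi's theorem.  By induction on the dimension one may assume that the radical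
  \<open>R\<close> contains no smaller non-zero ideal of \<open>L\<close>; then \<open>R\<close> is abelian and irreducible over the
  semisimple algebra \<open>M = L/R\<close>, and the obstruction to a splitting is a 2-cocycle of \<open>M\<close> with values
  in \<open>R\<close>.  It is a coboundary: for trivial coefficients because derivations of \<open>M\<close> are inner, and
  otherwise because a Casimir operator is invertible on \<open>R\<close>.  Both rest on Cartan's criterion.
\<close>

section \<open>Traces, bilinear forms and dual bases\<close>

text \<open>Homomorphic images carry a new bracket on another subspace of the ambient space, so all
  linear algebra is relative to a carrier: maps are total functions of which only the values on the
  carrier count, and modules are further subspaces of the same space.

  Cartan's criterion wants, next to an operator \<open>z\<close> with eigenvalues \<open>a\<close>,
  a companion with eigenvalues \<open>\<phi> a\<close>, where \<open>\<phi>\<close> has rational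
  values because a vanishing sum of rational squares vanishes term by term. The companion is scalar
  on each generalized eigenspace of \<open>z\<close>; these span since the field is algebraically
  closed. What comes out first is that the commutator algebra acts nilpotently on itself; Engel's
  theorem turns this into solvability.

  The trace form of a module degenerates on elements acting by zero. The Casimir operator is
  therefore built from dual bases of a non-zero ideal on which the form is non-degenerate. Its trace
  is the dimension of that ideal, non-zero in characteristic 0, and its kernel is a submodule, which
  is why irreducibility has to be arranged beforehand.\<close>

locale vec_space = vector_space scale for scale :: "'a::field \<Rightarrow> 'b::ab_group_add \<Rightarrow> 'b"
begin

text \<open>The finite set \<open>B\<close> may lie outside \<open>V\<close>, so finiteness passes
  to subspaces without choosing a basis.\<close>

definition fin_subspace :: "'b set \<Rightarrow> bool" where
  "fin_subspace V \<longleftrightarrow> subspace V \<and> (\<exists>B. finite B \<and> V \<subseteq> span B)"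

definition basis_of :: "'b set \<Rightarrow> 'b set \<Rightarrow> bool" where
  "basis_of V B \<longleftrightarrow> finite B \<and> independent B \<and> B \<subseteq> V \<and> span B = V"

definition lin_on :: "'b set \<Rightarrow> ('b \<Rightarrow> 'b) \<Rightarrow> bool" where
  "lin_on V f \<longleftrightarrow> (\<forall>x\<in>V. \<forall>y\<in>V. f (x + y) = f x + f y) \<and> (\<forall>a. \<forall>x\<in>V. f (scale a x) = scale a (f x))"

definition functional_on :: "'b set \<Rightarrow> ('b \<Rightarrow> 'a) \<Rightarrow> bool" where
  "functional_on V l \<longleftrightarrow> (\<forall>x\<in>V. \<forall>y\<in>V. l (x + y) = l x + l y) \<and> (\<forall>a. \<forall>x\<in>V. l (scale a x) = a * l x)"

definition endo :: "'b set \<Rightarrow> ('b \<Rightarrow> 'b) \<Rightarrow> bool" where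
  "endo V f \<longleftrightarrow> lin_on V f \<and> (\<forall>x\<in>V. f x \<in> V)"

lemma fin_subspace_subspace: "fin_subspace V \<Longrightarrow> subspace V"
  by (simp add: fin_subspace_def)

lemma fin_subspace_mono: "fin_subspace V \<Longrightarrow> subspace U \<Longrightarrow> U \<subseteq> V \<Longrightarrow> fin_subspace U"
  unfolding fin_subspace_def by blast

lemma basis_ofD:
  assumes "basis_of V B"
  shows "finite B" "independent B" "B \<subseteq> V" "span B = V" "subspace V"
  using assms subspace_span[of B] unfolding basis_of_def by auto

lemma basis_extend:
  assumes V: "fin_subspace V" and "independent A" "A \<subseteq> V"
  obtains B where "A \<subseteq> B" "basis_of V B"
proof -
  obtain T where T: "finite T" "V \<subseteq> span T" and sV: "subspace V"
    using V by (auto simp: fin_subspace_def)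
  obtain B where B: "A \<subseteq> B" "B \<subseteq> V" "independent B" "V \<subseteq> span B"
    using maximal_independent_subset_extend[OF assms(3,2)] by auto
  have "finite B" using independent_span_bound[OF T(1) B(3)] B(2) T(2) by auto
  moreover have "span B = V" using B span_minimal[OF B(2) sV] by auto
  ultimately show ?thesis using that B by (auto simp: basis_of_def)
qed

lemma basis_of_exists:
  assumes V: "fin_subspace V"
  obtains B where "basis_of V B"
  using basis_extend[OF V, of "{}"] by (auto simp: independent_empty)

lemma basis_subset_span:
  assumes V: "fin_subspace V" and "A \<subseteq> V" "V \<subseteq> span A"
  obtains B where "B \<subseteq> A" "basis_of V B"
proof -
  obtain B where B: "B \<subseteq> A" "independent B" "A \<subseteq> span B"
    using maximal_independent_subset[of A] by auto
  obtain T where T: "finite T" "V \<subseteq> span T" and sV: "subspace V"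
    using V by (auto simp: fin_subspace_def)
  have "finite B" using independent_span_bound[OF T(1) B(2)] B(1) assms(2) T(2) by auto
  moreover have "span B = V"
  proof
    show "span B \<subseteq> V" using span_minimal[OF _ sV, of B] B(1) assms(2) by auto
    show "V \<subseteq> span B" using assms(3) span_minimal[OF B(3) subspace_span] by auto
  qed
  ultimately show ?thesis using that[of B] B assms(2) by (auto simp: basis_of_def)
qed

lemma basis_card: "basis_of V B \<Longrightarrow> card B = dim V"
  using basis_card_eq_dim[of B V] by (auto simp: basis_of_def)

lemma basis_fin: "basis_of V B \<Longrightarrow> fin_subspace V"
  unfolding fin_subspace_def using basis_ofD[of V B] by auto

lemma dim_less:
  assumes V: "fin_subspace V" and U: "subspace U" "U \<subset> V"
  shows "dim U < dim V"
proof -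
  obtain A where A: "basis_of U A" using basis_of_exists fin_subspace_mono[OF V U(1)] U(2) by blast
  have AV: "A \<subseteq> V" using basis_ofD[OF A] U(2) by auto
  obtain B where B: "A \<subseteq> B" "basis_of V B" using basis_extend[OF V basis_ofD(2)[OF A] AV] .
  have "A \<noteq> B" using basis_ofD(4)[OF A] basis_ofD(4)[OF B(2)] U(2) by auto
  then have "card A < card B" using B basis_ofD(1)[OF B(2)] by (intro psubset_card_mono) auto
  then show ?thesis using basis_card A B(2) by metis
qed

lemma dim_le: "fin_subspace V \<Longrightarrow> subspace U \<Longrightarrow> U \<subseteq> V \<Longrightarrow> dim U \<le> dim V"
  using dim_less[of V U] by (cases "U = V") (auto simp: psubset_eq)

section \<open>Linear maps on a subspace\<close>

lemma lin_onD:
  assumes "lin_on V f"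
  shows "x \<in> V \<Longrightarrow> y \<in> V \<Longrightarrow> f (x + y) = f x + f y" "x \<in> V \<Longrightarrow> f (scale a x) = scale a (f x)"
  using assms by (auto simp: lin_on_def)

lemma lin_on_0: "lin_on V f \<Longrightarrow> subspace V \<Longrightarrow> f 0 = 0"
  using lin_onD(1)[of V f 0 0] subspace_0[of V] by simp

lemma lin_on_diff:
  assumes "lin_on V f" "subspace V" "x \<in> V" "y \<in> V"
  shows "f (x - y) = f x - f y"
  using lin_onD(1)[OF assms(1), of "x - y" y] subspace_diff[OF assms(2-4)] assms(4) by simp

lemma lin_on_neg:
  assumes "lin_on V f" "subspace V" "x \<in> V"
  shows "f (- x) = - f x"
  using lin_on_diff[OF assms(1,2) subspace_0[OF assms(2)] assms(3)] lin_on_0[OF assms(1,2)] by simp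

lemma lin_on_sum:
  assumes f: "lin_on V f" and V: "subspace V" and "\<And>i. i \<in> I \<Longrightarrow> g i \<in> V"
  shows "f (\<Sum>i\<in>I. g i) = (\<Sum>i\<in>I. f (g i))"
  using assms(3)
proof (induction I rule: infinite_finite_induct)
  case (insert i I)
  then show ?case using lin_onD(1)[OF f, of "g i" "sum g I"] subspace_sum[OF V, of I g] by auto
qed (auto simp: lin_on_0[OF f V])

lemma lin_on_eq_span:
  assumes f: "lin_on V f" and g: "lin_on V g" and V: "subspace V" and B: "B \<subseteq> V" "V \<subseteq> span B"
    and eq: "\<And>b. b \<in> B \<Longrightarrow> f b = g b" and x: "x \<in> V"
  shows "f x = g x"
proof -
  have "span B \<subseteq> V" using B(1) V span_minimal by blast
  have "x \<in> span B" using x B(2) by blast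
  then have "f x = g x \<and> x \<in> V"
  proof (induction rule: span_induct_alt)
    case base then show ?case by (simp add: lin_on_0[OF f V] lin_on_0[OF g V] subspace_0[OF V])
  next
    case (step c a b)
    have "a \<in> V" using step B(1) by auto
    then show ?case using step eq lin_onD[OF f] lin_onD[OF g] subspace_scale[OF V] subspace_add[OF V] by auto
  qed
  then show ?thesis by simp
qed

lemma lin_on_subset: "lin_on V f \<Longrightarrow> U \<subseteq> V \<Longrightarrow> lin_on U f"
  unfolding lin_on_def by (meson subsetD)

lemma endoD: assumes "endo V f" shows "lin_on V f" "x \<in> V \<Longrightarrow> f x \<in> V"
  using assms by (auto simp: endo_def)

lemma lin_on_comp: "lin_on V f \<Longrightarrow> lin_on U g \<Longrightarrow> (\<And>x. x \<in> U \<Longrightarrow> g x \<in> V) \<Longrightarrow> lin_on U (\<lambda>x. f (g x))"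
  by (simp add: lin_on_def)

lemma lin_on_sum_fun: "(\<And>i. i \<in> I \<Longrightarrow> lin_on V (g i)) \<Longrightarrow> lin_on V (\<lambda>x. \<Sum>i\<in>I. g i x)"
  by (simp add: lin_on_def sum.distrib scale_sum_right cong: sum.cong)

lemma endo_comp: "endo V f \<Longrightarrow> endo V g \<Longrightarrow> endo V (\<lambda>x. f (g x))"
  by (simp add: endo_def lin_on_def)

lemma endo_add: "subspace V \<Longrightarrow> endo V f \<Longrightarrow> endo V g \<Longrightarrow> endo V (\<lambda>x. f x + g x)"
  by (simp add: endo_def lin_on_def subspace_add scale_right_distrib algebra_simps)

lemma endo_diff: "subspace V \<Longrightarrow> endo V f \<Longrightarrow> endo V g \<Longrightarrow> endo V (\<lambda>x. f x - g x)"
  by (simp add: endo_def lin_on_def subspace_diff scale_right_diff_distrib algebra_simps)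

lemma endo_scale: "subspace V \<Longrightarrow> endo V f \<Longrightarrow> endo V (\<lambda>x. scale c (f x))"
  by (simp add: endo_def lin_on_def subspace_scale scale_right_distrib mult.commute)

lemma endo_id: "endo V (\<lambda>x. x)"
  by (simp add: endo_def lin_on_def)

lemma endo_scale_id: "subspace V \<Longrightarrow> endo V (\<lambda>x. scale c x)"
  using endo_scale[OF _ endo_id] .

lemma endo_zero: "subspace V \<Longrightarrow> endo V (\<lambda>x. 0)"
  by (simp add: endo_def lin_on_def subspace_0)

lemma endo_sum: "subspace V \<Longrightarrow> (\<And>i. i \<in> I \<Longrightarrow> endo V (g i)) \<Longrightarrow> endo V (\<lambda>x. \<Sum>i\<in>I. g i x)"
  by (induction I rule: infinite_finite_induct) (auto simp: endo_zero intro!: endo_add)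

lemma endo_funpow: "endo V f \<Longrightarrow> endo V (f ^^ n)"
  by (induction n) (auto simp: endo_def lin_on_def)

lemma lin_on_image_subspace:
  assumes "lin_on V f" "subspace V"
  shows "subspace (f ` V)"
proof (rule subspaceI)
  show "0 \<in> f ` V" using lin_on_0[OF assms] subspace_0[OF assms(2)] by (metis imageI)
next
  fix x y assume "x \<in> f ` V" "y \<in> f ` V"
  then obtain u v where "u \<in> V" "v \<in> V" "x = f u" "y = f v" by auto
  then show "x + y \<in> f ` V" using lin_onD(1)[OF assms(1)] subspace_add[OF assms(2)] by (metis imageI)
next
  fix c x assume "x \<in> f ` V"
  then obtain u where "u \<in> V" "x = f u" by auto
  then show "scale c x \<in> f ` V" using lin_onD(2)[OF assms(1)] subspace_scale[OF assms(2)] by (metis imageI)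
qed

lemma lin_on_kernel_subspace:
  assumes "lin_on V f" "subspace V" "subspace U"
  shows "subspace {x \<in> V. f x \<in> U}"
  using assms
  by (auto intro!: subspaceI simp: lin_on_0 lin_onD subspace_0 subspace_add subspace_scale)

lemma lin_on_image_span:
  assumes f: "lin_on V f" and V: "subspace V" and B: "B \<subseteq> V"
  shows "f ` span B \<subseteq> span (f ` B)"
proof
  fix y assume "y \<in> f ` span B"
  then obtain x where x: "x \<in> span B" "y = f x" by auto
  have "f x \<in> span (f ` B) \<and> x \<in> V" using x(1)
  proof (induction rule: span_induct_alt)
    case base then show ?case by (simp add: lin_on_0[OF f V] span_zero subspace_0[OF V])
  next
    case (step c a b)
    have "a \<in> V" using step B(1) by auto
    then have "f (scale c a + b) = scale c (f a) + f b" "scale c a + b \<in> V"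
      using step lin_onD[OF f] subspace_scale[OF V] subspace_add[OF V] by auto
    moreover have "scale c (f a) + f b \<in> span (f ` B)"
      using step by (intro span_add span_scale) (auto intro: span_base)
    ultimately show ?case by simp
  qed
  then show "y \<in> span (f ` B)" using x by simp
qed

lemma fin_subspace_image:
  assumes f: "lin_on V f" and V: "fin_subspace V"
  shows "fin_subspace (f ` V)"
proof -
  obtain B where B: "basis_of V B" using basis_of_exists[OF V] .
  have "f ` V \<subseteq> span (f ` B)"
    using lin_on_image_span[OF f fin_subspace_subspace[OF V] basis_ofD(3)[OF B]] basis_ofD(4)[OF B] by simp
  then show ?thesis unfolding fin_subspace_def
    using lin_on_image_subspace[OF f fin_subspace_subspace[OF V]] basis_ofD(1)[OF B] by auto
qed

text \<open>Extend the kernel vector \<open>x\<close> to a basis: \<open>f x\<close> contributes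
  nothing, so the images of the remaining \<open>dim V - 1\<close> basis vectors span the
  image.\<close>

lemma dim_image_less:
  assumes f: "lin_on V f" and V: "fin_subspace V" and x: "x \<in> V" "x \<noteq> 0" "f x = 0"
  shows "dim (f ` V) < dim V"
proof -
  have sV: "subspace V" using fin_subspace_subspace[OF V] .
  have "independent {x}" using x(2) by (simp add: independent_insert independent_empty)
  then obtain B where B: "{x} \<subseteq> B" "basis_of V B" using basis_extend[OF V, of "{x}"] x(1) by auto
  note Bd = basis_ofD[OF B(2)]
  have "f ` V \<subseteq> span (f ` B)" using lin_on_image_span[OF f sV Bd(3)] Bd(4) by simp
  also have "f ` B = insert 0 (f ` (B - {x}))" using B(1) x(3) by auto
  also have "span (insert 0 (f ` (B - {x}))) = span (f ` (B - {x}))" by (rule span_insert_0)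
  finally have "dim (f ` V) \<le> card (f ` (B - {x}))" by (rule dim_le_card) (use Bd in auto)
  also have "\<dots> \<le> card (B - {x})" by (rule card_image_le) (use Bd in auto)
  also have "\<dots> < card B" using Bd B(1) by (intro psubset_card_mono) auto
  finally show ?thesis using basis_card[OF B(2)] by simp
qed

lemma endo_surj_imp_inj:
  assumes f: "endo V f" and V: "fin_subspace V" and s: "f ` V = V" and x: "x \<in> V" "f x = 0"
  shows "x = 0"
  using dim_image_less[OF endoD(1)[OF f] V x(1) _ x(2)] s by fastforce

text \<open>If the image were a proper subspace, induction would make \<open>f\<close> surjective on
  it. A vector \<open>x\<close> outside the image would then share its value \<open>f x\<close> with
  some \<open>w\<close> inside, against injectivity.\<close>

lemma endo_inj_imp_surj:
  assumes "endo V f" "fin_subspace V" "\<And>x. x \<in> V \<Longrightarrow> f x = 0 \<Longrightarrow> x = 0"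
  shows "f ` V = V"
  using assms
proof (induction "dim V" arbitrary: V rule: less_induct)
  case less
  note f = less.prems(1) and V = less.prems(2) and inj = less.prems(3)
  note sV = fin_subspace_subspace[OF V]
  show ?case
  proof (rule ccontr)
    assume "f ` V \<noteq> V"
    then have W: "f ` V \<subset> V" using endoD(2)[OF f] by auto
    have sW: "subspace (f ` V)" by (rule lin_on_image_subspace[OF endoD(1)[OF f] sV])
    have "endo (f ` V) f" using endoD(2)[OF f] lin_on_subset[OF endoD(1)[OF f]] W by (auto simp: endo_def)
    moreover have "fin_subspace (f ` V)" using fin_subspace_mono[OF V sW] W by blast
    ultimately have ff: "f ` f ` V = f ` V"
      by (rule less.hyps[OF dim_less[OF V sW W]]) (use inj W in blast)
    obtain x where x: "x \<in> V" "x \<notin> f ` V" using W by blast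
    then obtain w where w: "w \<in> f ` V" "f x = f w" using ff by blast
    have wV: "w \<in> V" using w(1) W by blast
    have "f (x - w) = 0" using lin_on_diff[OF endoD(1)[OF f] sV x(1) wV] w(2) by simp
    then have "x - w = 0" by (rule inj[OF subspace_diff[OF sV x(1) wV]])
    then show False using x(2) w(1) by simp
  qed
qed

section \<open>Linear functionals and coordinates\<close>

lemma functional_onD:
  assumes "functional_on V l"
  shows "x \<in> V \<Longrightarrow> y \<in> V \<Longrightarrow> l (x + y) = l x + l y" "x \<in> V \<Longrightarrow> l (scale a x) = a * l x"
  using assms by (auto simp: functional_on_def)

lemma functional_on_0: "functional_on V l \<Longrightarrow> subspace V \<Longrightarrow> l 0 = 0"
  using functional_onD(2)[of V l 0 0] subspace_0[of V] by simp

lemma functional_on_diff: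
  assumes "functional_on V f" "subspace V" "x \<in> V" "y \<in> V"
  shows "f (x - y) = f x - f y"
  using functional_onD(1)[OF assms(1), of "x - y" y] subspace_diff[OF assms(2-4)] assms(4) by simp

lemma functional_on_sum:
  assumes f: "functional_on V f" and V: "subspace V" and "\<And>i. i \<in> I \<Longrightarrow> g i \<in> V"
  shows "f (\<Sum>i\<in>I. g i) = (\<Sum>i\<in>I. f (g i))"
  using assms(3)
proof (induction I rule: infinite_finite_induct)
  case (insert i I)
  then show ?case using functional_onD(1)[OF f, of "g i" "sum g I"] subspace_sum[OF V, of I g] by auto
qed (auto simp: functional_on_0[OF f V])

lemma lin_on_functional_sum:
  assumes "\<And>i. i \<in> I \<Longrightarrow> functional_on V (l i)"
  shows "lin_on V (\<lambda>x. \<Sum>i\<in>I. scale (l i x) (g i))"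
  by (simp add: lin_on_def functional_onD[OF assms] scale_left_distrib sum.distrib scale_sum_right cong: sum.cong)

lemma basis_rep_sum: "basis_of V B \<Longrightarrow> v \<in> V \<Longrightarrow> (\<Sum>b\<in>B. scale (representation B v b) b) = v"
  using sum_representation_eq[of B v B] by (simp add: basis_of_def)

lemma functional_rep:
  assumes "basis_of V B" "functional_on V l" "v \<in> V"
  shows "l v = (\<Sum>b\<in>B. representation B v b * l b)"
proof -
  note Bd = basis_ofD[OF assms(1)]
  have "l v = l (\<Sum>b\<in>B. scale (representation B v b) b)" using basis_rep_sum[OF assms(1,3)] by simp
  also have "\<dots> = (\<Sum>b\<in>B. l (scale (representation B v b) b))"
    by (rule functional_on_sum[OF assms(2) Bd(5)]) (use Bd subspace_scale[OF Bd(5)] in auto)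
  also have "\<dots> = (\<Sum>b\<in>B. representation B v b * l b)"
    by (rule sum.cong) (use Bd functional_onD(2)[OF assms(2)] in auto)
  finally show ?thesis .
qed

lemma functional_representation:
  assumes "basis_of V B"
  shows "functional_on V (\<lambda>v. representation B v b)"
  using basis_ofD[OF assms] by (auto simp: functional_on_def representation_add representation_scale)

lemma functional_comp: "functional_on V l \<Longrightarrow> endo V f \<Longrightarrow> functional_on V (\<lambda>x. l (f x))"
  by (simp add: functional_on_def endo_def lin_on_def)

section \<open>The trace of an endomorphism\<close>

definition trace_on :: "'b set \<Rightarrow> ('b \<Rightarrow> 'b) \<Rightarrow> 'a" where
  "trace_on V f = (let B = (SOME B. basis_of V B) in \<Sum>b\<in>B. representation B (f b) b)"

text \<open>Expanding every \<open>b\<close> in the basis \<open>C\<close> gives a double sum.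
  Summed over \<open>b\<close> first, it becomes the expansion of \<open>f c\<close> in the basis
  \<open>B\<close>, read off at the coordinate \<open>c\<close>.\<close>

lemma trace_basis_indep:
  assumes B: "basis_of V B" and C: "basis_of V C" and f: "endo V f"
  shows "(\<Sum>b\<in>B. representation B (f b) b) = (\<Sum>c\<in>C. representation C (f c) c)"
proof -
  note Bd = basis_ofD[OF B] and Cd = basis_ofD[OF C]
  have "(\<Sum>b\<in>B. representation B (f b) b) = (\<Sum>b\<in>B. \<Sum>c\<in>C. representation C b c * representation B (f c) b)"
    by (rule sum.cong[OF refl], rule functional_rep[OF C functional_comp[OF functional_representation[OF B] f]])
      (use Bd in auto)
  also have "\<dots> = (\<Sum>c\<in>C. \<Sum>b\<in>B. representation B (f c) b * representation C b c)"
    by (subst sum.swap) (simp add: mult.commute)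
  also have "\<dots> = (\<Sum>c\<in>C. representation C (f c) c)"
    by (rule sum.cong[OF refl], rule functional_rep[OF B functional_representation[OF C], symmetric])
      (use Cd endoD(2)[OF f] in auto)
  finally show ?thesis .
qed

lemma trace_on_basis:
  assumes B: "basis_of V B" and f: "endo V f"
  shows "trace_on V f = (\<Sum>b\<in>B. representation B (f b) b)"
  unfolding trace_on_def Let_def
  by (rule trace_basis_indep[OF someI[of "basis_of V", OF B] B f])

lemma trace_cong:
  assumes V: "fin_subspace V" and f: "endo V f" and "\<And>x. x \<in> V \<Longrightarrow> f x = g x"
  shows "trace_on V f = trace_on V g"
proof -
  obtain B where B: "basis_of V B" using basis_of_exists[OF V] .
  have sV: "subspace V" using fin_subspace_subspace[OF V] .
  have g: "endo V g"
    using endoD(2)[OF f] lin_onD[OF endoD(1)[OF f]] subspace_add[OF sV] subspace_scale[OF sV]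
    by (auto simp: endo_def lin_on_def assms(3)[symmetric])
  show ?thesis unfolding trace_on_basis[OF B f] trace_on_basis[OF B g]
    by (rule sum.cong) (use assms(3) basis_ofD[OF B] in auto)
qed

lemma trace_add:
  assumes V: "fin_subspace V" and f: "endo V f" and g: "endo V g"
  shows "trace_on V (\<lambda>x. f x + g x) = trace_on V f + trace_on V g"
proof -
  obtain B where B: "basis_of V B" using basis_of_exists[OF V] .
  have sV: "subspace V" using fin_subspace_subspace[OF V] .
  show ?thesis
    unfolding trace_on_basis[OF B f] trace_on_basis[OF B g] trace_on_basis[OF B endo_add[OF sV f g]]
      sum.distrib[symmetric]
    by (rule sum.cong[OF refl], rule functional_onD(1)[OF functional_representation[OF B]])
      (use basis_ofD[OF B] endoD(2)[OF f] endoD(2)[OF g] in auto)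
qed

lemma trace_scale:
  assumes V: "fin_subspace V" and f: "endo V f"
  shows "trace_on V (\<lambda>x. scale c (f x)) = c * trace_on V f"
proof -
  obtain B where B: "basis_of V B" using basis_of_exists[OF V] .
  have sV: "subspace V" using fin_subspace_subspace[OF V] .
  show ?thesis
    unfolding trace_on_basis[OF B f] trace_on_basis[OF B endo_scale[OF sV f]] sum_distrib_left
    by (rule sum.cong[OF refl], rule functional_onD(2)[OF functional_representation[OF B]])
      (use basis_ofD[OF B] endoD(2)[OF f] in auto)
qed

lemma trace_diff:
  assumes V: "fin_subspace V" and f: "endo V f" and g: "endo V g"
  shows "trace_on V (\<lambda>x. f x - g x) = trace_on V f - trace_on V g"
proof -
  have sV: "subspace V" using fin_subspace_subspace[OF V] .
  show ?thesis using trace_add[OF V endo_diff[OF sV f g] g] by simp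
qed

lemma trace_zero:
  assumes V: "fin_subspace V"
  shows "trace_on V (\<lambda>x. 0) = 0"
  using trace_scale[OF V endo_id, of 0] by simp

lemma trace_sum:
  assumes V: "fin_subspace V" and "\<And>i. i \<in> I \<Longrightarrow> endo V (g i)"
  shows "trace_on V (\<lambda>x. \<Sum>i\<in>I. g i x) = (\<Sum>i\<in>I. trace_on V (g i))"
  using assms(2)
proof (induction I rule: infinite_finite_induct)
  case (insert i I)
  have "trace_on V (\<lambda>x. g i x + (\<Sum>i\<in>I. g i x)) = trace_on V (g i) + trace_on V (\<lambda>x. \<Sum>i\<in>I. g i x)"
    by (rule trace_add[OF V]) (use insert in \<open>auto intro!: endo_sum fin_subspace_subspace[OF V]\<close>)
  then show ?case using insert by simp
qed (auto simp: trace_zero[OF V])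

lemma trace_commute:
  assumes V: "fin_subspace V" and f: "endo V f" and g: "endo V g"
  shows "trace_on V (\<lambda>x. f (g x)) = trace_on V (\<lambda>x. g (f x))"
proof -
  obtain B where B: "basis_of V B" using basis_of_exists[OF V] .
  note Bd = basis_ofD[OF B]
  have *: "trace_on V (\<lambda>x. f (g x)) =
     (\<Sum>b\<in>B. \<Sum>c\<in>B. representation B (g b) c * representation B (f c) b)"
    if f: "endo V f" and g: "endo V g" for f g
    unfolding trace_on_basis[OF B endo_comp[OF f g]]
    by (rule sum.cong[OF refl], rule functional_rep[OF B functional_comp[OF functional_representation[OF B] f]])
      (use Bd endoD(2)[OF g] in auto)
  show ?thesis unfolding *[OF f g] *[OF g f]
    by (subst sum.swap) (simp add: mult.commute)
qed

text \<open>A basis of \<open>W\<close> is extended to one of \<open>V\<close>. The added vectors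
  contribute no diagonal entries, because \<open>f b\<close> lies in \<open>W\<close> and has no
  coordinate there.\<close>

lemma trace_range:
  assumes V: "fin_subspace V" and f: "endo V f" and W: "subspace W" "W \<subseteq> V" and fW: "f ` V \<subseteq> W"
  shows "trace_on V f = trace_on W f"
proof -
  obtain C where C: "basis_of W C" using basis_of_exists fin_subspace_mono[OF V W] by blast
  obtain B where B: "C \<subseteq> B" "basis_of V B"
    using basis_extend[OF V basis_ofD(2)[OF C]] basis_ofD(3)[OF C] W(2) by auto
  note Bd = basis_ofD[OF B(2)] and Cd = basis_ofD[OF C]
  have fe: "endo W f" using f fW W(2) lin_on_subset unfolding endo_def by blast
  have rep: "representation B v = representation C v" if "v \<in> W" for v
    using representation_extend[of B v C] Bd(2) B(1) that Cd(4) by auto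
  have "trace_on V f = (\<Sum>b\<in>B. representation C (f b) b)"
    unfolding trace_on_basis[OF B(2) f]
  proof (rule sum.cong[OF refl])
    fix b assume "b \<in> B"
    then have "f b \<in> W" using fW Bd(3) by auto
    then show "representation B (f b) b = representation C (f b) b" using rep by simp
  qed
  also have "\<dots> = (\<Sum>b\<in>C. representation C (f b) b)"
    using Bd(1) B(1) representation_ne_zero[of C] by (intro sum.mono_neutral_right) blast+
  finally show ?thesis using trace_on_basis[OF C fe] by simp
qed

text \<open>The exponent may depend on \<open>v\<close>. For an endomorphism of a finite dimensional
  space this is ordinary nilpotency, but this form restricts to subspaces at once and says that
  \<open>V\<close> is the generalized eigenspace for 0.\<close>

definition loc_nil :: "'b set \<Rightarrow> ('b \<Rightarrow> 'b) \<Rightarrow> bool" where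
  "loc_nil V f \<longleftrightarrow> (\<forall>v\<in>V. \<exists>n. (f ^^ n) v = 0)"

text \<open>By \<open>trace_range\<close> the trace can be computed on the image, which is smaller
  unless \<open>f\<close> is onto. A surjective \<open>f\<close> is injective, and local nilpotency
  then leaves only \<open>V = {0}\<close>.\<close>

lemma trace_loc_nil:
  assumes "fin_subspace V" "endo V f" "loc_nil V f"
  shows "trace_on V f = 0"
  using assms
proof (induction "dim V" arbitrary: V rule: less_induct)
  case less
  have sV: "subspace V" using less.prems(1) fin_subspace_subspace by blast
  note f = less.prems(2)
  show ?case
  proof (cases "f ` V = V")
    case True
    have "v = 0" if "v \<in> V" for v
    proof -
      obtain n where n: "(f ^^ n) v = 0" using less.prems(3) \<open>v \<in> V\<close> by (auto simp: loc_nil_def)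
      have "(f ^^ n) v = 0 \<Longrightarrow> v = 0"
      proof (induction n)
        case (Suc n)
        then show ?case using endo_surj_imp_inj[OF f less.prems(1) True, of "(f ^^ n) v"]
            endoD(2)[OF endo_funpow[OF f]] \<open>v \<in> V\<close> by simp
      qed simp
      then show ?thesis using n by simp
    qed
    then have "f x = 0" if "x \<in> V" for x using endoD(2)[OF f that] by simp
    then have "trace_on V f = trace_on V (\<lambda>x. 0)" by (rule trace_cong[OF less.prems(1) f])
    then show ?thesis using trace_zero[OF less.prems(1)] by simp
  next
    case False
    let ?W = "f ` V"
    have W: "subspace ?W" "?W \<subset> V" using lin_on_image_subspace[OF endoD(1)[OF f] sV] endoD(2)[OF f] False by auto
    have "trace_on V f = trace_on ?W f" by (rule trace_range[OF less.prems(1) f W(1)]) (use W in auto)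
    also have "\<dots> = 0"
    proof (rule less.hyps)
      show "dim ?W < dim V" by (rule dim_less[OF less.prems(1) W])
      show "fin_subspace ?W" using fin_subspace_mono[OF less.prems(1) W(1)] W(2) by auto
      show "endo ?W f" using f W(2) lin_on_subset unfolding endo_def by blast
      show "loc_nil ?W f" using less.prems(3) W(2) by (auto simp: loc_nil_def)
    qed
    finally show ?thesis .
  qed
qed

section \<open>Bilinear forms and dual bases\<close>

definition bilin_form :: "'b set \<Rightarrow> ('b \<Rightarrow> 'b \<Rightarrow> 'a) \<Rightarrow> bool" where
  "bilin_form W \<beta> \<longleftrightarrow> (\<forall>x\<in>W. functional_on W (\<beta> x)) \<and> (\<forall>y\<in>W. functional_on W (\<lambda>x. \<beta> x y))"

definition nondegenerate_on :: "'b set \<Rightarrow> ('b \<Rightarrow> 'b \<Rightarrow> 'a) \<Rightarrow> bool" where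
  "nondegenerate_on W \<beta> \<longleftrightarrow> (\<forall>x\<in>W. (\<forall>y\<in>W. \<beta> x y = 0) \<longrightarrow> x = 0)"

text \<open>The map \<open>T x = \<Sum> \<beta>(x, b) b\<close> is injective because the form is
  non-degenerate, hence surjective, and the dual basis consists of the preimages of the basis
  vectors. The expansion of \<open>x\<close> holds because both sides pair equally with every
  \<open>b\<close>.\<close>

lemma dual_basis_exists:
  assumes B: "basis_of W B" and \<beta>: "bilin_form W \<beta>"
    and nondeg: "nondegenerate_on W \<beta>"
  obtains e where "\<And>b. b \<in> B \<Longrightarrow> e b \<in> W" "\<And>b c. b \<in> B \<Longrightarrow> c \<in> B \<Longrightarrow> \<beta> (e b) c = (if b = c then 1 else 0)"
    "\<And>x. x \<in> W \<Longrightarrow> x = (\<Sum>b\<in>B. scale (\<beta> x b) (e b))"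
proof -
  note Bd = basis_ofD[OF B]
  have fW: "fin_subspace W" using basis_fin[OF B] .
  define T where "T = (\<lambda>x. \<Sum>b\<in>B. scale (\<beta> x b) b)"
  have b1: "functional_on W (\<beta> x)" and b2: "functional_on W (\<lambda>x. \<beta> x y)" if "x \<in> W" "y \<in> W" for x y
    using \<beta> that by (auto simp: bilin_form_def)
  have TW: "T x \<in> W" if "x \<in> W" for x
    unfolding T_def using Bd by (intro subspace_sum subspace_scale) auto
  have "lin_on W T" unfolding T_def by (rule lin_on_functional_sum) (use b2 Bd(3) in blast)
  then have T: "endo W T" using TW by (simp add: endo_def)
  have repT: "representation B (T x) b = \<beta> x b" if "b \<in> B" for x b
  proof -
    have f: "functional_on W (\<lambda>v. representation B v b)" by (rule functional_representation[OF B])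
    have "representation B (T x) b = (\<Sum>c\<in>B. representation B (scale (\<beta> x c) c) b)"
      unfolding T_def
      by (rule functional_on_sum[OF f Bd(5)]) (use Bd subspace_scale in auto)
    also have "\<dots> = (\<Sum>c\<in>B. \<beta> x c * (if c = b then 1 else 0))"
    proof (rule sum.cong[OF refl])
      fix c assume c: "c \<in> B"
      then have "representation B (scale (\<beta> x c) c) b = \<beta> x c * representation B c b"
        using functional_onD(2)[OF f] Bd by auto
      then show "representation B (scale (\<beta> x c) c) b = \<beta> x c * (if c = b then 1 else 0)"
        using representation_basis[OF Bd(2) c] by simp
    qed
    also have "\<dots> = \<beta> x b" using Bd(1) that by (simp add: if_distrib sum.delta cong: if_cong)
    finally show ?thesis .
  qed
  have ext: "x = 0" if x: "x \<in> W" and z: "\<And>b. b \<in> B \<Longrightarrow> \<beta> x b = 0" for x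
  proof -
    have "\<beta> x y = 0" if y: "y \<in> W" for y using functional_rep[OF B b1[OF x x] y] z by simp
    then show ?thesis using nondeg x unfolding nondegenerate_on_def by blast
  qed
  have "T ` W = W"
  proof (rule endo_inj_imp_surj[OF T fW])
    fix x assume x: "x \<in> W" "T x = 0"
    then show "x = 0" using ext[OF x(1)] repT[of _ x] by (simp add: representation_zero)
  qed
  then have "\<exists>x\<in>W. T x = b" if "b \<in> B" for b using that Bd(3) by (metis imageE subsetD)
  then obtain e where e: "\<And>b. b \<in> B \<Longrightarrow> e b \<in> W" "\<And>b. b \<in> B \<Longrightarrow> T (e b) = b" by metis
  have e2: "\<beta> (e b) c = (if b = c then 1 else 0)" if "b \<in> B" "c \<in> B" for b c
    using repT[OF that(2), of "e b"] e(2)[OF that(1)] representation_basis[OF Bd(2) that(1)]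
    by (simp split: if_splits)
  have e3: "x = (\<Sum>b\<in>B. scale (\<beta> x b) (e b))" if x: "x \<in> W" for x
  proof -
    let ?s = "\<Sum>b\<in>B. scale (\<beta> x b) (e b)"
    have s: "?s \<in> W" using e Bd by (intro subspace_sum subspace_scale) auto
    have "x - ?s = 0"
    proof (rule ext)
      show "x - ?s \<in> W" using x s subspace_diff[OF Bd(5)] by auto
      fix c assume c: "c \<in> B"
      then have cW: "c \<in> W" using Bd by auto
      have "\<beta> ?s c = (\<Sum>b\<in>B. \<beta> (scale (\<beta> x b) (e b)) c)"
        by (rule functional_on_sum[OF b2[OF cW cW] Bd(5)]) (use e subspace_scale[OF Bd(5)] in auto)
      also have "\<dots> = (\<Sum>b\<in>B. \<beta> x b * (if b = c then 1 else 0))"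
        by (rule sum.cong[OF refl]) (use functional_onD(2)[OF b2[OF cW cW]] e e2 c in auto)
      also have "\<dots> = \<beta> x c" using Bd(1) c by (simp add: if_distrib sum.delta cong: if_cong)
      finally show "\<beta> (x - ?s) c = 0" using functional_on_diff[OF b2[OF cW cW] Bd(5) x s] by simp
    qed
    then show ?thesis by simp
  qed
  show ?thesis using that e(1) e2 e3 by blast
qed

lemma riesz:
  assumes W: "fin_subspace W" and \<beta>: "bilin_form W \<beta>"
    and nondeg: "nondegenerate_on W \<beta>"
    and l: "functional_on W l"
  obtains w where "w \<in> W" "\<And>y. y \<in> W \<Longrightarrow> l y = \<beta> w y"
proof -
  obtain B where B: "basis_of W B" using basis_of_exists[OF W] .
  note Bd = basis_ofD[OF B]
  obtain e where e: "\<And>b. b \<in> B \<Longrightarrow> e b \<in> W" "\<And>b c. b \<in> B \<Longrightarrow> c \<in> B \<Longrightarrow> \<beta> (e b) c = (if b = c then 1 else 0)"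
    using dual_basis_exists[OF B \<beta> nondeg] by metis
  define w where "w = (\<Sum>b\<in>B. scale (l b) (e b))"
  have w: "w \<in> W" unfolding w_def using e Bd by (intro subspace_sum subspace_scale) auto
  have b1: "functional_on W (\<beta> x)" and b2: "functional_on W (\<lambda>x. \<beta> x y)" if "x \<in> W" "y \<in> W" for x y
    using \<beta> that by (auto simp: bilin_form_def)
  have wc: "\<beta> w c = l c" if c: "c \<in> B" for c
  proof -
    have cW: "c \<in> W" using Bd c by auto
    have "\<beta> w c = (\<Sum>b\<in>B. \<beta> (scale (l b) (e b)) c)" unfolding w_def
      by (rule functional_on_sum[OF b2[OF cW cW] Bd(5)]) (use e subspace_scale[OF Bd(5)] in auto)
    also have "\<dots> = (\<Sum>b\<in>B. l b * (if b = c then 1 else 0))"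
      by (rule sum.cong[OF refl]) (use functional_onD(2)[OF b2[OF cW cW]] e c in auto)
    also have "\<dots> = l c" using Bd(1) c by (simp add: if_distrib sum.delta cong: if_cong)
    finally show ?thesis .
  qed
  show ?thesis
  proof (rule that[OF w])
    fix y assume y: "y \<in> W"
    show "l y = \<beta> w y" unfolding functional_rep[OF B l y] functional_rep[OF B b1[OF w w] y] using wc by simp
  qed
qed

lemma functional_kernel_subspace:
  assumes "functional_on V l" "subspace V"
  shows "subspace {x \<in> V. l x = 0}"
  using assms
  by (auto intro!: subspaceI simp: functional_on_0 functional_onD subspace_0 subspace_add subspace_scale)

lemma functional_zero_span:
  assumes l: "functional_on V l" and V: "subspace V" and A: "A \<subseteq> V" "V \<subseteq> span A"
    and z: "\<And>a. a \<in> A \<Longrightarrow> l a = 0" and x: "x \<in> V"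
  shows "l x = 0"
proof -
  have "span A \<subseteq> {x \<in> V. l x = 0}"
    by (rule span_minimal[OF _ functional_kernel_subspace[OF l V]]) (use A z in auto)
  then show ?thesis using x A(2) by blast
qed

lemma trace_functional:
  assumes V: "fin_subspace V" and F: "\<And>x. x \<in> N \<Longrightarrow> endo V (F x)" and N: "subspace N"
    and add: "\<And>x y v. x \<in> N \<Longrightarrow> y \<in> N \<Longrightarrow> v \<in> V \<Longrightarrow> F (x + y) v = F x v + F y v"
    and sc: "\<And>a x v. x \<in> N \<Longrightarrow> v \<in> V \<Longrightarrow> F (scale a x) v = scale a (F x v)"
  shows "functional_on N (\<lambda>x. trace_on V (F x))"
  unfolding functional_on_def
proof (intro conjI ballI allI)
  fix x y assume xy: "x \<in> N" "y \<in> N"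
  have "trace_on V (F (x + y)) = trace_on V (\<lambda>v. F x v + F y v)"
    by (rule trace_cong[OF V F[OF subspace_add[OF N xy]] add[OF xy]])
  then show "trace_on V (F (x + y)) = trace_on V (F x) + trace_on V (F y)"
    using trace_add[OF V F[OF xy(1)] F[OF xy(2)]] by simp
next
  fix a x assume x: "x \<in> N"
  have "trace_on V (F (scale a x)) = trace_on V (\<lambda>v. scale a (F x v))"
    by (rule trace_cong[OF V F[OF subspace_scale[OF N x]] sc[OF x]])
  then show "trace_on V (F (scale a x)) = a * trace_on V (F x)"
    using trace_scale[OF V F[OF x]] by simp
qed

lemma bilin_formD:
  assumes "bilin_form W \<beta>"
  shows "x \<in> W \<Longrightarrow> functional_on W (\<beta> x)" "y \<in> W \<Longrightarrow> functional_on W (\<lambda>x. \<beta> x y)"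
  using assms by (auto simp: bilin_form_def)

lemma functional_on_subset: "functional_on V l \<Longrightarrow> U \<subseteq> V \<Longrightarrow> functional_on U l"
  unfolding functional_on_def by (meson subsetD)

lemma bilin_form_subset: "bilin_form W \<beta> \<Longrightarrow> U \<subseteq> W \<Longrightarrow> bilin_form U \<beta>"
  unfolding bilin_form_def using functional_on_subset by (meson subsetD)

lemma endo_injective:
  assumes f: "endo V f" and V: "subspace V" and inj: "\<And>x. x \<in> V \<Longrightarrow> f x = 0 \<Longrightarrow> x = 0"
    and x: "x \<in> V" and y: "y \<in> V" and eq: "f x = f y"
  shows "x = y"
proof -
  have "f (x - y) = 0" using lin_on_diff[OF endoD(1)[OF f] V x y] eq by simp
  then have "x - y = 0" by (rule inj[OF subspace_diff[OF V x y]])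
  then show ?thesis by simp
qed

end

section \<open>Generalized eigenspaces\<close>

locale ac_space = vec_space scale
  for scale :: "'k::{alg_closed_field, field_char_0} \<Rightarrow> 'b::ab_group_add \<Rightarrow> 'b"
begin

definition gen_eig :: "'b set \<Rightarrow> ('b \<Rightarrow> 'b) \<Rightarrow> 'k \<Rightarrow> 'b set" where
  "gen_eig V f a = {v \<in> V. \<exists>n. ((\<lambda>x. f x - scale a x) ^^ n) v = 0}"

lemma endo_shift: "subspace V \<Longrightarrow> endo V f \<Longrightarrow> endo V (\<lambda>x. f x - scale a x)"
  by (intro endo_diff endo_scale_id)

lemma gen_eig_subset: "gen_eig V f a \<subseteq> V"
  by (auto simp: gen_eig_def)

lemma funpow_zero_mono:
  assumes "subspace V" "endo V g" "(g ^^ n) v = 0" "n \<le> m"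
  shows "(g ^^ m) v = 0"
proof -
  have "g 0 = 0" using lin_on_0[OF endoD(1)[OF assms(2)] assms(1)] .
  then have z: "(g ^^ k) 0 = 0" for k by (induction k) auto
  have "(g ^^ m) v = (g ^^ (m - n)) ((g ^^ n) v)"
    using assms(4) by (metis add.commute comp_apply funpow_add le_add_diff_inverse)
  then show ?thesis using assms(3) z by simp
qed

lemma gen_eig_subspace:
  assumes V: "subspace V" and f: "endo V f"
  shows "subspace (gen_eig V f a)"
proof -
  let ?g = "\<lambda>x. f x - scale a x"
  have g: "endo V ?g" using endo_shift[OF V f] .
  note gn = endoD(1)[OF endo_funpow[OF g]]
  show ?thesis
  proof (rule subspaceI)
    have "(?g ^^ 0) 0 = 0" by simp
    then show "0 \<in> gen_eig V f a" unfolding gen_eig_def using subspace_0[OF V] by blast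
  next
    fix x y assume "x \<in> gen_eig V f a" "y \<in> gen_eig V f a"
    then obtain n m where nm: "x \<in> V" "y \<in> V" "(?g ^^ n) x = 0" "(?g ^^ m) y = 0"
      by (auto simp: gen_eig_def)
    have "(?g ^^ (n + m)) (x + y) = (?g ^^ (n + m)) x + (?g ^^ (n + m)) y"
      using lin_onD(1)[OF gn nm(1,2)] .
    also have "\<dots> = 0"
      using funpow_zero_mono[OF V g nm(3), of "n + m"] funpow_zero_mono[OF V g nm(4), of "n + m"] by simp
    finally show "x + y \<in> gen_eig V f a" unfolding gen_eig_def using subspace_add[OF V nm(1,2)] by blast
  next
    fix c x assume "x \<in> gen_eig V f a"
    then obtain n where n: "x \<in> V" "(?g ^^ n) x = 0" by (auto simp: gen_eig_def)
    have "(?g ^^ n) (scale c x) = 0" using lin_onD(2)[OF gn n(1)] n(2) by simp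
    then show "scale c x \<in> gen_eig V f a" unfolding gen_eig_def using subspace_scale[OF V n(1)] by blast
  qed
qed

lemma gen_eig_shiftI:
  assumes "v \<in> V" "f v - scale a v \<in> gen_eig V f a"
  shows "v \<in> gen_eig V f a"
proof -
  let ?g = "\<lambda>x. f x - scale a x"
  obtain n where "(?g ^^ n) (?g v) = 0" using assms(2) by (auto simp: gen_eig_def)
  then have "(?g ^^ Suc n) v = 0" by (simp only: funpow_Suc_right o_apply)
  then show ?thesis unfolding gen_eig_def using assms(1) by blast
qed

lemma gen_eig_shift:
  assumes V: "subspace V" and f: "endo V f" and v: "v \<in> gen_eig V f a"
  shows "f v - scale b v \<in> gen_eig V f a"
proof -
  let ?g = "\<lambda>x. f x - scale a x"
  have g: "endo V ?g" using endo_shift[OF V f] .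
  obtain n where n: "v \<in> V" "(?g ^^ n) v = 0" using v by (auto simp: gen_eig_def)
  have "(?g ^^ Suc n) v = 0" using funpow_zero_mono[OF V g n(2), of "Suc n"] le_SucI[OF order_refl] by blast
  then have "(?g ^^ n) (?g v) = 0" by (simp only: funpow_Suc_right o_apply)
  then have *: "?g v \<in> gen_eig V f a" unfolding gen_eig_def using endoD(2)[OF g n(1)] by blast
  have eq: "f v - scale b v = ?g v + scale (a - b) v" by (simp add: scale_left_diff_distrib)
  show ?thesis unfolding eq
    by (rule subspace_add[OF gen_eig_subspace[OF V f] * subspace_scale[OF gen_eig_subspace[OF V f] v]])
qed

text \<open>Applying \<open>f - a\<close> lowers the exponent that kills \<open>v\<close>. Induction
  on that exponent is packaged here so that later proofs meet neither powers nor binomial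
  expansions.\<close>

lemma gen_eig_induct [consumes 3, case_names zero step]:
  assumes V: "subspace V" and f: "endo V f" and v: "v \<in> gen_eig V f a"
    and zero: "P 0" and step: "\<And>w. w \<in> gen_eig V f a \<Longrightarrow> P (f w - scale a w) \<Longrightarrow> P w"
  shows "P v"
proof -
  let ?g = "\<lambda>x. f x - scale a x"
  obtain n where "(?g ^^ n) v = 0" using v by (auto simp: gen_eig_def)
  then show ?thesis using v
  proof (induction n arbitrary: v)
    case 0
    then show ?case using zero by simp
  next
    case (Suc n)
    have "(?g ^^ n) (?g v) = 0" using Suc.prems(1) by (simp only: funpow_Suc_right o_apply)
    then show ?case using Suc.IH gen_eig_shift[OF V f Suc.prems(2), of a] step[OF Suc.prems(2)] by blast
  qed
qed

definition other_eig :: "'b set \<Rightarrow> ('b \<Rightarrow> 'b) \<Rightarrow> 'k \<Rightarrow> 'b set" where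
  "other_eig V f a = span (\<Union>c\<in>-{a}. gen_eig V f c)"

lemma other_eig_subset: "subspace V \<Longrightarrow> other_eig V f a \<subseteq> V"
  unfolding other_eig_def by (rule span_minimal) (auto simp: gen_eig_def)

text \<open>On a generalized eigenspace for \<open>c \<noteq> a\<close> the map \<open>f - a\<close> is the sum of the non-zero scalar
  \<open>c - a\<close> and a nilpotent map.\<close>

lemma other_eig_surj:
  assumes V: "subspace V" and f: "endo V f"
  shows "(\<lambda>x. f x - scale a x) ` other_eig V f a = other_eig V f a"
proof
  let ?g = "\<lambda>x. f x - scale a x"
  let ?U = "other_eig V f a"
  have sU: "subspace ?U" unfolding other_eig_def by (rule subspace_span)
  have UV: "?U \<subseteq> V" by (rule other_eig_subset[OF V])
  have g: "lin_on ?U ?g" using lin_on_subset[OF endoD(1)[OF endo_shift[OF V f]] UV] .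
  have genU: "gen_eig V f c \<subseteq> ?U" if "c \<noteq> a" for c
    unfolding other_eig_def using that by (intro subsetI span_base) auto
  have "?U \<subseteq> {x \<in> V. ?g x \<in> ?U}"
    unfolding other_eig_def
  proof (rule span_minimal)
    show "subspace {x \<in> V. ?g x \<in> span (\<Union>c\<in>-{a}. gen_eig V f c)}"
      by (rule lin_on_kernel_subspace[OF endoD(1)[OF endo_shift[OF V f]] V subspace_span])
    show "(\<Union>c\<in>-{a}. gen_eig V f c) \<subseteq> {x \<in> V. ?g x \<in> span (\<Union>c\<in>-{a}. gen_eig V f c)}"
    proof
      fix x assume "x \<in> (\<Union>c\<in>-{a}. gen_eig V f c)"
      then obtain c where c: "c \<noteq> a" "x \<in> gen_eig V f c" by auto
      then show "x \<in> {x \<in> V. ?g x \<in> span (\<Union>c\<in>-{a}. gen_eig V f c)}"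
        using gen_eig_shift[OF V f c(2), of a] genU[OF c(1)] gen_eig_subset[of V f c]
        unfolding other_eig_def by auto
    qed
  qed
  then show "?g ` ?U \<subseteq> ?U" by auto
  have im: "subspace (?g ` ?U)" by (rule lin_on_image_subspace[OF g sU])
  have "gen_eig V f c \<subseteq> ?g ` ?U" if c: "c \<noteq> a" for c
  proof
    fix v assume "v \<in> gen_eig V f c"
    then show "v \<in> ?g ` ?U"
    proof (induction rule: gen_eig_induct[OF V f, consumes 1, case_names zero step])
      case zero
      then show ?case by (rule subspace_0[OF im])
    next
      case (step w)
      have "?g w \<in> ?g ` ?U" using step(1) genU[OF c] by auto
      then have "scale (inverse (c - a)) (?g w - (f w - scale c w)) \<in> ?g ` ?U"
        by (rule subspace_scale[OF im subspace_diff[OF im _ step(2)]])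
      moreover have "?g w - (f w - scale c w) = scale (c - a) w" by (simp add: scale_left_diff_distrib)
      ultimately show ?case using c by simp
    qed
  qed
  then have "(\<Union>c\<in>-{a}. gen_eig V f c) \<subseteq> ?g ` ?U" by auto
  then show "?U \<subseteq> ?g ` ?U" using span_minimal[OF _ im] by (subst (1) other_eig_def)
qed

text \<open>On the span of the other generalized eigenspaces \<open>f - a\<close> is onto, hence
  injective. A vector in the intersection is killed by a power of \<open>f - a\<close>, so by
  induction on the exponent it is 0.\<close>

lemma other_eig_inter:
  assumes V: "fin_subspace V" and f: "endo V f" and v: "v \<in> gen_eig V f a" "v \<in> other_eig V f a"
  shows "v = 0"
proof -
  have sV: "subspace V" using fin_subspace_subspace[OF V] .
  let ?g = "\<lambda>x. f x - scale a x"
  let ?U = "other_eig V f a"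
  have UV: "?U \<subseteq> V" by (rule other_eig_subset[OF sV])
  have fU: "fin_subspace ?U" using fin_subspace_mono[OF V _ UV] by (simp add: other_eig_def subspace_span)
  have s: "?g ` ?U = ?U" using other_eig_surj[OF sV f] .
  have e: "endo ?U ?g" using lin_on_subset[OF endoD(1)[OF endo_shift[OF sV f]] UV] s
    unfolding endo_def by blast
  have "w \<in> ?U \<longrightarrow> w = 0" if "w \<in> gen_eig V f a" for w
    using that
  proof (induction rule: gen_eig_induct[OF sV f, consumes 1, case_names zero step])
    case (step w)
    then show ?case using endo_surj_imp_inj[OF e fU s] endoD(2)[OF e] by blast
  qed simp
  then show ?thesis using v by blast
qed

section \<open>Polynomials in an endomorphism and spanning by generalized eigenspaces\<close>

definition poly_act :: "('b \<Rightarrow> 'b) \<Rightarrow> 'k poly \<Rightarrow> 'b \<Rightarrow> 'b" where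
  "poly_act f p v = (\<Sum>i\<le>degree p. scale (coeff p i) ((f ^^ i) v))"

lemma poly_act_eq:
  assumes "degree p \<le> n"
  shows "poly_act f p v = (\<Sum>i\<le>n. scale (coeff p i) ((f ^^ i) v))"
  unfolding poly_act_def
  by (rule sum.mono_neutral_left) (use assms in \<open>auto simp: coeff_eq_0\<close>)

lemma poly_act_in: "subspace V \<Longrightarrow> endo V f \<Longrightarrow> v \<in> V \<Longrightarrow> poly_act f p v \<in> V"
  unfolding poly_act_def
  by (intro subspace_sum subspace_scale) (auto intro: endoD(2)[OF endo_funpow])

lemma poly_act_linear_factor:
  assumes V: "subspace V" and f: "endo V f" and v: "v \<in> V"
  shows "poly_act f ([:-a, 1:] * q) v = f (poly_act f q v) - scale a (poly_act f q v)"
proof -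
  let ?n = "degree q"
  have fn: "(f ^^ i) v \<in> V" for i using endoD(2)[OF endo_funpow[OF f] v] .
  have eq: "[:-a, 1:] * q = pCons 0 q - smult a q" by simp
  have deg: "degree (pCons 0 q - smult a q) \<le> Suc ?n"
    by (intro degree_diff_le) (auto simp: degree_pCons_le degree_smult_le le_SucI)
  have "poly_act f ([:-a, 1:] * q) v
    = (\<Sum>i\<le>Suc ?n. scale (coeff (pCons 0 q) i) ((f ^^ i) v)) - (\<Sum>i\<le>Suc ?n. scale (coeff (smult a q) i) ((f ^^ i) v))"
    unfolding eq poly_act_eq[OF deg] by (simp only: coeff_diff scale_left_diff_distrib sum_subtractf)
  also have "(\<Sum>i\<le>Suc ?n. scale (coeff (pCons 0 q) i) ((f ^^ i) v)) = (\<Sum>i\<le>?n. scale (coeff q i) (f ((f ^^ i) v)))"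
    by (subst sum.atMost_Suc_shift) simp
  also have "\<dots> = f (\<Sum>i\<le>?n. scale (coeff q i) ((f ^^ i) v))"
    by (subst lin_on_sum[OF endoD(1)[OF f] V])
      (auto simp: lin_onD(2)[OF endoD(1)[OF f]] fn intro!: subspace_scale[OF V])
  also have "(\<Sum>i\<le>?n. scale (coeff q i) ((f ^^ i) v)) = poly_act f q v"
    by (simp add: poly_act_def)
  also have "(\<Sum>i\<le>Suc ?n. scale (coeff (smult a q) i) ((f ^^ i) v)) = scale a (poly_act f q v)"
    unfolding poly_act_eq[of q "Suc ?n", OF le_SucI[OF order_refl]] scale_sum_right by simp
  finally show ?thesis .
qed

text \<open>The vectors \<open>f^i v\<close> for \<open>i \<le> card T\<close> lie in the span of
  \<open>card T\<close> elements. Since \<open>dependent\<close> speaks of sets and not of families,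
  two coinciding powers form a separate case, where \<open>X^j - X^i\<close> is the
  polynomial.\<close>

lemma poly_act_kills:
  assumes V: "fin_subspace V" and f: "endo V f" and v: "v \<in> V"
  obtains p where "p \<noteq> 0" "poly_act f p v = 0"
proof -
  obtain T where T: "finite T" "V \<subseteq> span T" using V by (auto simp: fin_subspace_def)
  have fn: "(f ^^ i) v \<in> V" for i using endoD(2)[OF endo_funpow[OF f] v] .
  let ?n = "card T"
  show ?thesis
  proof (cases "inj_on (\<lambda>i. (f ^^ i) v) {..?n}")
    case True
    let ?S = "(\<lambda>i. (f ^^ i) v) ` {..?n}"
    have "card ?S = Suc ?n" using card_image[OF True] by simp
    moreover have "?S \<subseteq> span T" using fn T(2) by auto
    ultimately have "dependent ?S" using independent_span_bound[OF T(1), of ?S] by auto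
    then obtain u w where u: "w \<in> ?S" "u w \<noteq> 0" "(\<Sum>x\<in>?S. scale (u x) x) = 0"
      unfolding dependent_finite[OF finite_imageI[OF finite_atMost]] by blast
    have s0: "(\<Sum>i\<le>?n. scale (u ((f ^^ i) v)) ((f ^^ i) v)) = 0"
      using u(3) sum.reindex[OF True, of "\<lambda>x. scale (u x) x"] by simp
    define p where "p = (\<Sum>i\<le>?n. monom (u ((f ^^ i) v)) i)"
    have cp: "coeff p j = (if j \<le> ?n then u ((f ^^ j) v) else 0)" for j
      unfolding p_def by (simp add: coeff_sum coeff_monom)
    obtain i where i: "i \<le> ?n" "w = (f ^^ i) v" using u(1) by auto
    have "coeff p i \<noteq> 0" using cp i u(2) by simp
    then have "p \<noteq> 0" by auto
    moreover have "degree p \<le> ?n" by (rule degree_le) (simp add: cp)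
    then have "poly_act f p v = 0" using s0 by (simp add: poly_act_eq cp)
    ultimately show ?thesis using that by blast
  next
    case False
    then obtain i j where ij: "i < j" "(f ^^ i) v = (f ^^ j) v"
      unfolding inj_on_def by (metis nat_neq_iff)
    define p where "p = monom (1::'k) j - monom 1 i"
    have "coeff p j = 1" using ij(1) by (simp add: p_def)
    then have p0: "p \<noteq> 0" by auto
    have "degree p \<le> j" unfolding p_def
      using ij(1) by (intro degree_diff_le) (auto simp: degree_monom_eq)
    then have "poly_act f p v = (\<Sum>m\<le>j. scale (coeff p m) ((f ^^ m) v))" by (rule poly_act_eq)
    also have "\<dots> = (\<Sum>m\<le>j. (if m = j then (f ^^ m) v else 0)) - (\<Sum>m\<le>j. (if m = i then (f ^^ m) v else 0))"
      unfolding sum_subtractf[symmetric] by (rule sum.cong) (auto simp: p_def)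
    also have "\<dots> = 0" using ij by (simp add: sum.delta)
    finally show ?thesis using that p0 by blast
  qed
qed

text \<open>This is an eigenvector of \<open>V/U\<close>, found without forming the quotient. Take a
  non-zero \<open>p\<close> of least degree with \<open>p(f) w \<in> U\<close> and split off a root,
  \<open>p = (X - a) q\<close>; minimality keeps \<open>q(f) w\<close> outside
  \<open>U\<close>.\<close>

lemma eigenvector_mod:
  assumes V: "fin_subspace V" and f: "endo V f" and U: "subspace U" and w: "w \<in> V" "w \<notin> U"
  obtains a x where "x \<in> V" "x \<notin> U" "f x - scale a x \<in> U"
proof -
  have sV: "subspace V" using fin_subspace_subspace[OF V] .
  let ?P = "\<lambda>p. p \<noteq> 0 \<and> poly_act f p w \<in> U"
  obtain p0 where "?P p0" using poly_act_kills[OF V f w(1)] subspace_0[OF U] by metis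
  then obtain p where p: "?P p" and min: "\<And>q. ?P q \<Longrightarrow> degree p \<le> degree q"
    using ex_has_least_nat[of ?P p0 degree] by blast
  have "degree p \<noteq> 0"
  proof
    assume "degree p = 0"
    then obtain c where c: "p = [:c:]" by (rule degree_eq_zeroE)
    then have "scale c w \<in> U" "c \<noteq> 0" using p by (auto simp: poly_act_def)
    then have "scale (inverse c) (scale c w) \<in> U" using subspace_scale[OF U] by blast
    then show False using \<open>c \<noteq> 0\<close> w by simp
  qed
  then obtain a where "poly p a = 0" using alg_closed_imp_poly_has_root[of p] by auto
  then obtain q where q: "p = [:-a, 1:] * q" by (metis poly_eq_0_iff_dvd dvdE)
  have q0: "q \<noteq> 0" using p q by auto
  have "degree p = Suc (degree q)" unfolding q using q0 by (subst degree_mult_eq) auto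
  then have "poly_act f q w \<notin> U" using min[of q] q0 by auto
  moreover have "poly_act f q w \<in> V" by (rule poly_act_in[OF sV f w(1)])
  moreover have "f (poly_act f q w) - scale a (poly_act f q w) \<in> U"
    using p poly_act_linear_factor[OF sV f w(1)] q by metis
  ultimately show ?thesis using that by blast
qed

text \<open>Otherwise there is an eigenvector \<open>x\<close> modulo the span. Write
  \<open>(f - a) x = u + u'\<close> with \<open>u\<close> a generalized eigenvector for
  \<open>a\<close> and \<open>u'\<close> in the sum of the others. As \<open>f - a\<close> is onto
  there, \<open>u' = (f - a) y\<close>, so \<open>x - y\<close> is a generalized eigenvector for
  \<open>a\<close>, and \<open>x\<close> lies in the span after all.\<close>

lemma gen_eig_span:
  assumes V: "fin_subspace V" and f: "endo V f"
  shows "span (\<Union>a. gen_eig V f a) = V"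
proof (rule ccontr)
  let ?U = "span (\<Union>a. gen_eig V f a)"
  assume ne: "?U \<noteq> V"
  have sV: "subspace V" using fin_subspace_subspace[OF V] .
  have "?U \<subseteq> V" by (rule span_minimal[OF _ sV]) (auto simp: gen_eig_def)
  then obtain w where "w \<in> V" "w \<notin> ?U" using ne by auto
  then obtain a x where x: "x \<in> V" "x \<notin> ?U" "f x - scale a x \<in> ?U"
    using eigenvector_mod[OF V f subspace_span] by metis
  have "?U = span (gen_eig V f a \<union> (\<Union>c\<in>-{a}. gen_eig V f c))"
    by (rule arg_cong[where f = span]) auto
  also have "\<dots> = {u + u' | u u'. u \<in> gen_eig V f a \<and> u' \<in> other_eig V f a}"
    unfolding span_Un other_eig_def[symmetric] span_eq_iff[THEN iffD2, OF gen_eig_subspace[OF sV f]] by blast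
  finally obtain u u' where u: "u \<in> gen_eig V f a" "u' \<in> other_eig V f a" "f x - scale a x = u + u'"
    using x(3) by blast
  obtain y where y: "y \<in> other_eig V f a" "u' = f y - scale a y"
    using u(2) other_eig_surj[OF sV f, of a] by auto
  have yV: "y \<in> V" using y other_eig_subset[OF sV] by blast
  have "f (x - y) - scale a (x - y) = (f x - scale a x) - (f y - scale a y)"
    unfolding lin_on_diff[OF endoD(1)[OF f] sV x(1) yV] scale_right_diff_distrib by simp
  also have "\<dots> = u" using u(3) y(2) by simp
  finally have "f (x - y) - scale a (x - y) = u" .
  then have "x - y \<in> gen_eig V f a"
    using gen_eig_shiftI[of "x - y" V f a] u(1) subspace_diff[OF sV x(1) yV] by simp
  then have "x - y \<in> ?U" by (intro span_base) auto
  moreover have "y \<in> ?U"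
    using y(1) span_mono[of "\<Union>c\<in>-{a}. gen_eig V f c" "\<Union>c. gen_eig V f c"] unfolding other_eig_def by blast
  ultimately have "(x - y) + y \<in> ?U" by (rule span_add)
  then show False using x(2) by simp
qed

lemma gen_eig_basis:
  assumes V: "fin_subspace V" and f: "endo V f"
  obtains B ev where "basis_of V B" "\<And>b. b \<in> B \<Longrightarrow> b \<in> gen_eig V f (ev b)"
proof -
  have "(\<Union>a. gen_eig V f a) \<subseteq> V" by (auto simp: gen_eig_def)
  then obtain B where B: "B \<subseteq> (\<Union>a. gen_eig V f a)" "basis_of V B"
    using basis_subset_span[OF V, of "\<Union>a. gen_eig V f a"] gen_eig_span[OF V f] by auto
  then have "\<exists>a. b \<in> gen_eig V f a" if "b \<in> B" for b using that by auto
  then show ?thesis using that B(2) by metis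
qed

text \<open>For \<open>\<phi>\<close> the identity this is the semisimple part of \<open>f\<close>.
  It is defined on a basis of generalized eigenvectors; the value is right on all other generalized
  eigenvectors too, because these have zero coordinates at basis vectors with another eigenvalue, by
  \<open>other_eig_inter\<close>.\<close>

lemma gen_eig_scalar_map:
  assumes V: "fin_subspace V" and f: "endo V f"
  obtains y where "endo V y" "\<And>a v. v \<in> gen_eig V f a \<Longrightarrow> y v = scale (\<phi> a) v"
proof -
  have sV: "subspace V" using fin_subspace_subspace[OF V] .
  obtain B ev where B: "basis_of V B" and ev: "\<And>b. b \<in> B \<Longrightarrow> b \<in> gen_eig V f (ev b)"
    using gen_eig_basis[OF V f] by metis
  note Bd = basis_ofD[OF B]
  define y where "y = (\<lambda>v. \<Sum>b\<in>B. scale (representation B v b * \<phi> (ev b)) b)"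
  have "functional_on V (\<lambda>v. representation B v b * \<phi> (ev b))" for b
    using functional_onD[OF functional_representation[OF B]] by (simp add: functional_on_def distrib_right)
  then have "lin_on V y" unfolding y_def by (rule lin_on_functional_sum)
  moreover have "y u \<in> V" for u
    unfolding y_def by (intro subspace_sum[OF sV] subspace_scale[OF sV]) (use Bd in auto)
  ultimately have "endo V y" by (simp add: endo_def)
  moreover have "y v = scale (\<phi> a) v" if v: "v \<in> gen_eig V f a" for a v
  proof -
    have vV: "v \<in> V" using v gen_eig_subset by blast
    have rep: "representation B v b = 0" if "b \<in> B" "ev b \<noteq> a" for b
    proof -
      let ?A = "{b \<in> B. ev b = a}" and ?C = "{b \<in> B. ev b \<noteq> a}"
      let ?r = "\<lambda>b. scale (representation B v b) b"
      have fin: "finite ?A" "finite ?C" using Bd(1) by auto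
      have "v = sum ?r B" using basis_rep_sum[OF B vV] by simp
      also have "\<dots> = sum ?r (?A \<union> ?C)" by (rule sum.cong) auto
      also have "\<dots> = sum ?r ?A + sum ?r ?C" by (rule sum.union_disjoint) (use fin in auto)
      finally have "v - sum ?r ?A = (sum ?r ?A + sum ?r ?C) - sum ?r ?A"
        by (rule arg_cong[where f = "\<lambda>x. x - sum ?r ?A"])
      then have Ceq: "v - sum ?r ?A = sum ?r ?C" by (simp only: add_diff_cancel_left')
      moreover have "sum ?r ?A \<in> gen_eig V f a"
        by (intro subspace_sum subspace_scale gen_eig_subspace[OF sV f]) (use ev in auto)
      ultimately have "sum ?r ?C \<in> gen_eig V f a"
        using subspace_diff[OF gen_eig_subspace[OF sV f] v] by (simp only: Ceq[symmetric])
      moreover have "sum ?r ?C \<in> other_eig V f a" unfolding other_eig_def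
        by (intro span_sum span_scale span_base) (use ev in blast)
      ultimately have z: "sum ?r ?C = 0" using other_eig_inter[OF V f] by blast
      have "independent ?C" using independent_mono[OF Bd(2)] by auto
      then show ?thesis using independentD[OF _ fin(2) order_refl z] that by blast
    qed
    have "y v = (\<Sum>b\<in>B. scale (\<phi> a) (scale (representation B v b) b))"
      unfolding y_def
    proof (rule sum.cong[OF refl])
      fix b assume "b \<in> B"
      then show "scale (representation B v b * \<phi> (ev b)) b = scale (\<phi> a) (scale (representation B v b) b)"
        using rep by (cases "ev b = a") (auto simp: mult.commute)
    qed
    also have "\<dots> = scale (\<phi> a) v" unfolding scale_sum_right[symmetric] basis_rep_sum[OF B vV] ..
    finally show ?thesis .
  qed
  ultimately show ?thesis using that by blast
qed

lemma trace_scalar_basis: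
  assumes V: "fin_subspace V" and B: "basis_of V B" and f: "endo V f" and "\<And>b. b \<in> B \<Longrightarrow> f b = scale (c b) b"
  shows "trace_on V f = (\<Sum>b\<in>B. c b)"
  unfolding trace_on_basis[OF B f]
proof (rule sum.cong[OF refl])
  fix b assume b: "b \<in> B"
  note Bd = basis_ofD[OF B]
  have "representation B (f b) b = c b * representation B b b"
    using assms(4)[OF b] functional_onD(2)[OF functional_representation[OF B]] Bd(3) b by auto
  then show "representation B (f b) b = c b" using representation_basis[OF Bd(2) b] by simp
qed

end

text \<open>The field is a rational vector space in which \<open>e\<close> is independent, so
  \<open>e \<mapsto> 1\<close> extends linearly. The functional will be normalized at a supposed
  non-zero eigenvalue.\<close>

lemma rational_functional_exists:
  fixes e :: "'k::field_char_0"
  assumes "e \<noteq> 0"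
  obtains \<phi> :: "'k \<Rightarrow> rat" where "\<And>x y. \<phi> (x + y) = \<phi> x + \<phi> y" "\<And>q x. \<phi> (of_rat q * x) = q * \<phi> x" "\<phi> e = 1"
proof -
  interpret Q: vector_space "\<lambda>q (x::'k). of_rat q * x"
    by unfold_locales (auto simp: algebra_simps of_rat_add of_rat_mult)
  interpret R: vector_space "(*) :: rat \<Rightarrow> rat \<Rightarrow> rat"
    by unfold_locales (auto simp: algebra_simps)
  interpret QR: vector_space_pair "\<lambda>q (x::'k). of_rat q * x" "(*) :: rat \<Rightarrow> rat \<Rightarrow> rat" ..
  have "Q.independent {e}" using assms by (simp add: Q.independent_insert Q.independent_empty)
  define \<phi> where "\<phi> = QR.construct {e} (\<lambda>x. 1)"
  have "Vector_Spaces.linear (\<lambda>q (x::'k). of_rat q * x) (*) \<phi>"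
    unfolding \<phi>_def by (rule QR.linear_construct) fact
  moreover have "\<phi> e = 1" unfolding \<phi>_def by (rule QR.construct_basis) (fact, simp)
  ultimately show ?thesis using that[of \<phi>] QR.linear_add QR.linear_scale by blast
qed

section \<open>Solvable ideals and Engel's theorem\<close>

lemma ex_greatest_measure:
  fixes f :: "'c \<Rightarrow> nat"
  assumes "P a" "\<And>x. P x \<Longrightarrow> f x \<le> n"
  obtains r where "P r" "\<And>x. P x \<Longrightarrow> f x \<le> f r"
proof -
  have "\<forall>x. P x \<longrightarrow> f x < Suc n" using assms(2) by (simp add: less_Suc_eq_le)
  then show ?thesis using ex_has_greatest_nat[of P a f "Suc n", OF assms(1)] that by blast
qed

context vec_space
begin

abbreviation ssum :: "'b set \<Rightarrow> 'b set \<Rightarrow> 'b set" where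
  "ssum A B \<equiv> {x + y | x y. x \<in> A \<and> y \<in> B}"

abbreviation "lie \<equiv> lie_algebra scale"
abbreviation "subalgebra \<equiv> lie_subalgebra scale"
abbreviation "ideal \<equiv> lie_ideal scale"
abbreviation "bracket \<equiv> bracket_space scale"
abbreviation "derived \<equiv> derived_series scale"
abbreviation "solvable \<equiv> solvable_lie scale"

section \<open>Brackets, subalgebras and ideals\<close>

lemma lie_subspace: "lie L br \<Longrightarrow> subspace L"
  by (rule lie_algebra.subspace_L)

lemma lie_closed: "lie L br \<Longrightarrow> x \<in> L \<Longrightarrow> y \<in> L \<Longrightarrow> br x y \<in> L"
  by (rule lie_algebra.br_closed)

lemma lie_lin_right: "lie L br \<Longrightarrow> x \<in> L \<Longrightarrow> lin_on L (br x)"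
  using lie_algebra.br_add_right[of scale L br x] lie_algebra.br_scale_right[of scale L br x]
  by (simp add: lin_on_def)

lemma lie_lin_left: "lie L br \<Longrightarrow> y \<in> L \<Longrightarrow> lin_on L (\<lambda>x. br x y)"
  using lie_algebra.br_add_left[of scale L br _ _ y] lie_algebra.br_scale_left[of scale L br _ y]
  by (simp add: lin_on_def)

lemma lie_ad_endo: "lie L br \<Longrightarrow> x \<in> L \<Longrightarrow> endo L (br x)"
  by (simp add: endo_def lie_lin_right lie_closed)

lemma lie_anti:
  assumes L: "lie L br" and xy: "x \<in> L" "y \<in> L"
  shows "br x y = - br y x"
proof -
  have s: "x + y \<in> L" using subspace_add[OF lie_subspace[OF L]] xy .
  have "0 = br (x + y) (x + y)" using lie_algebra.br_self[OF L s] by simp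
  also have "\<dots> = br x (x + y) + br y (x + y)" by (rule lie_algebra.br_add_left[OF L]) (use xy s in auto)
  also have "\<dots> = (br x x + br x y) + (br y x + br y y)"
    using xy by (simp only: lie_algebra.br_add_right[OF L])
  also have "\<dots> = br x y + br y x" using lie_algebra.br_self[OF L] xy by simp
  finally show ?thesis by (simp add: eq_neg_iff_add_eq_0)
qed

text \<open>The Jacobi identity in the form \<open>ad [x, y] = [ad x, ad y]\<close>, which makes the
  bracket a representation of the algebra on itself.\<close>

lemma lie_jacobi:
  assumes L: "lie L br" and xyz: "x \<in> L" "y \<in> L" "z \<in> L"
  shows "br (br x y) z = br x (br y z) - br y (br x z)"
proof -
  have a: "br y (br z x) = - br y (br x z)"
    using lie_anti[OF L xyz(3,1)] lin_on_neg[OF lie_lin_right[OF L xyz(2)] lie_subspace[OF L] lie_closed[OF L xyz(1,3)]]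
    by simp
  have b: "br z (br x y) = - br (br x y) z"
    by (rule lie_anti[OF L xyz(3) lie_closed[OF L xyz(1,2)]])
  have "br x (br y z) + - br y (br x z) + - br (br x y) z = 0"
    using lie_algebra.jacobi[OF L xyz] unfolding a b .
  then show ?thesis by (simp add: algebra_simps)
qed

lemma lie_0_right: "lie L br \<Longrightarrow> x \<in> L \<Longrightarrow> br x 0 = 0"
  using lin_on_0[OF lie_lin_right lie_subspace] .

lemma lie_0_left: "lie L br \<Longrightarrow> x \<in> L \<Longrightarrow> br 0 x = 0"
  using lin_on_0[OF lie_lin_left lie_subspace] .

lemma subalgebraI:
  "subspace S \<Longrightarrow> S \<subseteq> L \<Longrightarrow> (\<And>x y. x \<in> S \<Longrightarrow> y \<in> S \<Longrightarrow> br x y \<in> S) \<Longrightarrow> subalgebra L br S"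
  by (simp add: lie_subalgebra_def)

lemma subalgebraD:
  assumes "subalgebra L br S"
  shows "subspace S" "S \<subseteq> L" "x \<in> S \<Longrightarrow> y \<in> S \<Longrightarrow> br x y \<in> S"
  using assms by (auto simp: lie_subalgebra_def)

lemma idealI:
  "subspace S \<Longrightarrow> S \<subseteq> L \<Longrightarrow> (\<And>x y. x \<in> L \<Longrightarrow> y \<in> S \<Longrightarrow> br x y \<in> S) \<Longrightarrow> ideal L br S"
  by (simp add: lie_ideal_def)

lemma idealD:
  assumes "ideal L br J"
  shows "subspace J" "J \<subseteq> L" "x \<in> L \<Longrightarrow> y \<in> J \<Longrightarrow> br x y \<in> J"
  using assms by (auto simp: lie_ideal_def)

lemma ideal_right:
  assumes L: "lie L br" and J: "ideal L br J" and "x \<in> L" "y \<in> J"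
  shows "br y x \<in> J"
  using lie_anti[OF L, of y x] idealD[OF J] assms(3,4) subspace_neg[OF idealD(1)[OF J]] by auto

lemma subalgebra_lie:
  assumes L: "lie L br" and S: "subalgebra L br S"
  shows "lie S br"
proof unfold_locales
  note Sd = subalgebraD[OF S]
  show "subspace S" by (rule Sd)
  fix x y z assume "x \<in> S" "y \<in> S" "z \<in> S"
  then have m: "x \<in> L" "y \<in> L" "z \<in> L" using Sd(2) by auto
  show "br (x + y) z = br x z + br y z" "br x (y + z) = br x y + br x z"
    "br x (br y z) + br y (br z x) + br z (br x y) = 0"
    using m by (auto simp: lie_algebra.br_add_left[OF L] lie_algebra.br_add_right[OF L] lie_algebra.jacobi[OF L])
next
  note Sd = subalgebraD[OF S]
  fix x y a assume "x \<in> S" "y \<in> S"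
  then show "br x y \<in> S" by (rule Sd)
  have m: "x \<in> L" "y \<in> L" using \<open>x \<in> S\<close> \<open>y \<in> S\<close> Sd(2) by auto
  show "br (scale a x) y = scale a (br x y)" "br x (scale a y) = scale a (br x y)"
    using m by (auto simp: lie_algebra.br_scale_left[OF L] lie_algebra.br_scale_right[OF L])
next
  fix x assume "x \<in> S"
  then show "br x x = 0" using subalgebraD(2)[OF S] lie_algebra.br_self[OF L] by blast
qed

lemma ideal_subalgebra: "ideal L br J \<Longrightarrow> subalgebra L br J"
  unfolding lie_ideal_def lie_subalgebra_def by blast

lemma ideal_lie: "lie L br \<Longrightarrow> ideal L br J \<Longrightarrow> lie J br"
  by (rule subalgebra_lie[OF _ ideal_subalgebra])

lemma ideal_self: "lie L br \<Longrightarrow> ideal L br L"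
  by (simp add: lie_ideal_def lie_subspace lie_closed)

lemma ideal_zero: "lie L br \<Longrightarrow> ideal L br {0}"
  using subspace_0[OF lie_subspace[of L br]] lie_0_right[of L br] subspace_single_0
  by (simp add: lie_ideal_def)

lemma ideal_inter:
  assumes "ideal L br A" "ideal L br B"
  shows "ideal L br (A \<inter> B)"
  using idealD[OF assms(1)] idealD[OF assms(2)] by (intro idealI) (auto intro: subspace_inter)

section \<open>Derived series and solvability\<close>

lemma bracket_space_subspace: "subspace (bracket br A B)"
  unfolding bracket_space_def by (rule subspace_span)

lemma bracket_space_least:
  assumes "subspace I" "\<And>x y. x \<in> A \<Longrightarrow> y \<in> B \<Longrightarrow> br x y \<in> I"
  shows "bracket br A B \<subseteq> I"
  unfolding bracket_space_def by (rule span_minimal) (use assms in auto)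

lemma bracket_space_in: "x \<in> A \<Longrightarrow> y \<in> B \<Longrightarrow> br x y \<in> bracket br A B"
  unfolding bracket_space_def by (intro span_base) blast

lemma bracket_space_mono: "A \<subseteq> A' \<Longrightarrow> B \<subseteq> B' \<Longrightarrow> bracket br A B \<subseteq> bracket br A' B'"
  unfolding bracket_space_def by (intro span_mono) blast

lemma derived_mono: "K \<subseteq> L \<Longrightarrow> derived K br n \<subseteq> derived L br n"
  by (induction n) (simp_all add: bracket_space_mono)

lemma derived_add: "derived L br (m + n) = derived (derived L br m) br n"
  by (induction n) auto

lemma bracket_ideal:
  assumes L: "lie L br" and I: "ideal L br I"
  shows "ideal L br (bracket br I I)"
proof -
  note D = idealD(1,2)[OF I]
  let ?E = "bracket br I I"
  have EL: "?E \<subseteq> L" by (rule bracket_space_least[OF lie_subspace[OF L]]) (use D lie_closed[OF L] in blast)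
  have "?E \<subseteq> {z \<in> L. br x z \<in> ?E}" if x: "x \<in> L" for x
  proof (rule bracket_space_least)
    show "subspace {z \<in> L. br x z \<in> ?E}"
      by (rule lin_on_kernel_subspace[OF lie_lin_right[OF L x] lie_subspace[OF L] bracket_space_subspace])
    fix u v assume uv: "u \<in> I" "v \<in> I"
    have m: "u \<in> L" "v \<in> L" using uv D by auto
    have eq: "br x (br u v) = br (br x u) v + br u (br x v)" using lie_jacobi[OF L x m] by simp
    have "br (br x u) v \<in> ?E" "br u (br x v) \<in> ?E"
      using uv idealD(3)[OF I x] by (auto intro: bracket_space_in)
    then show "br u v \<in> {z \<in> L. br x z \<in> ?E}" unfolding eq[symmetric]
      using lie_closed[OF L m] subspace_add[OF bracket_space_subspace] eq by simp
  qed
  then have "br x z \<in> ?E" if "x \<in> L" "z \<in> ?E" for x z using that by blast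
  then show ?thesis using idealI[OF bracket_space_subspace EL] by simp
qed

lemma derived_ideal:
  assumes L: "lie L br"
  shows "ideal L br (derived L br n)"
  by (induction n) (simp_all add: ideal_self[OF L] bracket_ideal[OF L])

lemma derived_subset: "lie L br \<Longrightarrow> derived L br n \<subseteq> L"
  using idealD(2)[OF derived_ideal] .

lemma zero_in_derived: "lie L br \<Longrightarrow> 0 \<in> derived L br n"
  using subspace_0[OF idealD(1)[OF derived_ideal]] .

lemma solvableI: "lie L br \<Longrightarrow> derived L br n \<subseteq> {0} \<Longrightarrow> solvable L br"
  unfolding solvable_lie_def using zero_in_derived[of L br n] by (auto intro!: exI[of _ n])

text \<open>Asking only that \<open>K\<close> contain some term of the derived series lets one lemma
  serve subalgebras (\<open>n = 0\<close>), commutator algebras (\<open>n = 1\<close>), sums with an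
  ideal and preimages under epimorphisms.\<close>

lemma solvable_by_derived:
  assumes L: "lie L br" and "derived L br n \<subseteq> K" and K: "solvable K br"
  shows "solvable L br"
proof -
  obtain m where m: "derived K br m = {0}" using K by (auto simp: solvable_lie_def)
  have "derived L br (n + m) \<subseteq> {0}"
    unfolding derived_add using derived_mono[OF assms(2), of br m] m by simp
  then show ?thesis by (rule solvableI[OF L])
qed

lemma solvable_lie_lie: "solvable L br \<Longrightarrow> lie L br"
  by (simp add: solvable_lie_def)

lemma solvable_sub:
  assumes "lie K br" "K \<subseteq> L" "solvable L br"
  shows "solvable K br"
  using solvable_by_derived[OF assms(1) _ assms(3), of 0] assms(2) by simp

lemma solvable_zero:
  assumes "lie L br"
  shows "solvable {0} br"
  by (rule solvableI[of _ _ 0]) (use ideal_lie[OF assms ideal_zero[OF assms]] in auto)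

lemma abelian_solvable:
  assumes L: "lie L br" and "\<And>x y. x \<in> L \<Longrightarrow> y \<in> L \<Longrightarrow> br x y = 0"
  shows "solvable L br"
  using solvableI[OF L, of 1] bracket_space_least[OF subspace_single_0, of L L br] assms(2) by simp

text \<open>Modulo the ideal \<open>B\<close>, a bracket of two sums is the bracket of their
  \<open>A\<close> parts. This is the derived series of \<open>(A + B)/B\<close>, expressed inside
  \<open>L\<close>; \<open>A\<close> is only a subalgebra because ideals of a supplement of the
  radical will take its place.\<close>

lemma derived_ssum:
  assumes L: "lie L br" and A: "subalgebra L br A" and B: "ideal L br B"
  shows "derived (ssum A B) br n \<subseteq> ssum (derived A br n) B"
proof (induction n)
  case 0
  then show ?case by simp
next
  case (Suc n)
  let ?D = "derived A br n"
  have lA: "lie A br" by (rule subalgebra_lie[OF L A])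
  have DL: "?D \<subseteq> L" using derived_subset[OF lA] subalgebraD(2)[OF A] by blast
  have BL: "B \<subseteq> L" by (rule idealD[OF B])
  have "derived (ssum A B) br (Suc n) \<subseteq> bracket br (ssum ?D B) (ssum ?D B)"
    unfolding derived_series.simps by (rule bracket_space_mono[OF Suc Suc])
  also have "\<dots> \<subseteq> ssum (bracket br ?D ?D) B"
  proof (rule bracket_space_least)
    show "subspace (ssum (bracket br ?D ?D) B)"
      by (rule subspace_sums[OF bracket_space_subspace idealD(1)[OF B]])
    fix u v assume "u \<in> ssum ?D B" "v \<in> ssum ?D B"
    then obtain a b a' b' where u: "u = a + b" "v = a' + b'" "a \<in> ?D" "a' \<in> ?D" "b \<in> B" "b' \<in> B" by blast
    have m: "a \<in> L" "a' \<in> L" "b \<in> L" "b' \<in> L" using u DL BL by auto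
    have "br u v = br a a' + (br a b' + (br b a' + br b b'))"
      unfolding u using m
      by (simp add: lie_algebra.br_add_left[OF L] lie_algebra.br_add_right[OF L] add.assoc
          subspace_add[OF lie_subspace[OF L]] lie_closed[OF L])
    moreover have "br a b' + (br b a' + br b b') \<in> B"
      using m u by (intro subspace_add[OF idealD(1)[OF B]] idealD(3)[OF B] ideal_right[OF L B])
    moreover have "br a a' \<in> bracket br ?D ?D" using u by (intro bracket_space_in)
    ultimately show "br u v \<in> ssum (bracket br ?D ?D) B" by blast
  qed
  finally show ?case by simp
qed

lemma ssum_superset: "subspace A \<Longrightarrow> subspace B \<Longrightarrow> A \<subseteq> ssum A B \<and> B \<subseteq> ssum A B"
  using subspace_0[of A] subspace_0[of B] by force

lemma ssum_subset: "subspace C \<Longrightarrow> A \<subseteq> C \<Longrightarrow> B \<subseteq> C \<Longrightarrow> ssum A B \<subseteq> C"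
  using subspace_add[of C] by blast

lemma ssum_subalgebra:
  assumes L: "lie L br" and A: "subalgebra L br A" and B: "ideal L br B"
  shows "subalgebra L br (ssum A B)"
proof -
  note Ad = subalgebraD[OF A] and Bd = idealD[OF B]
  have AL: "ssum A B \<subseteq> L" by (rule ssum_subset[OF lie_subspace[OF L] Ad(2) Bd(2)])
  show ?thesis
  proof (rule subalgebraI[OF subspace_sums[OF Ad(1) Bd(1)] AL])
    fix u v assume "u \<in> ssum A B" "v \<in> ssum A B"
    then have "br u v \<in> derived (ssum A B) br 1" by (auto intro: bracket_space_in)
    then have "br u v \<in> ssum (derived A br 1) B" using derived_ssum[OF L A B, of 1] by blast
    then show "br u v \<in> ssum A B" using derived_subset[OF subalgebra_lie[OF L A], of 1] by blast
  qed
qed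

lemma ssum_ideal:
  assumes L: "lie L br" and A: "ideal L br A" and B: "ideal L br B"
  shows "ideal L br (ssum A B)"
proof -
  note Ad = idealD[OF A] and Bd = idealD[OF B]
  have AL: "ssum A B \<subseteq> L" by (rule ssum_subset[OF lie_subspace[OF L] Ad(2) Bd(2)])
  show ?thesis
  proof (rule idealI[OF subspace_sums[OF Ad(1) Bd(1)] AL])
    fix x u assume x: "x \<in> L" and "u \<in> ssum A B"
    then obtain a b where u: "u = a + b" "a \<in> A" "b \<in> B" by blast
    then have "br x u = br x a + br x b" using Ad(2) Bd(2) x lie_algebra.br_add_right[OF L x] by blast
    then show "br x u \<in> ssum A B" using Ad(3)[OF x u(2)] Bd(3)[OF x u(3)] by blast
  qed
qed

lemma ssum_solvable:
  assumes L: "lie L br" and A: "subalgebra L br A" and B: "ideal L br B"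
    and sA: "solvable A br" and sB: "solvable B br"
  shows "solvable (ssum A B) br"
proof -
  obtain n where "derived A br n = {0}" using sA by (auto simp: solvable_lie_def)
  then have "derived (ssum A B) br n \<subseteq> B" using derived_ssum[OF L A B, of n] by auto
  then show ?thesis using solvable_by_derived[OF _ _ sB] subalgebra_lie[OF L ssum_subalgebra[OF L A B]] by blast
qed

text \<open>The radical as a property of \<open>R\<close> rather than as the span in
  \<open>solvable_radical\<close>: this is what the statement asks of the Baer radical, and it can
  be checked directly for the smaller algebras of an induction.\<close>

definition max_solvable :: "'b set \<Rightarrow> ('b \<Rightarrow> 'b \<Rightarrow> 'b) \<Rightarrow> 'b set \<Rightarrow> bool" where
  "max_solvable L br R \<longleftrightarrow> solvable_ideal scale L br R \<and> (\<forall>J. solvable_ideal scale L br J \<longrightarrow> J \<subseteq> R)"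

lemma max_solvableD:
  assumes "max_solvable L br R"
  shows "ideal L br R" "solvable R br" "solvable_ideal scale L br J \<Longrightarrow> J \<subseteq> R"
  using assms by (auto simp: max_solvable_def solvable_ideal_def)

text \<open>The sum of two solvable ideals is a solvable ideal, so one of greatest dimension absorbs
  all others.\<close>

lemma max_solvable_exists:
  assumes L: "lie L br" and fL: "fin_subspace L"
  obtains R where "max_solvable L br R"
proof -
  let ?P = "solvable_ideal scale L br"
  have P0: "?P {0}" using ideal_zero[OF L] solvable_zero[OF L] by (simp add: solvable_ideal_def)
  have dims: "dim J \<le> dim L" if "?P J" for J
  proof -
    have "subspace J" "J \<subseteq> L" using that idealD(1,2)[of L br J] by (auto simp: solvable_ideal_def)
    then show ?thesis using dim_le[OF fL] by blast
  qed
  then obtain R where R: "?P R" and max: "\<And>J. ?P J \<Longrightarrow> dim J \<le> dim R"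
    using ex_greatest_measure[of ?P "{0}" dim "dim L", OF P0 dims] by blast
  have "J \<subseteq> R" if J: "?P J" for J
  proof -
    have i: "ideal L br J" "ideal L br R" and s: "solvable J br" "solvable R br"
      using J R by (auto simp: solvable_ideal_def)
    have S: "?P (ssum J R)"
      using ssum_ideal[OF L i] ssum_solvable[OF L ideal_subalgebra[OF i(1)] i(2) s] by (simp add: solvable_ideal_def)
    have sub: "J \<subseteq> ssum J R" "R \<subseteq> ssum J R" using ssum_superset[OF idealD(1)[OF i(1)] idealD(1)[OF i(2)]] by auto
    have iS: "ideal L br (ssum J R)" using S by (simp add: solvable_ideal_def)
    have f: "fin_subspace (ssum J R)" by (rule fin_subspace_mono[OF fL idealD(1,2)[OF iS]])
    have "\<not> R \<subset> ssum J R" using dim_less[OF f idealD(1)[OF i(2)]] max[OF S] by linarith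
    then have "R = ssum J R" using sub(2) by blast
    then show ?thesis using sub(1) by simp
  qed
  then show ?thesis using that[of R] R unfolding max_solvable_def by blast
qed

definition radfree :: "'b set \<Rightarrow> ('b \<Rightarrow> 'b \<Rightarrow> 'b) \<Rightarrow> bool" where
  "radfree L br \<longleftrightarrow> (\<forall>J. solvable_ideal scale L br J \<longrightarrow> J = {0})"

lemma radfree_abelian_ideal:
  assumes L: "lie L br" and r: "radfree L br" and J: "ideal L br J"
    and "\<And>x y. x \<in> J \<Longrightarrow> y \<in> J \<Longrightarrow> br x y = 0"
  shows "J = {0}"
  using r abelian_solvable[OF ideal_lie[OF L J] assms(4)] J by (simp add: radfree_def solvable_ideal_def)

section \<open>Solvable ideals under epimorphisms\<close>

lemma derived_image:
  assumes L: "lie L br" and f: "lin_on L f" and fb: "\<And>x y. x \<in> L \<Longrightarrow> y \<in> L \<Longrightarrow> f (br x y) = c (f x) (f y)"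
    and K: "subalgebra L br K"
  shows "derived (f ` K) c n = f ` derived K br n"
proof (induction n)
  case 0
  then show ?case by simp
next
  case (Suc n)
  let ?D = "derived K br n"
  have lK: "lie K br" by (rule subalgebra_lie[OF L K])
  have DL: "?D \<subseteq> L" using derived_subset[OF lK] subalgebraD(2)[OF K] by blast
  have EL: "bracket br ?D ?D \<subseteq> L"
    by (rule bracket_space_least[OF lie_subspace[OF L]]) (use DL lie_closed[OF L] in blast)
  have f': "lin_on (bracket br ?D ?D) f" by (rule lin_on_subset[OF f EL])
  have "bracket c (f ` ?D) (f ` ?D) \<subseteq> f ` bracket br ?D ?D"
  proof (rule bracket_space_least)
    show "subspace (f ` bracket br ?D ?D)"
      by (rule lin_on_image_subspace[OF f' bracket_space_subspace])
    fix u v assume "u \<in> f ` ?D" "v \<in> f ` ?D"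
    then obtain x y where xy: "x \<in> ?D" "y \<in> ?D" "u = f x" "v = f y" by auto
    have "x \<in> L" "y \<in> L" using xy DL by auto
    then have "c u v = f (br x y)" using fb xy by simp
    then show "c u v \<in> f ` bracket br ?D ?D" using xy bracket_space_in[of x ?D y ?D br] by auto
  qed
  moreover have "bracket br ?D ?D \<subseteq> {x \<in> L. f x \<in> bracket c (f ` ?D) (f ` ?D)}"
  proof (rule bracket_space_least)
    show "subspace {x \<in> L. f x \<in> bracket c (f ` ?D) (f ` ?D)}"
      by (rule lin_on_kernel_subspace[OF f lie_subspace[OF L] bracket_space_subspace])
    fix x y assume xy: "x \<in> ?D" "y \<in> ?D"
    have "x \<in> L" "y \<in> L" using xy DL by auto
    then have "f (br x y) = c (f x) (f y)" "br x y \<in> L" using fb lie_closed[OF L] by auto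
    then show "br x y \<in> {x \<in> L. f x \<in> bracket c (f ` ?D) (f ` ?D)}"
      using bracket_space_in[of "f x" "f ` ?D" "f y" "f ` ?D" c] xy by simp
  qed
  ultimately show ?case using Suc by auto
qed

lemma lie_epiD:
  assumes "lie_epi scale L br M c f"
  shows "lin_on L f" "f ` L = M" "x \<in> L \<Longrightarrow> y \<in> L \<Longrightarrow> f (br x y) = c (f x) (f y)" "x \<in> L \<Longrightarrow> f x \<in> M"
  using assms by (auto simp: lie_epi_def lin_on_def)

lemma epi_preimage_ideal:
  assumes L: "lie L br" and e: "lie_epi scale L br M c f" and J: "ideal M c J"
  shows "ideal L br {x \<in> L. f x \<in> J}"
  by (rule idealI[OF lin_on_kernel_subspace[OF lie_epiD(1)[OF e] lie_subspace[OF L] idealD(1)[OF J]]])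
    (use lie_epiD[OF e] idealD[OF J] lie_closed[OF L] in auto)

lemma epi_preimage_subalgebra:
  assumes L: "lie L br" and e: "lie_epi scale L br M c f" and J: "subalgebra M c J"
  shows "subalgebra L br {x \<in> L. f x \<in> J}"
  by (rule subalgebraI[OF lin_on_kernel_subspace[OF lie_epiD(1)[OF e] lie_subspace[OF L] subalgebraD(1)[OF J]]])
    (use lie_epiD[OF e] subalgebraD[OF J] lie_closed[OF L] in auto)

lemma epi_image_ideal:
  assumes L: "lie L br" and e: "lie_epi scale L br M c f" and J: "ideal L br J"
  shows "ideal M c (f ` J)"
proof (rule idealI)
  note Jd = idealD[OF J] and ed = lie_epiD[OF e]
  show "subspace (f ` J)" by (rule lin_on_image_subspace[OF lin_on_subset[OF ed(1) Jd(2)] Jd(1)])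
  show "f ` J \<subseteq> M" using Jd(2) ed(4) by blast
  fix x y assume "x \<in> M" "y \<in> f ` J"
  then obtain u v where uv: "u \<in> L" "x = f u" "v \<in> J" "y = f v" using ed(2) by auto
  then have "c x y = f (br u v)" using ed(3) Jd(2) by auto
  then show "c x y \<in> f ` J" using Jd(3) uv by simp
qed

lemma epi_preimage_solvable:
  assumes L: "lie L br" and M: "lie M c" and e: "lie_epi scale L br M c f" and J: "solvable_ideal scale M c J"
    and k: "solvable {x \<in> L. f x = 0} br"
  shows "solvable_ideal scale L br {x \<in> L. f x \<in> J}"
proof -
  let ?K = "{x \<in> L. f x \<in> J}"
  have Ji: "ideal M c J" and Js: "solvable J c" using J by (auto simp: solvable_ideal_def)
  have K: "ideal L br ?K" by (rule epi_preimage_ideal[OF L e Ji])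
  obtain n where n: "derived J c n = {0}" using Js by (auto simp: solvable_lie_def)
  have "f ` derived ?K br n = derived (f ` ?K) c n"
    by (rule derived_image[OF L lie_epiD(1)[OF e] _ ideal_subalgebra[OF K], symmetric]) (rule lie_epiD(3)[OF e])
  also have "\<dots> \<subseteq> derived J c n" by (rule derived_mono) auto
  finally have "f ` derived ?K br n \<subseteq> {0}" using n by simp
  then have "derived ?K br n \<subseteq> {x \<in> L. f x = 0}"
    using derived_subset[OF ideal_lie[OF L K], of n] by auto
  then show ?thesis unfolding solvable_ideal_def
    using solvable_by_derived[OF ideal_lie[OF L K] _ k] K by blast
qed

lemma epi_image_solvable:
  assumes L: "lie L br" and M: "lie M c" and e: "lie_epi scale L br M c f" and J: "solvable_ideal scale L br J"
  shows "solvable_ideal scale M c (f ` J)"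
proof -
  have Ji: "ideal L br J" and Js: "solvable J br" using J by (auto simp: solvable_ideal_def)
  obtain n where n: "derived J br n = {0}" using Js by (auto simp: solvable_lie_def)
  have fJ: "ideal M c (f ` J)" by (rule epi_image_ideal[OF L e Ji])
  have "derived (f ` J) c n = f ` derived J br n"
    by (rule derived_image[OF L lie_epiD(1)[OF e] _ ideal_subalgebra[OF Ji]]) (rule lie_epiD(3)[OF e])
  also have "\<dots> = {0}" using n lin_on_0[OF lie_epiD(1)[OF e] lie_subspace[OF L]] by simp
  finally show ?thesis
    using fJ solvableI[OF ideal_lie[OF M fJ], of n] by (simp add: solvable_ideal_def)
qed

text \<open>A kernel inside \<open>R\<close> is solvable, so solvable ideals of \<open>M\<close>
  pull back to solvable ideals of \<open>L\<close>, and these lie in \<open>R\<close>. For kernel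
  equal to \<open>R\<close> this says that \<open>L/R\<close> has no non-zero solvable
  ideal.\<close>

lemma epi_max_solvable:
  assumes L: "lie L br" and M: "lie M c" and e: "lie_epi scale L br M c f" and R: "max_solvable L br R"
    and k: "{x \<in> L. f x = 0} \<subseteq> R"
  shows "max_solvable M c (f ` R)"
proof -
  have Rs: "solvable_ideal scale L br R" and Rmax: "\<And>J. solvable_ideal scale L br J \<Longrightarrow> J \<subseteq> R"
    using R by (auto simp: max_solvable_def)
  have "ideal L br {x \<in> L. f x \<in> {0}}" by (rule epi_preimage_ideal[OF L e ideal_zero[OF M]])
  then have "lie {x \<in> L. f x = 0} br" using ideal_lie[OF L] by simp
  then have ks: "solvable {x \<in> L. f x = 0} br"
    using solvable_sub[OF _ k] Rs by (simp add: solvable_ideal_def)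
  have "J \<subseteq> f ` R" if J: "solvable_ideal scale M c J" for J
  proof
    fix y assume y: "y \<in> J"
    have "J \<subseteq> M" using J idealD(2)[of M c J] by (simp add: solvable_ideal_def)
    then obtain x where "x \<in> L" "y = f x" using y lie_epiD(2)[OF e] by auto
    then show "y \<in> f ` R" using Rmax[OF epi_preimage_solvable[OF L M e J ks]] y by auto
  qed
  then show ?thesis using epi_image_solvable[OF L M e Rs] by (simp add: max_solvable_def)
qed

text \<open>Two claims are proved together by induction on \<open>dim K\<close>. The pair
  \<open>U \<subset> W\<close> stands for the module \<open>W/U\<close>, in which \<open>K\<close>
  must kill a non-zero vector. For a maximal proper subalgebra \<open>H\<close> the second claim,
  applied to \<open>K/H\<close>, yields \<open>x\<close> with \<open>[H, x] \<subseteq> H\<close>.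
  Then \<open>K = H + F x\<close>, so \<open>[K, K] \<subseteq> H\<close> is solvable; and the
  vectors of \<open>W/U\<close> killed by \<open>H\<close> are stable under the nilpotent
  \<open>ad x\<close>, which kills one of them.\<close>

lemma engel_aux:
  assumes Q: "lie Q br" and fQ: "fin_subspace Q" and nil: "\<And>x. x \<in> Q \<Longrightarrow> loc_nil Q (br x)"
    and K: "subalgebra Q br K"
  shows "solvable K br \<and>
    (\<forall>U W. subspace U \<and> subspace W \<and> U \<subset> W \<and> W \<subseteq> Q \<and> (\<forall>x\<in>K. \<forall>w\<in>W. br x w \<in> W) \<and> (\<forall>x\<in>K. \<forall>u\<in>U. br x u \<in> U)
      \<longrightarrow> (\<exists>w\<in>W - U. \<forall>x\<in>K. br x w \<in> U))"
  using K
proof (induction "dim K" arbitrary: K rule: less_induct)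
  case less
  note K = less.prems
  note Kd = subalgebraD[OF K]
  have lK: "lie K br" by (rule subalgebra_lie[OF Q K])
  have fK: "fin_subspace K" by (rule fin_subspace_mono[OF fQ Kd(1,2)])
  show ?case
  proof (cases "K = {0}")
    case True
    have "solvable K br" using solvable_zero[OF Q] True by simp
    moreover have "\<exists>w\<in>W - U. \<forall>x\<in>K. br x w \<in> U" if "subspace U" "U \<subset> W" "W \<subseteq> Q" for U W
    proof -
      obtain w where "w \<in> W - U" using psubset_imp_ex_mem[OF \<open>U \<subset> W\<close>] by blast
      then show ?thesis using True lie_0_left[OF Q, of w] that(3) subspace_0[OF that(1)] by force
    qed
    ultimately show ?thesis by blast
  next
    case False
    let ?P = "\<lambda>H. subalgebra K br H \<and> H \<noteq> K"
    have "?P {0}" using ideal_subalgebra[OF ideal_zero[OF lK]] False by auto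
    moreover have "dim H \<le> dim K" if "?P H" for H
      using dim_le[OF fK subalgebraD(1,2)[of K br H]] that by blast
    ultimately obtain H where H: "?P H" and max: "\<And>J. ?P J \<Longrightarrow> dim J \<le> dim H"
      using ex_greatest_measure[of ?P "{0}" dim "dim K"] by blast
    note Hd = subalgebraD[OF conjunct1[OF H]]
    have HQ: "subalgebra Q br H" using Hd Kd by (intro subalgebraI) auto
    have "dim H < dim K" using dim_less[OF fK Hd(1)] Hd(2) H by blast
    note IH = less.hyps[OF this HQ]
    have sH: "solvable H br" using IH by blast
    have EH: "\<exists>w\<in>W - U. \<forall>x\<in>H. br x w \<in> U" if "subspace U" "subspace W" "U \<subset> W" "W \<subseteq> Q"
      "\<forall>x\<in>H. \<forall>w\<in>W. br x w \<in> W" "\<forall>x\<in>H. \<forall>u\<in>U. br x u \<in> U" for U W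
      using IH that by blast
    \<comment> \<open>The induction hypothesis for the module \<open>K/H\<close>, on which
      \<open>H\<close> acts by the bracket.\<close>
    have "\<exists>w\<in>K - H. \<forall>x\<in>H. br x w \<in> H"
    proof (rule EH[OF Hd(1) Kd(1) _ Kd(2)])
      show "H \<subset> K" using Hd(2) H by (simp add: psubset_eq)
      show "\<forall>x\<in>H. \<forall>w\<in>K. br x w \<in> K" using Hd(2) Kd(3) by (simp add: subset_iff)
      show "\<forall>x\<in>H. \<forall>u\<in>H. br x u \<in> H" using Hd(3) by simp
    qed
    then obtain x where x: "x \<in> K" "x \<notin> H" and xH: "\<And>h. h \<in> H \<Longrightarrow> br h x \<in> H" by blast
    have xQ: "x \<in> Q" and HQ': "H \<subseteq> Q" using x Kd Hd by auto
    have xH': "br x h \<in> H" if "h \<in> H" for h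
      using lie_anti[OF Q xQ, of h] xH[OF that] HQ' that subspace_neg[OF Hd(1)] by auto
    let ?X = "range (\<lambda>c. scale c x)"
    have sX: "subspace ?X" using subspace_span[of "{x}"] by (simp add: span_singleton)
    \<comment> \<open>The brackets land in \<open>H\<close> itself, as \<open>[x, x] = 0\<close>. So
      \<open>H + F x\<close> is a subalgebra, and its commutator algebra lies in
      \<open>H\<close>.\<close>
    have cl: "br u v \<in> H" if "u \<in> ssum H ?X" "v \<in> ssum H ?X" for u v
    proof -
      obtain h c h' c' where uv: "u = h + scale c x" "v = h' + scale c' x" "h \<in> H" "h' \<in> H" using \<open>u \<in> _\<close> \<open>v \<in> _\<close> by blast
      have m: "h \<in> Q" "h' \<in> Q" "scale c x \<in> Q" "scale c' x \<in> Q"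
        using uv HQ' xQ subspace_scale[OF lie_subspace[OF Q]] by auto
      have "br u v = br h h' + scale c' (br h x) + (scale c (br x h') + scale c (scale c' (br x x)))"
        unfolding uv using m xQ subspace_add[OF lie_subspace[OF Q]]
        by (simp add: lie_algebra.br_add_left[OF Q] lie_algebra.br_add_right[OF Q]
          lie_algebra.br_scale_left[OF Q] lie_algebra.br_scale_right[OF Q] scale_right_distrib mult.commute)
      also have "br x x = 0" using lie_algebra.br_self[OF Q xQ] .
      finally show ?thesis
        using uv Hd(3)[OF uv(3,4)] xH[OF uv(3)] xH'[OF uv(4)] subspace_add[OF Hd(1)] subspace_scale[OF Hd(1)] by simp
    qed
    have sub: "H \<subseteq> ssum H ?X" "?X \<subseteq> ssum H ?X" using ssum_superset[OF Hd(1) sX] by auto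
    have xX: "x \<in> ?X" using image_eqI[of x "\<lambda>c. scale c x" 1] by simp
    have "?X \<subseteq> K" using x(1) subspace_scale[OF Kd(1)] by blast
    then have subK: "ssum H ?X \<subseteq> K" by (rule ssum_subset[OF Kd(1) Hd(2)])
    have KX: "K = ssum H ?X"
    proof (rule ccontr)
      assume "K \<noteq> ssum H ?X"
      moreover have "subalgebra K br (ssum H ?X)"
        using subalgebraI[OF subspace_sums[OF Hd(1) sX] subK, of br] cl sub(1) by (simp only: subsetD)
      ultimately have P: "?P (ssum H ?X)" by simp
      have "x \<in> ssum H ?X" using sub(2) xX by (rule subsetD)
      then have "H \<noteq> ssum H ?X" using x(2) by metis
      then have "H \<subset> ssum H ?X" using sub(1) by (rule psubsetI[rotated])
      then have "dim H < dim (ssum H ?X)"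
        by (rule dim_less[OF fin_subspace_mono[OF fK subspace_sums[OF Hd(1) sX] subK] Hd(1)])
      then show False using max[OF P] by simp
    qed
    have "derived K br 1 \<subseteq> H"
      using bracket_space_least[OF Hd(1), of K K br] cl KX by simp
    then have sK: "solvable K br" by (rule solvable_by_derived[OF lK _ sH])
    have "\<exists>w\<in>W - U. \<forall>x\<in>K. br x w \<in> U"
      if U: "subspace U" and W: "subspace W" "U \<subset> W" "W \<subseteq> Q"
      and KW: "\<forall>x\<in>K. \<forall>w\<in>W. br x w \<in> W" and KU: "\<forall>x\<in>K. \<forall>u\<in>U. br x u \<in> U" for U W
    proof -
      obtain w where w: "w \<in> W" "w \<notin> U" "\<forall>h\<in>H. br h w \<in> U"
        using EH[OF U W] KW KU Hd(2) by blast
      \<comment> \<open>Being killed by \<open>H\<close> modulo \<open>U\<close> is inherited by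
        \<open>[x, w]\<close>: in \<open>[h, [x, w]] = [[h, x], w] + [x, [h, w]]\<close> the element
        \<open>[h, x]\<close> is again in \<open>H\<close>.\<close>
      have iter: "(br x ^^ i) w \<in> W \<and> (\<forall>h\<in>H. br h ((br x ^^ i) w) \<in> U)" for i
      proof (induction i)
        case 0
        then show ?case using w by simp
      next
        case (Suc i)
        let ?w = "(br x ^^ i) w"
        have wQ: "?w \<in> Q" using Suc W(3) by auto
        have "br h (br x ?w) \<in> U" if h: "h \<in> H" for h
        proof -
          have "br h (br x ?w) = br (br h x) ?w + br x (br h ?w)"
            using lie_jacobi[OF Q _ xQ wQ, of h] h HQ' by auto
          moreover have "br (br h x) ?w \<in> U" using Suc xH[OF h] by blast
          moreover have "br x (br h ?w) \<in> U" using KU x(1) Suc h by blast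
          ultimately show ?thesis using subspace_add[OF U] by simp
        qed
        then show ?case using Suc KW x(1) by simp
      qed
      have "w \<in> Q" using w W(3) by auto
      then obtain n0 where "(br x ^^ n0) w = 0" using nil[OF xQ] by (auto simp: loc_nil_def)
      then have ex: "(br x ^^ n0) w \<in> U" using subspace_0[OF U] by simp
      \<comment> \<open>The last iterate before \<open>U\<close> is entered is killed modulo
        \<open>U\<close> by \<open>x\<close> and by \<open>H\<close>, hence by
        \<open>K\<close>.\<close>
      define n where "n = (LEAST n. (br x ^^ n) w \<in> U)"
      have n: "(br x ^^ n) w \<in> U" unfolding n_def using ex by (rule LeastI)
      have "n \<noteq> 0" using n w(2) by (cases n) auto
      then obtain m where m: "n = Suc m" by (cases n) auto
      let ?v = "(br x ^^ m) w"
      have v: "?v \<notin> U" using not_less_Least[of m "\<lambda>n. (br x ^^ n) w \<in> U"] m n_def by simp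
      have vW: "?v \<in> W" "\<And>h. h \<in> H \<Longrightarrow> br h ?v \<in> U" using iter[of m] by auto
      have xv: "br x ?v \<in> U" using n m by simp
      have "br k ?v \<in> U" if "k \<in> K" for k
      proof -
        obtain h c where k: "k = h + scale c x" "h \<in> H" using \<open>k \<in> K\<close> KX by auto
        have "br k ?v = br h ?v + scale c (br x ?v)"
          unfolding k using k(2) HQ' xQ vW(1) W(3) subspace_scale[OF lie_subspace[OF Q]]
          by (simp add: lie_algebra.br_add_left[OF Q] lie_algebra.br_scale_left[OF Q] subset_eq)
        then show ?thesis using vW(2)[OF k(2)] xv subspace_add[OF U] subspace_scale[OF U] by simp
      qed
      then show ?thesis using v vW(1) by blast
    qed
    then show ?thesis using sK by blast
  qed
qed

lemma ad_nilpotent_solvable: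
  assumes Q: "lie Q br" and "fin_subspace Q" and "\<And>x. x \<in> Q \<Longrightarrow> loc_nil Q (br x)"
  shows "solvable Q br"
  using engel_aux[OF assms ideal_subalgebra[OF ideal_self[OF Q]]] by blast

end

section \<open>Trace forms and Cartan's criterion\<close>

context vec_space
begin

section \<open>Representations and their trace forms\<close>

definition lie_rep :: "'b set \<Rightarrow> ('b \<Rightarrow> 'b \<Rightarrow> 'b) \<Rightarrow> 'b set \<Rightarrow> ('b \<Rightarrow> 'b \<Rightarrow> 'b) \<Rightarrow> bool" where
  "lie_rep M c V act \<longleftrightarrow> lie M c \<and> fin_subspace M \<and> fin_subspace V \<and>
     (\<forall>x\<in>M. endo V (act x)) \<and> (\<forall>v\<in>V. lin_on M (\<lambda>x. act x v)) \<and>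
     (\<forall>x\<in>M. \<forall>y\<in>M. \<forall>v\<in>V. act (c x y) v = act x (act y v) - act y (act x v))"

lemma lie_repD:
  assumes "lie_rep M c V act"
  shows "lie M c" "fin_subspace M" "fin_subspace V" "x \<in> M \<Longrightarrow> endo V (act x)"
    "v \<in> V \<Longrightarrow> lin_on M (\<lambda>x. act x v)"
    "x \<in> M \<Longrightarrow> y \<in> M \<Longrightarrow> v \<in> V \<Longrightarrow> act (c x y) v = act x (act y v) - act y (act x v)"
    "x \<in> M \<Longrightarrow> v \<in> V \<Longrightarrow> act x v \<in> V" "subspace M" "subspace V"
  using assms by (auto simp: lie_rep_def endo_def fin_subspace_def)

lemma adjoint_rep: "lie M c \<Longrightarrow> fin_subspace M \<Longrightarrow> lie_rep M c M c"
  unfolding lie_rep_def using lie_ad_endo[of M c] lie_lin_left[of M c] lie_jacobi[of M c] by blast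

lemma lie_rep_sub:
  assumes r: "lie_rep M c V act" and N: "subalgebra M c N"
  shows "lie_rep N c V act"
proof -
  note d = lie_repD[OF r] and Nd = subalgebraD[OF N]
  have "lie N c" by (rule subalgebra_lie[OF d(1) N])
  moreover have "fin_subspace N" by (rule fin_subspace_mono[OF d(2) Nd(1,2)])
  moreover have "lin_on N (\<lambda>x. act x v)" if "v \<in> V" for v by (rule lin_on_subset[OF d(5)[OF that] Nd(2)])
  ultimately show ?thesis unfolding lie_rep_def using d(3,4,6) Nd(2) by (simp add: subset_iff)
qed

text \<open>For the adjoint representation, as \<open>trace_form M c\<close>, this is the Killing
  form.\<close>

definition trace_form :: "'b set \<Rightarrow> ('b \<Rightarrow> 'b \<Rightarrow> 'b) \<Rightarrow> 'b \<Rightarrow> 'b \<Rightarrow> 'a" where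
  "trace_form V act x y = trace_on V (\<lambda>v. act x (act y v))"

lemma trace_form_sym:
  assumes r: "lie_rep M c V act" and "x \<in> M" "y \<in> M"
  shows "trace_form V act x y = trace_form V act y x"
  unfolding trace_form_def using trace_commute[OF lie_repD(3)[OF r]] lie_repD(4)[OF r] assms(2,3) by blast

lemma trace_form_functional:
  assumes r: "lie_rep M c V act" and y: "y \<in> M"
  shows "functional_on M (\<lambda>x. trace_form V act x y)"
  unfolding trace_form_def
proof (rule trace_functional[OF lie_repD(3)[OF r] _ lie_repD(8)[OF r]])
  fix x assume "x \<in> M"
  then show "endo V (\<lambda>v. act x (act y v))" using lie_repD(4)[OF r] y by (blast intro: endo_comp)
qed (use lin_onD[OF lie_repD(5)[OF r lie_repD(7)[OF r y]]] in auto)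

lemma trace_form_bilin:
  assumes r: "lie_rep M c V act"
  shows "bilin_form M (trace_form V act)"
  unfolding bilin_form_def
proof (intro conjI ballI)
  fix x assume x: "x \<in> M"
  show "functional_on M (trace_form V act x)"
    using trace_form_functional[OF r x] trace_form_sym[OF r x]
      subspace_add[OF lie_repD(8)[OF r]] subspace_scale[OF lie_repD(8)[OF r]]
    unfolding functional_on_def by simp
qed (rule trace_form_functional[OF r])

text \<open>Both sides are differences of traces of triple products, and cyclicity gives
  \<open>tr(y x z) = tr(x z y)\<close>.\<close>

lemma trace_form_invariant:
  assumes r: "lie_rep M c V act" and x: "x \<in> M" and y: "y \<in> M" and z: "z \<in> M"
  shows "trace_form V act (c x y) z = trace_form V act x (c y z)"
proof -
  note d = lie_repD[OF r]
  note e = d(4)[OF x] d(4)[OF y] d(4)[OF z]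
  have "trace_form V act (c x y) z = trace_on V (\<lambda>v. act x (act y (act z v)) - act y (act x (act z v)))"
    unfolding trace_form_def
    by (rule trace_cong[OF d(3) endo_comp[OF d(4)[OF lie_closed[OF d(1) x y]] e(3)]])
      (rule d(6)[OF x y d(7)[OF z]])
  also have "\<dots> = trace_on V (\<lambda>v. act x (act y (act z v))) - trace_on V (\<lambda>v. act y (act x (act z v)))"
    by (rule trace_diff[OF d(3) endo_comp[OF e(1) endo_comp[OF e(2,3)]] endo_comp[OF e(2) endo_comp[OF e(1,3)]]])
  also have "trace_on V (\<lambda>v. act y (act x (act z v))) = trace_on V (\<lambda>v. act x (act z (act y v)))"
    by (rule trace_commute[OF d(3) e(2) endo_comp[OF e(1,3)]])
  also have "trace_on V (\<lambda>v. act x (act y (act z v))) - trace_on V (\<lambda>v. act x (act z (act y v)))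
    = trace_on V (\<lambda>v. act x (act y (act z v)) - act x (act z (act y v)))"
    by (rule trace_diff[OF d(3) endo_comp[OF e(1) endo_comp[OF e(2,3)]] endo_comp[OF e(1) endo_comp[OF e(3,2)]], symmetric])
  also have "\<dots> = trace_form V act x (c y z)"
    unfolding trace_form_def
  proof (rule trace_cong[OF d(3)])
    show "endo V (\<lambda>v. act x (act y (act z v)) - act x (act z (act y v)))"
      by (rule endo_diff[OF d(9) endo_comp[OF e(1) endo_comp[OF e(2,3)]] endo_comp[OF e(1) endo_comp[OF e(3,2)]]])
    fix v assume v: "v \<in> V"
    show "act x (act y (act z v)) - act x (act z (act y v)) = act x (act (c y z) v)"
      unfolding d(6)[OF y z v]
      by (rule lin_on_diff[OF endoD(1)[OF e(1)] d(9), symmetric]) (use d(7) y z v in auto)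
  qed
  finally show ?thesis .
qed

lemma perp_ideal:
  assumes r: "lie_rep M c V act" and I: "ideal M c I"
  shows "ideal M c {x \<in> M. \<forall>y\<in>I. trace_form V act x y = 0}" (is "ideal M c ?P")
proof (rule idealI)
  note d = lie_repD[OF r] and Id = idealD[OF I]
  have f: "functional_on M (\<lambda>x. trace_form V act x y)" if "y \<in> I" for y
    using trace_form_functional[OF r] that Id(2) by blast
  show "subspace ?P"
  proof (rule subspaceI)
    show "0 \<in> ?P" using subspace_0[OF d(8)] functional_on_0[OF f d(8)] by simp
    fix x y assume "x \<in> ?P" "y \<in> ?P"
    then show "x + y \<in> ?P" using subspace_add[OF d(8)] functional_onD(1)[OF f] by simp
  next
    fix a x assume "x \<in> ?P"
    then show "scale a x \<in> ?P" using subspace_scale[OF d(8)] functional_onD(2)[OF f] by simp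
  qed
  show "?P \<subseteq> M" by auto
  fix z x assume z: "z \<in> M" and x: "x \<in> ?P"
  have xM: "x \<in> M" using x by simp
  have "trace_form V act (c x z) y = 0" if "y \<in> I" for y
    using trace_form_invariant[OF r xM z, of y] x Id(3)[OF z that] subsetD[OF Id(2) that] by simp
  then have "c x z \<in> ?P" using lie_closed[OF d(1) xM z] by simp
  then have "- c x z \<in> ?P" using \<open>subspace ?P\<close> subspace_neg by blast
  then show "c z x \<in> ?P" using lie_anti[OF d(1) z xM] by simp
qed

end

section \<open>Cartan's criterion\<close>

context ac_space
begin

text \<open>Eigenvalues add: \<open>(z - (a + s)) u v = ([z, u] - s u) v + u (z - a) v\<close>. An
  induction on the exponent for \<open>u\<close> with one for \<open>v\<close> inside it handles the
  two summands.\<close>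

lemma gen_eig_act:
  assumes r: "lie_rep M c V act" and z: "z \<in> M"
    and u: "u \<in> gen_eig M (c z) s" and v: "v \<in> gen_eig V (act z) a"
  shows "act u v \<in> gen_eig V (act z) (a + s)"
proof -
  note d = lie_repD[OF r]
  have ez: "endo M (c z)" by (rule lie_ad_endo[OF d(1) z])
  note az = d(4)[OF z]
  have G: "subspace (gen_eig V (act z) (a + s))" by (rule gen_eig_subspace[OF d(9) az])
  have "\<forall>v\<in>gen_eig V (act z) a. act u v \<in> gen_eig V (act z) (a + s)" using u
  proof (induction rule: gen_eig_induct[OF d(8) ez, consumes 1, case_names zero step])
    case zero
    show ?case
      using lin_on_0[OF d(5) d(8)] subspace_0[OF G] gen_eig_subset[of V "act z" a] by auto
  next
    case (step u)
    have uM: "u \<in> M" using step(1) gen_eig_subset by blast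
    have zu: "c z u \<in> M" by (rule lie_closed[OF d(1) z uM])
    show ?case
    proof
      fix v assume "v \<in> gen_eig V (act z) a"
      then show "act u v \<in> gen_eig V (act z) (a + s)"
      proof (induction rule: gen_eig_induct[OF d(9) az, consumes 1, case_names zero step])
        case zero
        show ?case using lin_on_0[OF endoD(1)[OF d(4)[OF uM]] d(9)] subspace_0[OF G] by simp
      next
        case inner: (step v)
        have vV: "v \<in> V" using inner(1) gen_eig_subset by blast
        have zv: "act z v \<in> V" by (rule d(7)[OF z vV])
        have 1: "act (c z u - scale s u) v = act z (act u v) - act u (act z v) - scale s (act u v)"
          using lin_on_diff[OF d(5)[OF vV] d(8) zu subspace_scale[OF d(8) uM]] lin_onD(2)[OF d(5)[OF vV] uM]
            d(6)[OF z uM vV] by simp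
        have 2: "act u (act z v - scale a v) = act u (act z v) - scale a (act u v)"
          using lin_on_diff[OF endoD(1)[OF d(4)[OF uM]] d(9) zv subspace_scale[OF d(9) vV]]
            lin_onD(2)[OF endoD(1)[OF d(4)[OF uM]] vV] by simp
        have eq: "act z (act u v) - scale (a + s) (act u v)
          = act (c z u - scale s u) v + act u (act z v - scale a v)"
          unfolding 1 2 by (simp add: scale_left_distrib)
        have "act z (act u v) - scale (a + s) (act u v) \<in> gen_eig V (act z) (a + s)"
          unfolding eq by (rule subspace_add[OF G _ inner(2)]) (use step(2) inner(1) in blast)
        then show ?case by (rule gen_eig_shiftI[OF d(7)[OF uM vV]])
      qed
    qed
  qed
  then show ?thesis using v by blast
qed

lemma loc_nil_gen_eig: "loc_nil V f \<longleftrightarrow> V \<subseteq> gen_eig V f 0"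
  unfolding loc_nil_def gen_eig_def by auto

text \<open>If \<open>\<phi>\<close> is a \<open>\<rat>\<close>-linear functional on the field and \<open>y\<close> acts as \<open>\<phi> a\<close> on the generalized
  eigenspace of \<open>z\<close> for \<open>a\<close>, then \<open>[v, y]\<close> is a multiple of \<open>v\<close> for every generalized eigenvector
  \<open>v\<close> of \<open>ad z\<close>.  Since \<open>z\<close> is a sum of commutators, this makes the trace of \<open>z y\<close>, that is the sum
  of all \<open>a \<phi>(a)\<close>, vanish, and applying \<open>\<phi>\<close> to this sum gives a vanishing sum of squares.\<close>

lemma cartan_nilpotent:
  assumes r: "lie_rep N c V act" and tf: "\<And>x y. x \<in> N \<Longrightarrow> y \<in> N \<Longrightarrow> trace_form V act x y = 0"
    and z: "z \<in> bracket c N N"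
  shows "V \<subseteq> gen_eig V (act z) 0"
proof -
  note d = lie_repD[OF r]
  have brN: "bracket c N N \<subseteq> N"
    by (rule bracket_space_least[OF d(8)]) (rule lie_closed[OF d(1)])
  have zN: "z \<in> N" using z brN by blast
  note az = d(4)[OF zN]
  obtain B ev where B: "basis_of V B" and ev: "\<And>b. b \<in> B \<Longrightarrow> b \<in> gen_eig V (act z) (ev b)"
    using gen_eig_basis[OF d(3) az] by metis
  note Bd = basis_ofD[OF B]
  have ev0: "ev b0 = 0" if b0: "b0 \<in> B" for b0
  proof (rule ccontr)
    assume ne: "ev b0 \<noteq> 0"
    obtain \<phi> :: "'k \<Rightarrow> rat" where \<phi>: "\<And>x y. \<phi> (x + y) = \<phi> x + \<phi> y" "\<And>q x. \<phi> (of_rat q * x) = q * \<phi> x" "\<phi> (ev b0) = 1"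
      using rational_functional_exists[OF ne] by metis
    \<comment> \<open>\<open>\<psi>\<close> is \<open>\<phi>\<close> with its rational values put
      back into the field, so that they can scale vectors. Applying \<open>\<phi>\<close> to
      \<open>\<psi> a * a\<close> gives the square of \<open>\<phi> a\<close>.\<close>
    define \<psi> where "\<psi> = (\<lambda>x. of_rat (\<phi> x) :: 'k)"
    have \<psi>_add: "\<psi> (x + y) = \<psi> x + \<psi> y" for x y by (simp add: \<psi>_def \<phi>(1) of_rat_add)
    obtain y where y: "endo V y" and yv: "\<And>a v. v \<in> gen_eig V (act z) a \<Longrightarrow> y v = scale (\<psi> a) v"
      using gen_eig_scalar_map[OF d(3) az] by metis
    have y1: "act v (y w) - y (act v w) = scale (- \<psi> s) (act v w)"
      if v: "v \<in> gen_eig N (c z) s" and w: "w \<in> V" for v s w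
    proof -
      have vN: "v \<in> N" using v gen_eig_subset by blast
      note av = d(4)[OF vN]
      show ?thesis
      proof (rule lin_on_eq_span[OF _ _ d(9) _ _ _ w])
        show "lin_on V (\<lambda>w. act v (y w) - y (act v w))"
          by (rule endoD(1)[OF endo_diff[OF d(9) endo_comp[OF av y] endo_comp[OF y av]]])
        show "lin_on V (\<lambda>w. scale (- \<psi> s) (act v w))"
          by (rule endoD(1)[OF endo_scale[OF d(9) av]])
        show "(\<Union>a. gen_eig V (act z) a) \<subseteq> V" by (auto simp: gen_eig_def)
        show "V \<subseteq> span (\<Union>a. gen_eig V (act z) a)" using gen_eig_span[OF d(3) az] by simp
        fix w assume "w \<in> (\<Union>a. gen_eig V (act z) a)"
        then obtain a where w: "w \<in> gen_eig V (act z) a" by blast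
        have wV: "w \<in> V" using w gen_eig_subset by blast
        have "y (act v w) = scale (\<psi> (a + s)) (act v w)" by (rule yv[OF gen_eig_act[OF r zN v w]])
        moreover have "act v (y w) = scale (\<psi> a) (act v w)"
          unfolding yv[OF w] by (rule lin_onD(2)[OF endoD(1)[OF av] wV])
        ultimately show "act v (y w) - y (act v w) = scale (- \<psi> s) (act v w)"
          by (simp add: \<psi>_add scale_left_distrib)
      qed
    qed
    let ?K = "\<lambda>u v w. act u (act v (y w) - y (act v w))"
    \<comment> \<open>The trace of \<open>u [v, y]\<close> is linear in \<open>v\<close>, so
      \<open>v\<close> may be a generalized eigenvector of \<open>ad z\<close>. Then
      \<open>[v, y]\<close> is a multiple of \<open>v\<close>, and the trace is a multiple of
      \<open>trace_form V act u v\<close>.\<close>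
    have t1: "trace_on V (?K u v) = 0" if u: "u \<in> N" and v: "v \<in> N" for u v
    proof (rule functional_zero_span[OF _ d(8) _ _ _ v])
      note au = d(4)[OF u]
      show "functional_on N (\<lambda>v. trace_on V (?K u v))"
      proof (rule trace_functional[OF d(3) _ d(8)])
        fix v assume "v \<in> N"
        note av = d(4)[OF this]
        show "endo V (?K u v)"
          by (rule endo_comp[OF au endo_diff[OF d(9) endo_comp[OF av y] endo_comp[OF y av]]])
      next
        fix v v' w assume m: "v \<in> N" "v' \<in> N" "w \<in> V"
        have yw: "y w \<in> V" "act v w \<in> V" "act v' w \<in> V" using m endoD(2)[OF y] d(7) by auto
        have m1: "act v (y w) - y (act v w) \<in> V" "act v' (y w) - y (act v' w) \<in> V"
          using m yw endoD(2)[OF y] d(7) subspace_diff[OF d(9)] by auto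
        have "act (v + v') (y w) - y (act (v + v') w) = (act v (y w) - y (act v w)) + (act v' (y w) - y (act v' w))"
          using lin_onD(1)[OF d(5)[OF yw(1)] m(1,2)] lin_onD(1)[OF d(5)[OF m(3)] m(1,2)]
            lin_onD(1)[OF endoD(1)[OF y] yw(2,3)] by simp
        then show "act u (act (v + v') (y w) - y (act (v + v') w))
          = act u (act v (y w) - y (act v w)) + act u (act v' (y w) - y (act v' w))"
          using lin_onD(1)[OF endoD(1)[OF au] m1] by simp
      next
        fix a v w assume m: "v \<in> N" "w \<in> V"
        have yw: "y w \<in> V" "act v w \<in> V" using m endoD(2)[OF y] d(7) by auto
        have m1: "act v (y w) - y (act v w) \<in> V"
          using m yw endoD(2)[OF y] d(7) subspace_diff[OF d(9)] by auto
        have "act (scale a v) (y w) - y (act (scale a v) w) = scale a (act v (y w) - y (act v w))"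
          using lin_onD(2)[OF d(5)[OF yw(1)] m(1)] lin_onD(2)[OF d(5)[OF m(2)] m(1)]
            lin_onD(2)[OF endoD(1)[OF y] yw(2)] by (simp add: scale_right_diff_distrib)
        then show "act u (act (scale a v) (y w) - y (act (scale a v) w)) = scale a (act u (act v (y w) - y (act v w)))"
          using lin_onD(2)[OF endoD(1)[OF au] m1] by simp
      qed
      show "(\<Union>s. gen_eig N (c z) s) \<subseteq> N" by (auto simp: gen_eig_def)
      show "N \<subseteq> span (\<Union>s. gen_eig N (c z) s)"
        using gen_eig_span[OF d(2) lie_ad_endo[OF d(1) zN]] by simp
      fix v assume "v \<in> (\<Union>s. gen_eig N (c z) s)"
      then obtain s where v: "v \<in> gen_eig N (c z) s" by blast
      have vN: "v \<in> N" using v gen_eig_subset by blast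
      have "trace_on V (?K u v) = trace_on V (\<lambda>w. scale (- \<psi> s) (act u (act v w)))"
      proof (rule trace_cong[OF d(3)])
        show "endo V (?K u v)"
          by (rule endo_comp[OF au endo_diff[OF d(9) endo_comp[OF d(4)[OF vN] y] endo_comp[OF y d(4)[OF vN]]]])
        fix w assume w: "w \<in> V"
        show "act u (act v (y w) - y (act v w)) = scale (- \<psi> s) (act u (act v w))"
          unfolding y1[OF v w] by (rule lin_onD(2)[OF endoD(1)[OF au] d(7)[OF vN w]])
      qed
      also have "\<dots> = - \<psi> s * trace_form V act u v"
        unfolding trace_form_def by (rule trace_scale[OF d(3) endo_comp[OF au d(4)[OF vN]]])
      finally show "trace_on V (?K u v) = 0" using tf[OF u vN] by simp
    qed
    have tz: "trace_on V (\<lambda>w. act z (y w)) = 0"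
    proof (rule functional_zero_span[OF _ bracket_space_subspace _ _ _ z])
      show "functional_on (bracket c N N) (\<lambda>x. trace_on V (\<lambda>w. act x (y w)))"
      proof (rule trace_functional[OF d(3) _ bracket_space_subspace])
        fix x assume "x \<in> bracket c N N"
        then show "endo V (\<lambda>w. act x (y w))" using endo_comp[OF d(4) y] brN by blast
      qed (use lin_onD[OF lin_on_subset[OF d(5)[OF endoD(2)[OF y]] brN]] in auto)
      show "{c u v |u v. u \<in> N \<and> v \<in> N} \<subseteq> bracket c N N"
        unfolding bracket_space_def by (rule span_superset)
      show "bracket c N N \<subseteq> span {c u v |u v. u \<in> N \<and> v \<in> N}"
        unfolding bracket_space_def by simp
      fix x assume "x \<in> {c u v |u v. u \<in> N \<and> v \<in> N}"
      then obtain u v where uv: "u \<in> N" "v \<in> N" "x = c u v" by blast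
      note au = d(4)[OF uv(1)] and av = d(4)[OF uv(2)]
      have e: "endo V (\<lambda>w. act u (act v (y w)))" "endo V (\<lambda>w. act v (act u (y w)))" "endo V (\<lambda>w. act u (y (act v w)))"
        by (rule endo_comp[OF au endo_comp[OF av y]] endo_comp[OF av endo_comp[OF au y]] endo_comp[OF au endo_comp[OF y av]])+
      \<comment> \<open>Cyclicity moves \<open>y\<close> into the second factor:
        \<open>tr([u, v] y) = tr(u [v, y])\<close>, where \<open>y\<close> is merely an endomorphism
        of \<open>V\<close>.\<close>
      have "trace_on V (\<lambda>w. act x (y w)) = trace_on V (\<lambda>w. act u (act v (y w)) - act v (act u (y w)))"
        unfolding uv(3)
        by (rule trace_cong[OF d(3) endo_comp[OF d(4)[OF lie_closed[OF d(1) uv(1,2)]] y] d(6)[OF uv(1,2) endoD(2)[OF y]]])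
      also have "\<dots> = trace_on V (\<lambda>w. act u (act v (y w))) - trace_on V (\<lambda>w. act v (act u (y w)))"
        by (rule trace_diff[OF d(3) e(1,2)])
      also have "trace_on V (\<lambda>w. act v (act u (y w))) = trace_on V (\<lambda>w. act u (y (act v w)))"
        by (rule trace_commute[OF d(3) av endo_comp[OF au y]])
      also have "trace_on V (\<lambda>w. act u (act v (y w))) - trace_on V (\<lambda>w. act u (y (act v w)))
         = trace_on V (\<lambda>w. act u (act v (y w)) - act u (y (act v w)))"
        by (rule trace_diff[OF d(3) e(1,3), symmetric])
      also have "\<dots> = trace_on V (?K u v)"
      proof (rule trace_cong[OF d(3) endo_diff[OF d(9) e(1,3)]])
        fix w assume w: "w \<in> V"
        show "act u (act v (y w)) - act u (y (act v w)) = act u (act v (y w) - y (act v w))"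
          by (rule lin_on_diff[OF endoD(1)[OF au] d(9), symmetric]) (use w endoD(2)[OF y] endoD(2)[OF av] in auto)
      qed
      also have "\<dots> = 0" by (rule t1[OF uv(1,2)])
      finally show "trace_on V (\<lambda>w. act x (y w)) = 0" .
    qed
    \<comment> \<open>The map \<open>s\<close> is the diagonal part of
      \<open>act z \<circ> y\<close>: on the generalized eigenspace for \<open>a\<close> they differ
      by \<open>\<psi> a\<close> times the nilpotent \<open>act z - a\<close>. Hence the two have
      the same trace.\<close>
    obtain s where s: "endo V s" and sv: "\<And>a v. v \<in> gen_eig V (act z) a \<Longrightarrow> s v = scale (\<psi> a * a) v"
      using gen_eig_scalar_map[OF d(3) az, of "\<lambda>a. \<psi> a * a"] by metis
    let ?n = "\<lambda>w. act z (y w) - s w"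
    have n: "endo V ?n" by (rule endo_diff[OF d(9) endo_comp[OF az y] s])
    have "(\<Union>a. gen_eig V (act z) a) \<subseteq> gen_eig V ?n 0"
    proof
      fix w assume "w \<in> (\<Union>a. gen_eig V (act z) a)"
      then obtain a where "w \<in> gen_eig V (act z) a" by blast
      then show "w \<in> gen_eig V ?n 0"
      proof (induction rule: gen_eig_induct[OF d(9) az, consumes 1, case_names zero step])
        case zero
        show ?case by (rule subspace_0[OF gen_eig_subspace[OF d(9) n]])
      next
        case (step w)
        have wV: "w \<in> V" using step(1) gen_eig_subset by blast
        have "act z (y w) = scale (\<psi> a) (act z w)"
          unfolding yv[OF step(1)] by (rule lin_onD(2)[OF endoD(1)[OF az] wV])
        then have "?n w - scale 0 w = scale (\<psi> a) (act z w - scale a w)"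
          using sv[OF step(1)] by (simp add: scale_right_diff_distrib)
        then have "?n w - scale 0 w \<in> gen_eig V ?n 0"
          using subspace_scale[OF gen_eig_subspace[OF d(9) n] step(2)] by simp
        then show ?case by (rule gen_eig_shiftI[OF wV])
      qed
    qed
    then have "span (\<Union>a. gen_eig V (act z) a) \<subseteq> gen_eig V ?n 0"
      by (rule span_minimal[OF _ gen_eig_subspace[OF d(9) n]])
    then have "V \<subseteq> gen_eig V ?n 0" unfolding gen_eig_span[OF d(3) az] .
    then have "loc_nil V ?n" unfolding loc_nil_gen_eig .
    then have "trace_on V ?n = 0" by (rule trace_loc_nil[OF d(3) n])
    then have "trace_on V s = 0" using trace_diff[OF d(3) endo_comp[OF az y] s] tz by simp
    then have "(\<Sum>b\<in>B. \<psi> (ev b) * ev b) = 0"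
      using trace_scalar_basis[OF d(3) B s sv[OF ev]] by simp
    moreover have \<phi>0: "\<phi> 0 = 0" using \<phi>(2)[of 0 0] by simp
    then have "\<phi> (sum g A) = (\<Sum>b\<in>A. \<phi> (g b))" for g and A :: "'b set"
      by (induction A rule: infinite_finite_induct) (auto simp: \<phi>(1))
    then have "\<phi> (\<Sum>b\<in>B. \<psi> (ev b) * ev b) = (\<Sum>b\<in>B. \<phi> (ev b) * \<phi> (ev b))"
      by (simp add: \<psi>_def \<phi>(2))
    ultimately have "(\<Sum>b\<in>B. \<phi> (ev b) * \<phi> (ev b)) = 0" using \<phi>0 by simp
    then have "\<phi> (ev b0) * \<phi> (ev b0) = 0"
      using sum_nonneg_eq_0_iff[OF Bd(1), of "\<lambda>b. \<phi> (ev b) * \<phi> (ev b)"] b0 by simp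
    then show False using \<phi>(3) by simp
  qed
  have "b \<in> gen_eig V (act z) 0" if "b \<in> B" for b using ev[OF that] ev0[OF that] by simp
  then have "span B \<subseteq> gen_eig V (act z) 0" by (intro span_minimal[OF _ gen_eig_subspace[OF d(9) az]] subsetI)
  then show ?thesis unfolding Bd(4) .
qed

text \<open>Elements \<open>z\<close> of \<open>[N, N]\<close> act nilpotently on \<open>V\<close>,
  so 0 is the only eigenvalue there. An eigenvector of \<open>ad z\<close> for
  \<open>s \<noteq> 0\<close> would shift eigenvalues on \<open>V\<close> by \<open>s\<close>; it
  therefore acts as zero, and the assumption on the kernel makes it central. So \<open>ad z\<close>
  is nilpotent, and Engel's theorem applies to \<open>[N, N]\<close>. A central kernel covers both
  adjoint and faithful modules.\<close>

lemma cartan_solvable: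
  assumes r: "lie_rep N c V act" and tf: "\<And>x y. x \<in> N \<Longrightarrow> y \<in> N \<Longrightarrow> trace_form V act x y = 0"
    and ker: "\<And>x y. x \<in> N \<Longrightarrow> (\<And>v. v \<in> V \<Longrightarrow> act x v = 0) \<Longrightarrow> y \<in> N \<Longrightarrow> c x y = 0"
  shows "solvable N c"
proof -
  note d = lie_repD[OF r]
  let ?Q = "derived N c 1"
  have Qi: "ideal N c ?Q" by (rule derived_ideal[OF d(1)])
  have Qe: "?Q = bracket c N N" by simp
  note Qd = idealD[OF Qi]
  have "loc_nil ?Q (c z)" if zQ: "z \<in> ?Q" for z
  proof -
    have z: "z \<in> N" using zQ Qd(2) by blast
    note az = d(4)[OF z] and ez = lie_ad_endo[OF d(1) z]
    have V0: "V \<subseteq> gen_eig V (act z) 0" using cartan_nilpotent[OF r tf] zQ Qe by blast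
    have "gen_eig N (c z) s \<subseteq> gen_eig N (c z) 0" for s
    proof (cases "s = 0")
      case False
      show ?thesis
      proof
        fix u assume u: "u \<in> gen_eig N (c z) s"
        then have uN: "u \<in> N" using gen_eig_subset by blast
        have "act u v = 0" if v: "v \<in> V" for v
        proof (rule other_eig_inter[OF d(3) az])
          show "act u v \<in> gen_eig V (act z) 0" using d(7)[OF uN v] V0 by blast
          have "act u v \<in> gen_eig V (act z) s" using gen_eig_act[OF r z u, of v 0] v V0 by auto
          then show "act u v \<in> other_eig V (act z) 0"
            unfolding other_eig_def using False by (intro span_base) blast
        qed
        then have "c u z = 0" using ker uN z by blast
        then have "c z u - scale 0 u = 0" using lie_anti[OF d(1) z uN] by simp
        then have "c z u - scale 0 u \<in> gen_eig N (c z) 0"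
          using subspace_0[OF gen_eig_subspace[OF d(8) ez]] by simp
        then show "u \<in> gen_eig N (c z) 0" by (rule gen_eig_shiftI[OF uN])
      qed
    qed simp
    then have "(\<Union>s. gen_eig N (c z) s) \<subseteq> gen_eig N (c z) 0" by blast
    then have "span (\<Union>s. gen_eig N (c z) s) \<subseteq> gen_eig N (c z) 0"
      by (rule span_minimal[OF _ gen_eig_subspace[OF d(8) ez]])
    then have "loc_nil N (c z)" unfolding loc_nil_gen_eig gen_eig_span[OF d(2) ez] .
    then show ?thesis using Qd(2) by (auto simp: loc_nil_def)
  qed
  then have "solvable ?Q c"
    by (rule ad_nilpotent_solvable[OF ideal_lie[OF d(1) Qi] fin_subspace_mono[OF d(2) Qd(1,2)]])
  then show ?thesis by (rule solvable_by_derived[OF d(1) order_refl])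
qed

text \<open>The radical of the Killing form is an ideal, and Cartan's criterion for its action on
  \<open>M\<close> makes it solvable, hence zero.\<close>

lemma killing_nondegenerate:
  assumes M: "lie M c" "fin_subspace M" and rf: "radfree M c"
    and x: "x \<in> M" and z: "\<And>y. y \<in> M \<Longrightarrow> trace_form M c x y = 0"
  shows "x = 0"
proof -
  have r: "lie_rep M c M c" by (rule adjoint_rep[OF M])
  let ?N = "{x \<in> M. \<forall>y\<in>M. trace_form M c x y = 0}"
  have N: "ideal M c ?N" by (rule perp_ideal[OF r ideal_self[OF M(1)]])
  have "solvable ?N c"
    by (rule cartan_solvable[OF lie_rep_sub[OF r ideal_subalgebra[OF N]]]) auto
  then have "?N = {0}" using rf N by (simp add: radfree_def solvable_ideal_def)
  then show ?thesis using x z by blast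
qed

end

section \<open>Vanishing of the second cohomology\<close>

context ac_space
begin

lemma killing_ext:
  assumes M: "lie M c" "fin_subspace M" and rf: "radfree M c"
    and x: "x \<in> M" "x' \<in> M" and eq: "\<And>y. y \<in> M \<Longrightarrow> trace_form M c x y = trace_form M c x' y"
  shows "x = x'"
proof -
  note sM = fin_subspace_subspace[OF M(2)]
  have b: "bilin_form M (trace_form M c)" by (rule trace_form_bilin[OF adjoint_rep[OF M]])
  have "x - x' = 0"
  proof (rule killing_nondegenerate[OF M rf subspace_diff[OF sM x]])
    fix y assume y: "y \<in> M"
    show "trace_form M c (x - x') y = 0"
      using functional_on_diff[OF bilin_formD(2)[OF b y] sM x] eq[OF y] by simp
  qed
  then show ?thesis by simp
qed

lemma killing_riesz:
  assumes M: "lie M c" "fin_subspace M" and rf: "radfree M c" and l: "functional_on M l"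
  obtains w where "w \<in> M" "\<And>y. y \<in> M \<Longrightarrow> l y = trace_form M c w y"
proof -
  have "nondegenerate_on M (trace_form M c)"
    unfolding nondegenerate_on_def using killing_nondegenerate[OF M rf] by blast
  then show ?thesis using riesz[OF M(2) trace_form_bilin[OF adjoint_rep[OF M]] _ l] that by blast
qed

text \<open>Represent \<open>x \<mapsto> tr(D ad x)\<close> by an element \<open>z\<close> through
  the Killing form and put \<open>E = D - ad z\<close>. Then \<open>tr(E ad x) = 0\<close> for all
  \<open>x\<close>, and as \<open>ad (E x) = [E, ad x]\<close>, cyclicity gives
  \<open>\<kappa>(E x, y) = tr(E ad [x, y]) = 0\<close>.\<close>

lemma derivation_inner:
  assumes M: "lie M c" "fin_subspace M" and rf: "radfree M c" and D: "endo M D"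
    and der: "\<And>x y. x \<in> M \<Longrightarrow> y \<in> M \<Longrightarrow> D (c x y) = c (D x) y + c x (D y)"
  obtains z where "z \<in> M" "\<And>x. x \<in> M \<Longrightarrow> D x = c z x"
proof -
  note sM = fin_subspace_subspace[OF M(2)]
  note ad = lie_ad_endo[OF M(1)]
  have l: "functional_on M (\<lambda>x. trace_on M (\<lambda>v. D (c x v)))"
  proof (rule trace_functional[OF M(2) _ sM])
    fix x assume "x \<in> M"
    then show "endo M (\<lambda>v. D (c x v))" by (rule endo_comp[OF D ad])
  next
    fix v assume "v \<in> M"
    then have "lin_on M (\<lambda>x. D (c x v))"
      by (intro lin_on_comp[OF endoD(1)[OF D] lie_lin_left[OF M(1)]] lie_closed[OF M(1)])
    then show "\<And>x y. x \<in> M \<Longrightarrow> y \<in> M \<Longrightarrow> D (c (x + y) v) = D (c x v) + D (c y v)"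
      and "\<And>a x. x \<in> M \<Longrightarrow> D (c (scale a x) v) = scale a (D (c x v))" by (auto dest: lin_onD)
  qed
  obtain z where z: "z \<in> M" and lz: "\<And>y. y \<in> M \<Longrightarrow> trace_on M (\<lambda>v. D (c y v)) = trace_form M c z y"
    by (rule killing_riesz[OF M rf l]) blast
  define E where "E = (\<lambda>x. D x - c z x)"
  have E: "endo M E" unfolding E_def by (rule endo_diff[OF sM D ad[OF z]])
  have trE: "trace_on M (\<lambda>v. E (c x v)) = 0" if x: "x \<in> M" for x
  proof -
    have "trace_on M (\<lambda>v. E (c x v)) = trace_on M (\<lambda>v. D (c x v)) - trace_on M (\<lambda>v. c z (c x v))"
      unfolding E_def by (rule trace_diff[OF M(2) endo_comp[OF D ad[OF x]] endo_comp[OF ad[OF z] ad[OF x]]])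
    then show ?thesis using lz[OF x] by (simp add: trace_form_def)
  qed
  have Eder: "E (c x y) = c (E x) y + c x (E y)" if xy: "x \<in> M" "y \<in> M" for x y
  proof -
    have zx: "c z x \<in> M" "c z y \<in> M" "D x \<in> M" "D y \<in> M"
      using lie_closed[OF M(1) z] endoD(2)[OF D] xy by auto
    have "c (E x) y = c (D x) y - c (c z x) y"
      unfolding E_def by (rule lin_on_diff[OF lie_lin_left[OF M(1) xy(2)] sM zx(3,1)])
    moreover have "c x (E y) = c x (D y) - c x (c z y)"
      unfolding E_def by (rule lin_on_diff[OF lie_lin_right[OF M(1) xy(1)] sM zx(4,2)])
    moreover have "c (c z x) y = c z (c x y) - c x (c z y)" by (rule lie_jacobi[OF M(1) z xy])
    ultimately show ?thesis unfolding E_def der[OF xy] by simp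
  qed
  have "E x = 0" if x: "x \<in> M" for x
  proof (rule killing_nondegenerate[OF M rf endoD(2)[OF E x]])
    fix y assume y: "y \<in> M"
    note ax = ad[OF x] and ay = ad[OF y]
    have e1: "endo M (\<lambda>v. E (c x (c y v)))" by (rule endo_comp[OF E endo_comp[OF ax ay]])
    have e2: "endo M (\<lambda>v. c x (E (c y v)))" by (rule endo_comp[OF ax endo_comp[OF E ay]])
    have e3: "endo M (\<lambda>v. E (c y (c x v)))" by (rule endo_comp[OF E endo_comp[OF ay ax]])
    have "trace_form M c (E x) y = trace_on M (\<lambda>v. E (c x (c y v)) - c x (E (c y v)))"
      unfolding trace_form_def
    proof (rule trace_cong[OF M(2) endo_comp[OF ad[OF endoD(2)[OF E x]] ay]])
      fix v assume v: "v \<in> M"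
      show "c (E x) (c y v) = E (c x (c y v)) - c x (E (c y v))"
        using Eder[OF x lie_closed[OF M(1) y v]] by simp
    qed
    also have "\<dots> = trace_on M (\<lambda>v. E (c x (c y v))) - trace_on M (\<lambda>v. c x (E (c y v)))"
      by (rule trace_diff[OF M(2) e1 e2])
    also have "trace_on M (\<lambda>v. c x (E (c y v))) = trace_on M (\<lambda>v. E (c y (c x v)))"
      by (rule trace_commute[OF M(2) ax endo_comp[OF E ay]])
    also have "trace_on M (\<lambda>v. E (c x (c y v))) - trace_on M (\<lambda>v. E (c y (c x v)))
      = trace_on M (\<lambda>v. E (c x (c y v)) - E (c y (c x v)))"
      by (rule trace_diff[OF M(2) e1 e3, symmetric])
    also have "\<dots> = trace_on M (\<lambda>v. E (c (c x y) v))"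
    proof (rule trace_cong[OF M(2) endo_diff[OF sM e1 e3]])
      fix v assume v: "v \<in> M"
      have m: "c x (c y v) \<in> M" "c y (c x v) \<in> M" using lie_closed[OF M(1)] x y v by auto
      show "E (c x (c y v)) - E (c y (c x v)) = E (c (c x y) v)"
        using lin_on_diff[OF endoD(1)[OF E] sM m] lie_jacobi[OF M(1) x y v] by simp
    qed
    also have "\<dots> = 0" by (rule trE[OF lie_closed[OF M(1) x y]])
    finally show "trace_form M c (E x) y = 0" .
  qed
  then have "D x = c z x" if "x \<in> M" for x using that by (simp add: E_def)
  then show ?thesis using that z by blast
qed

text \<open>The Chevalley-Eilenberg condition for 2-cocycles, written with a cyclic sum on either
  side.\<close>

definition lie_cocycle :: "'b set \<Rightarrow> ('b \<Rightarrow> 'b \<Rightarrow> 'b) \<Rightarrow> 'b set \<Rightarrow> ('b \<Rightarrow> 'b \<Rightarrow> 'b) \<Rightarrow> ('b \<Rightarrow> 'b \<Rightarrow> 'b) \<Rightarrow> bool" where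
  "lie_cocycle M c V act f \<longleftrightarrow> (\<forall>x\<in>M. \<forall>y\<in>M. f x y \<in> V) \<and> (\<forall>x\<in>M. lin_on M (f x)) \<and> (\<forall>y\<in>M. lin_on M (\<lambda>x. f x y)) \<and>
     (\<forall>x\<in>M. \<forall>y\<in>M. f x y = - f y x) \<and>
     (\<forall>x\<in>M. \<forall>y\<in>M. \<forall>z\<in>M. act x (f y z) + act y (f z x) + act z (f x y) = f (c x y) z + f (c y z) x + f (c z x) y)"

definition lie_coboundary :: "'b set \<Rightarrow> ('b \<Rightarrow> 'b \<Rightarrow> 'b) \<Rightarrow> 'b set \<Rightarrow> ('b \<Rightarrow> 'b \<Rightarrow> 'b) \<Rightarrow> ('b \<Rightarrow> 'b \<Rightarrow> 'b) \<Rightarrow> bool" where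
  "lie_coboundary M c V act f \<longleftrightarrow> (\<exists>h. lin_on M h \<and> (\<forall>x\<in>M. h x \<in> V) \<and>
     (\<forall>x\<in>M. \<forall>y\<in>M. f x y = act x (h y) - act y (h x) - h (c x y)))"

lemma lie_cocycleD:
  assumes "lie_cocycle M c V act f"
  shows "x \<in> M \<Longrightarrow> y \<in> M \<Longrightarrow> f x y \<in> V" "x \<in> M \<Longrightarrow> lin_on M (f x)" "y \<in> M \<Longrightarrow> lin_on M (\<lambda>x. f x y)"
    "x \<in> M \<Longrightarrow> y \<in> M \<Longrightarrow> f x y = - f y x"
    "x \<in> M \<Longrightarrow> y \<in> M \<Longrightarrow> z \<in> M \<Longrightarrow>
      act x (f y z) + act y (f z x) + act z (f x y) = f (c x y) z + f (c y z) x + f (c z x) y"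
  using assms unfolding lie_cocycle_def by blast+

text \<open>For trivial coefficients, writing a scalar cocycle as \<open>\<kappa> (D x) y\<close> with the Killing form \<open>\<kappa>\<close>
  turns the cocycle identity into the derivation rule for \<open>D\<close>.\<close>

lemma whitehead_trivial:
  assumes r: "lie_rep M c V act" and rf: "radfree M c" and f: "lie_cocycle M c V act f"
    and triv: "\<And>x v. x \<in> M \<Longrightarrow> v \<in> V \<Longrightarrow> act x v = 0"
  shows "lie_coboundary M c V act f"
proof -
  note d = lie_repD[OF r] and fd = lie_cocycleD[OF f]
  note M = d(1,2) and sM = d(8)
  let ?\<kappa> = "trace_form M c"
  have ar: "lie_rep M c M c" by (rule adjoint_rep[OF M])
  have bil: "bilin_form M ?\<kappa>" by (rule trace_form_bilin[OF ar])
  note b1 = bilin_formD(1)[OF bil] and b2 = bilin_formD(2)[OF bil]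
  have cyc: "f (c x y) z + f (c y z) x + f (c z x) y = 0" if "x \<in> M" "y \<in> M" "z \<in> M" for x y z
    using fd(5)[OF that] triv[OF that(1) fd(1)[OF that(2,3)]] triv[OF that(2) fd(1)[OF that(3,1)]]
      triv[OF that(3) fd(1)[OF that(1,2)]] by simp
  obtain B where B: "basis_of V B" using basis_of_exists[OF d(3)] .
  note Bd = basis_ofD[OF B]
  \<comment> \<open>With trivial action each coordinate of \<open>f\<close> is a scalar cocycle by
    itself.\<close>
  have "\<exists>z. z \<in> M \<and> (\<forall>x\<in>M. \<forall>y\<in>M. representation B (f x y) b = ?\<kappa> z (c x y))" for b
  proof -
    let ?g = "\<lambda>x y. representation B (f x y) b"
    note rep = functional_representation[OF B, of b]
    have g1: "functional_on M (?g x)" if x: "x \<in> M" for x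
      unfolding functional_on_def
      by (simp add: lin_onD[OF fd(2)[OF x]] functional_onD[OF rep] fd(1)[OF x])
    have g2: "functional_on M (\<lambda>x. ?g x y)" if y: "y \<in> M" for y
      unfolding functional_on_def
      by (simp add: lin_onD[OF fd(3)[OF y]] functional_onD[OF rep] fd(1)[OF _ y])
    have ganti: "?g x y = - ?g y x" if "x \<in> M" "y \<in> M" for x y
      unfolding fd(4)[OF that] using functional_onD(2)[OF rep fd(1)[OF that(2,1)], of "-1"] by simp
    have gcyc: "?g (c x y) z + ?g (c y z) x + ?g (c z x) y = 0" if m: "x \<in> M" "y \<in> M" "z \<in> M" for x y z
    proof -
      have v: "f (c x y) z \<in> V" "f (c y z) x \<in> V" "f (c z x) y \<in> V"
        using m by (auto intro!: fd(1) lie_closed[OF M(1)])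
      have "?g (c x y) z + ?g (c y z) x + ?g (c z x) y
        = representation B (f (c x y) z + f (c y z) x + f (c z x) y) b"
        using functional_onD(1)[OF rep v(1,2)] functional_onD(1)[OF rep subspace_add[OF d(9) v(1,2)] v(3)] by simp
      also have "\<dots> = 0" unfolding cyc[OF m] using functional_on_0[OF rep d(9)] .
      finally show ?thesis .
    qed
    have "\<exists>w. w \<in> M \<and> (\<forall>y\<in>M. ?g x y = ?\<kappa> w y)" if x: "x \<in> M" for x
      by (rule killing_riesz[OF M rf g1[OF x]]) blast
    then have "\<forall>x\<in>M. \<exists>w. w \<in> M \<and> (\<forall>y\<in>M. ?g x y = ?\<kappa> w y)" by blast
    from bchoice[OF this] obtain D
      where DM: "\<And>x. x \<in> M \<Longrightarrow> D x \<in> M" and Dg: "\<And>x y. x \<in> M \<Longrightarrow> y \<in> M \<Longrightarrow> ?g x y = ?\<kappa> (D x) y"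
      by blast
    have De: "endo M D" unfolding endo_def lin_on_def
    proof (intro conjI ballI allI)
      fix x y assume xy: "x \<in> M" "y \<in> M"
      show "D (x + y) = D x + D y"
      proof (rule killing_ext[OF M rf DM[OF subspace_add[OF sM xy]] subspace_add[OF sM DM[OF xy(1)] DM[OF xy(2)]]])
        fix z assume z: "z \<in> M"
        have "?\<kappa> (D (x + y)) z = ?g x z + ?g y z"
          using Dg[OF subspace_add[OF sM xy] z] functional_onD(1)[OF g2[OF z] xy] by simp
        also have "\<dots> = ?\<kappa> (D x + D y) z"
          using Dg[OF xy(1) z] Dg[OF xy(2) z] functional_onD(1)[OF b2[OF z] DM[OF xy(1)] DM[OF xy(2)]] by simp
        finally show "?\<kappa> (D (x + y)) z = ?\<kappa> (D x + D y) z" .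
      qed
    next
      fix a x assume x: "x \<in> M"
      show "D (scale a x) = scale a (D x)"
      proof (rule killing_ext[OF M rf DM[OF subspace_scale[OF sM x]] subspace_scale[OF sM DM[OF x]]])
        fix z assume z: "z \<in> M"
        have "?\<kappa> (D (scale a x)) z = a * ?g x z"
          using Dg[OF subspace_scale[OF sM x] z] functional_onD(2)[OF g2[OF z] x] by simp
        also have "\<dots> = ?\<kappa> (scale a (D x)) z"
          using Dg[OF x z] functional_onD(2)[OF b2[OF z] DM[OF x]] by simp
        finally show "?\<kappa> (D (scale a x)) z = ?\<kappa> (scale a (D x)) z" .
      qed
    qed (rule DM)
    have inv: "?\<kappa> (c x y) z = ?\<kappa> x (c y z)" if "x \<in> M" "y \<in> M" "z \<in> M" for x y z
      by (rule trace_form_invariant[OF ar that])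
    have cl: "c x y \<in> M" if "x \<in> M" "y \<in> M" for x y by (rule lie_closed[OF M(1) that])
    have der: "D (c x y) = c (D x) y + c x (D y)" if xy: "x \<in> M" "y \<in> M" for x y
    proof (rule killing_ext[OF M rf DM[OF cl[OF xy]]])
      note x = xy(1) and y = xy(2)
      show "c (D x) y + c x (D y) \<in> M" by (intro subspace_add[OF sM] cl DM xy)
      fix z assume z: "z \<in> M"
      have "?\<kappa> (D (c x y)) z = ?g (c x y) z" using Dg[OF cl[OF xy] z] by simp
      also have "\<dots> = - ?g (c y z) x - ?g (c z x) y"
      proof -
        have "?g (c z x) y = - (?g (c x y) z + ?g (c y z) x)" using gcyc[OF xy z] by (simp only: add_eq_0_iff)
        then show ?thesis by simp
      qed
      also have "\<dots> = ?g x (c y z) + ?g y (c z x)"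
        unfolding ganti[OF cl[OF y z] x] ganti[OF cl[OF z x] y] by simp
      also have "\<dots> = ?\<kappa> (D x) (c y z) + ?\<kappa> (D y) (c z x)" using Dg[OF x cl[OF y z]] Dg[OF y cl[OF z x]] by simp
      also have "?\<kappa> (D x) (c y z) = ?\<kappa> (c (D x) y) z" using inv[OF DM[OF x] y z] by simp
      also have "c z x = scale (- 1) (c x z)" using lie_anti[OF M(1) z x] by simp
      also have "?\<kappa> (D y) (scale (- 1) (c x z)) = - ?\<kappa> (c (D y) x) z"
        using functional_onD(2)[OF b1[OF DM[OF y]] cl[OF x z], of "- 1"] inv[OF DM[OF y] x z] by simp
      also have "\<dots> = ?\<kappa> (scale (- 1) (c (D y) x)) z"
        using functional_onD(2)[OF b2[OF z] cl[OF DM[OF y] x], of "- 1"] by simp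
      also have "scale (- 1) (c (D y) x) = c x (D y)" using lie_anti[OF M(1) x DM[OF y]] by simp
      also have "?\<kappa> (c (D x) y) z + ?\<kappa> (c x (D y)) z = ?\<kappa> (c (D x) y + c x (D y)) z"
        by (rule functional_onD(1)[OF b2[OF z] cl[OF DM[OF x] y] cl[OF x DM[OF y]], symmetric])
      finally show "?\<kappa> (D (c x y)) z = ?\<kappa> (c (D x) y + c x (D y)) z" .
    qed
    \<comment> \<open>With \<open>D = ad w\<close>, invariance gives
      \<open>g(x, y) = \<kappa>([w, x], y) = \<kappa>(w, [x, y])\<close>, so the cocycle depends on
      \<open>[x, y]\<close> only.\<close>
    obtain w where w: "w \<in> M" "\<And>x. x \<in> M \<Longrightarrow> D x = c w x"
      by (rule derivation_inner[OF M rf De der]) blast+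
    show ?thesis
    proof (intro exI[of _ w] conjI w(1) ballI)
      fix x y assume xy: "x \<in> M" "y \<in> M"
      show "?g x y = ?\<kappa> w (c x y)" using Dg[OF xy] w(2)[OF xy(1)] inv[OF w(1) xy] by simp
    qed
  qed
  then have "\<forall>b. \<exists>z. z \<in> M \<and> (\<forall>x\<in>M. \<forall>y\<in>M. representation B (f x y) b = ?\<kappa> z (c x y))" by blast
  from choice[OF this] obtain z
    where zM: "\<And>b. z b \<in> M" and zf: "\<And>b x y. x \<in> M \<Longrightarrow> y \<in> M \<Longrightarrow> representation B (f x y) b = ?\<kappa> (z b) (c x y)"
    by blast
  \<comment> \<open>The sign fits the coboundary of \<open>h\<close>, which for trivial action is
    just \<open>- h (c x y)\<close>.\<close>
  define h where "h = (\<lambda>w. \<Sum>b\<in>B. scale (- ?\<kappa> (z b) w) b)"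
  have "functional_on M (\<lambda>w. - ?\<kappa> (z b) w)" for b
    using functional_onD[OF b1[OF zM]] by (simp add: functional_on_def)
  then have "lin_on M h" unfolding h_def by (rule lin_on_functional_sum)
  moreover have hV: "h x \<in> V" for x
    unfolding h_def by (intro subspace_sum[OF d(9)] subspace_scale[OF d(9)]) (use Bd in auto)
  moreover have "f x y = act x (h y) - act y (h x) - h (c x y)" if xy: "x \<in> M" "y \<in> M" for x y
  proof -
    have "f x y = (\<Sum>b\<in>B. scale (representation B (f x y) b) b)" using basis_rep_sum[OF B fd(1)[OF xy]] by simp
    also have "\<dots> = - h (c x y)" unfolding h_def by (simp add: zf[OF xy] sum_negf)
    finally show ?thesis using triv hV xy by simp
  qed
  ultimately show ?thesis unfolding lie_coboundary_def by blast
qed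

text \<open>The tensor \<open>\<Sum> b \<otimes> e b\<close> is invariant under \<open>x\<close>: by
  invariance of the form, the matrix of \<open>ad x\<close> in the dual basis is minus the transpose
  of that in \<open>B\<close>. The arbitrary bilinear \<open>F\<close> takes the place of the tensor
  product, so that the same identity serves the Casimir operator and the map built from a
  cocycle.\<close>

lemma casimir_identity:
  assumes r: "lie_rep M c V act" and P: "ideal M c P" and B: "basis_of P B"
    and e: "\<And>b. b \<in> B \<Longrightarrow> e b \<in> P"
    and e2: "\<And>b b'. b \<in> B \<Longrightarrow> b' \<in> B \<Longrightarrow> trace_form V act (e b) b' = (if b = b' then 1 else 0)"
    and e3: "\<And>x. x \<in> P \<Longrightarrow> x = (\<Sum>b\<in>B. scale (trace_form V act x b) (e b))"
    and x: "x \<in> M"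
    and F1: "\<And>u. u \<in> P \<Longrightarrow> lin_on P (F u)" and F2: "\<And>w. w \<in> P \<Longrightarrow> lin_on P (\<lambda>u. F u w)"
  shows "(\<Sum>b\<in>B. F (c x b) (e b)) = - (\<Sum>b\<in>B. F b (c x (e b)))"
proof -
  note d = lie_repD[OF r] and Pd = idealD[OF P] and Bd = basis_ofD[OF B]
  let ?\<beta> = "trace_form V act"
  have bil: "bilin_form M ?\<beta>" by (rule trace_form_bilin[OF r])
  have bP: "b \<in> P" if "b \<in> B" for b using that Bd(3) by blast
  have coef: "representation B w b = ?\<beta> (e b) w" if w: "w \<in> P" and b: "b \<in> B" for w b
  proof -
    have fl: "functional_on P (?\<beta> (e b))"
      using functional_on_subset[OF bilin_formD(1)[OF bil] Pd(2)] e[OF b] Pd(2) by blast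
    have "?\<beta> (e b) w = (\<Sum>b'\<in>B. representation B w b' * ?\<beta> (e b) b')" by (rule functional_rep[OF B fl w])
    also have "\<dots> = (\<Sum>b'\<in>B. if b' = b then representation B w b' else 0)"
      by (rule sum.cong[OF refl]) (use e2[OF b] in auto)
    also have "\<dots> = representation B w b" using Bd(1) b by simp
    finally show ?thesis by simp
  qed
  \<comment> \<open>The matrix of \<open>ad x\<close> in the basis \<open>B\<close>: coordinates are
    read off by pairing with the dual basis.\<close>
  let ?A = "\<lambda>b b'. ?\<beta> (e b') (c x b)"
  have 1: "F (c x b) (e b) = (\<Sum>b'\<in>B. scale (?A b b') (F b' (e b)))" if b: "b \<in> B" for b
  proof -
    have xb: "c x b \<in> P" by (rule Pd(3)[OF x bP[OF b]])
    have "c x b = (\<Sum>b'\<in>B. scale (?A b b') b')" using basis_rep_sum[OF B xb] coef[OF xb] by simp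
    then have "F (c x b) (e b) = F (\<Sum>b'\<in>B. scale (?A b b') b') (e b)" by simp
    also have "\<dots> = (\<Sum>b'\<in>B. F (scale (?A b b') b') (e b))"
      by (rule lin_on_sum[OF F2[OF e[OF b]] Pd(1)]) (use subspace_scale[OF Pd(1) bP] in blast)
    also have "\<dots> = (\<Sum>b'\<in>B. scale (?A b b') (F b' (e b)))"
      by (rule sum.cong[OF refl]) (rule lin_onD(2)[OF F2[OF e[OF b]] bP])
    finally show ?thesis .
  qed
  have 2: "F b (c x (e b)) = (\<Sum>b'\<in>B. scale (- ?A b' b) (F b (e b')))" if b: "b \<in> B" for b
  proof -
    have eM: "e b \<in> M" using e[OF b] Pd(2) by blast
    have xe: "c x (e b) \<in> P" by (rule Pd(3)[OF x e[OF b]])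
    have co: "?\<beta> (c x (e b)) b' = - ?A b' b" if b': "b' \<in> B" for b'
    proof -
      have b'M: "b' \<in> M" using bP[OF b'] Pd(2) by blast
      have "c x (e b) = scale (- 1) (c (e b) x)" using lie_anti[OF d(1) x eM] by simp
      then have "?\<beta> (c x (e b)) b' = - ?\<beta> (c (e b) x) b'"
        using functional_onD(2)[OF bilin_formD(2)[OF bil b'M] lie_closed[OF d(1) eM x], of "- 1"] by simp
      then show ?thesis using trace_form_invariant[OF r eM x b'M] by simp
    qed
    have "c x (e b) = (\<Sum>b'\<in>B. scale (?\<beta> (c x (e b)) b') (e b'))" by (rule e3[OF xe])
    also have "\<dots> = (\<Sum>b'\<in>B. scale (- ?A b' b) (e b'))" using co by simp
    finally have "F b (c x (e b)) = F b (\<Sum>b'\<in>B. scale (- ?A b' b) (e b'))" by simp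
    also have "\<dots> = (\<Sum>b'\<in>B. F b (scale (- ?A b' b) (e b')))"
      by (rule lin_on_sum[OF F1[OF bP[OF b]] Pd(1)]) (use subspace_scale[OF Pd(1) e] in blast)
    also have "\<dots> = (\<Sum>b'\<in>B. scale (- ?A b' b) (F b (e b')))"
      by (rule sum.cong[OF refl]) (rule lin_onD(2)[OF F1[OF bP[OF b]] e])
    finally show ?thesis .
  qed
  have "(\<Sum>b\<in>B. F (c x b) (e b)) = (\<Sum>b\<in>B. \<Sum>b'\<in>B. scale (?A b b') (F b' (e b)))"
    by (rule sum.cong[OF refl 1])
  also have "\<dots> = (\<Sum>b'\<in>B. \<Sum>b\<in>B. scale (?A b b') (F b' (e b)))" by (rule sum.swap)
  also have "\<dots> = - (\<Sum>b'\<in>B. \<Sum>b\<in>B. scale (- ?A b b') (F b' (e b)))" by (simp add: sum_negf)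
  also have "(\<Sum>b'\<in>B. \<Sum>b\<in>B. scale (- ?A b b') (F b' (e b))) = (\<Sum>b\<in>B. F b (c x (e b)))"
    by (rule sum.cong[OF refl 2[symmetric]])
  finally show ?thesis .
qed

text \<open>Let \<open>C\<close> be the kernel of the action and \<open>P\<close> its orthogonal for
  the Killing form. The two meet in 0, so \<open>P\<close> acts faithfully and Cartan's criterion
  removes the radical of the trace form on \<open>P\<close>. If \<open>P\<close> were 0, the
  functional \<open>\<kappa>(x0, _)\<close> on \<open>C\<close> would be represented by some
  \<open>w \<in> C\<close>, and \<open>x0 - w \<in> P\<close> would give
  \<open>x0 = w \<in> C\<close>, although \<open>x0\<close> acts non-trivially.\<close>

lemma faithful_ideal:
  assumes r: "lie_rep M c V act" and rf: "radfree M c"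
    and nontriv: "x0 \<in> M" "v0 \<in> V" "act x0 v0 \<noteq> 0"
  obtains P where "ideal M c P" "P \<noteq> {0}" "nondegenerate_on P (trace_form V act)"
proof -
  note d = lie_repD[OF r]
  note M = d(1,2) and sM = d(8)
  let ?\<kappa> = "trace_form M c"
  have ar: "lie_rep M c M c" by (rule adjoint_rep[OF M])
  have bil: "bilin_form M ?\<kappa>" by (rule trace_form_bilin[OF ar])
  define C where "C = {x \<in> M. \<forall>v\<in>V. act x v = 0}"
  have C: "ideal M c C"
  proof (rule idealI)
    show "subspace C" unfolding C_def
      by (rule subspaceI)
        (auto simp: subspace_0[OF sM] subspace_add[OF sM] subspace_scale[OF sM] lin_on_0[OF d(5) sM] lin_onD[OF d(5)])
    show "C \<subseteq> M" by (auto simp: C_def)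
    fix x y assume x: "x \<in> M" and y: "y \<in> C"
    then have yM: "y \<in> M" and y0: "\<And>v. v \<in> V \<Longrightarrow> act y v = 0" by (auto simp: C_def)
    have "act (c x y) v = 0" if v: "v \<in> V" for v
      using d(6)[OF x yM v] y0[OF v] y0[OF d(7)[OF x v]] lin_on_0[OF endoD(1)[OF d(4)[OF x]] d(9)] by simp
    then show "c x y \<in> C" using lie_closed[OF M(1) x yM] by (simp add: C_def)
  qed
  note Cd = idealD[OF C]
  define P where "P = {x \<in> M. \<forall>y\<in>C. ?\<kappa> x y = 0}"
  have P: "ideal M c P" unfolding P_def by (rule perp_ideal[OF ar C])
  note Pd = idealD[OF P]
  \<comment> \<open>The intersection is abelian: for \<open>y \<in> C\<close> also
    \<open>[y, w] \<in> C\<close>, so \<open>\<kappa>([x, y], w) = \<kappa>(x, [y, w]) = 0\<close>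
    for every \<open>w\<close>.\<close>
  have PC: "P \<inter> C = {0}"
  proof (rule radfree_abelian_ideal[OF M(1) rf ideal_inter[OF P C]])
    fix x y assume xy: "x \<in> P \<inter> C" "y \<in> P \<inter> C"
    then have m: "x \<in> M" "y \<in> M" using Cd(2) by auto
    show "c x y = 0"
    proof (rule killing_nondegenerate[OF M rf lie_closed[OF M(1) m]])
      fix w assume w: "w \<in> M"
      have "c y w \<in> C" using ideal_right[OF M(1) C w] xy by blast
      then show "?\<kappa> (c x y) w = 0" using trace_form_invariant[OF ar m w] xy(1) by (auto simp: P_def)
    qed
  qed
  have P0: "P \<noteq> {0}"
  proof
    assume P0: "P = {0}"
    have fC: "fin_subspace C" by (rule fin_subspace_mono[OF M(2) Cd(1,2)])
    have fl: "functional_on C (?\<kappa> x0)" by (rule functional_on_subset[OF bilin_formD(1)[OF bil nontriv(1)] Cd(2)])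
    have "x = 0" if "x \<in> C" "\<forall>y\<in>C. ?\<kappa> x y = 0" for x
    proof -
      have "x \<in> P \<inter> C" using that Cd(2) by (auto simp: P_def)
      then show ?thesis using PC by blast
    qed
    then have nC: "nondegenerate_on C ?\<kappa>" unfolding nondegenerate_on_def by blast
    obtain w where w: "w \<in> C" "\<And>y. y \<in> C \<Longrightarrow> ?\<kappa> x0 y = ?\<kappa> w y"
      using riesz[OF fC bilin_form_subset[OF bil Cd(2)] nC fl] by metis
    have wM: "w \<in> M" using w(1) Cd(2) by blast
    have "?\<kappa> (x0 - w) y = 0" if y: "y \<in> C" for y
      using functional_on_diff[OF bilin_formD(2)[OF bil, of y] sM nontriv(1) wM] w(2)[OF y] y Cd(2) by auto
    then have "x0 - w \<in> P" using subspace_diff[OF sM nontriv(1) wM] by (simp add: P_def)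
    then have "x0 = w" using P0 by simp
    then show False using w(1) nontriv by (simp add: C_def)
  qed
  let ?N = "P \<inter> {x \<in> M. \<forall>y\<in>P. trace_form V act x y = 0}"
  have N: "ideal M c ?N" by (rule ideal_inter[OF P perp_ideal[OF r P]])
  have "solvable ?N c"
  proof (rule cartan_solvable[OF lie_rep_sub[OF r ideal_subalgebra[OF N]]])
    fix x y assume "x \<in> ?N" "y \<in> ?N"
    then show "trace_form V act x y = 0" by blast
  next
    fix x y assume x: "x \<in> ?N" "\<And>v. v \<in> V \<Longrightarrow> act x v = 0" and y: "y \<in> ?N"
    then have "x \<in> P \<inter> C" by (auto simp: C_def)
    then have "x = 0" using PC by blast
    then show "c x y = 0" using lie_0_left[OF M(1)] y by blast
  qed
  then have N0: "?N = {0}" using rf N by (simp add: radfree_def solvable_ideal_def)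
  show ?thesis
  proof (rule that[OF P P0])
    have "x \<in> ?N" if "x \<in> P" "\<forall>y\<in>P. trace_form V act x y = 0" for x using that Pd(2) by auto
    then show "nondegenerate_on P (trace_form V act)" unfolding nondegenerate_on_def N0 by blast
  qed
qed

text \<open>With the Casimir operator \<open>\<Gamma> = \<Sum>b e\<^sub>b\<close> and \<open>g x = \<Sum>b f(e\<^sub>b, x)\<close>, the coboundary of \<open>g\<close> is
  \<open>\<Gamma> f\<close>; moreover \<open>\<Gamma>\<close> is invertible because it commutes with the action and has non-zero trace.\<close>

lemma whitehead_nontrivial:
  assumes r: "lie_rep M c V act" and rf: "radfree M c" and f: "lie_cocycle M c V act f"
    and nontriv: "x0 \<in> M" "v0 \<in> V" "act x0 v0 \<noteq> 0"
    and irr: "\<And>U. subspace U \<Longrightarrow> U \<subseteq> V \<Longrightarrow> (\<And>x u. x \<in> M \<Longrightarrow> u \<in> U \<Longrightarrow> act x u \<in> U) \<Longrightarrow> U = {0} \<or> U = V"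
  shows "lie_coboundary M c V act f"
proof -
  note d = lie_repD[OF r] and fd = lie_cocycleD[OF f]
  note M = d(1,2) and sM = d(8) and sV = d(9)
  let ?\<beta> = "trace_form V act"
  have bil: "bilin_form M ?\<beta>" by (rule trace_form_bilin[OF r])
  obtain P where P: "ideal M c P" and P0: "P \<noteq> {0}"
    and nd: "nondegenerate_on P ?\<beta>"
    using faithful_ideal[OF r rf nontriv] by metis
  note Pd = idealD[OF P]
  have fP: "fin_subspace P" by (rule fin_subspace_mono[OF M(2) Pd(1,2)])
  obtain B where B: "basis_of P B" using basis_of_exists[OF fP] .
  note Bd = basis_ofD[OF B]
  obtain e where e: "\<And>b. b \<in> B \<Longrightarrow> e b \<in> P"
    and e2: "\<And>b b'. b \<in> B \<Longrightarrow> b' \<in> B \<Longrightarrow> ?\<beta> (e b) b' = (if b = b' then 1 else 0)"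
    and e3: "\<And>x. x \<in> P \<Longrightarrow> x = (\<Sum>b\<in>B. scale (?\<beta> x b) (e b))"
    using dual_basis_exists[OF B bilin_form_subset[OF bil Pd(2)] nd] by metis
  have bM: "b \<in> M" if "b \<in> B" for b using that Bd(3) Pd(2) by blast
  have eM: "e b \<in> M" if "b \<in> B" for b using e[OF that] Pd(2) by blast
  have cas: "(\<Sum>b\<in>B. F (c x b) (e b)) = - (\<Sum>b\<in>B. F b (c x (e b)))"
    if "x \<in> M" "\<And>u. u \<in> P \<Longrightarrow> lin_on P (F u)" "\<And>w. w \<in> P \<Longrightarrow> lin_on P (\<lambda>u. F u w)" for F x
    by (rule casimir_identity[OF r P B])
      (erule e, erule (1) e2, erule e3, rule that(1), erule that(2), erule that(3))
  have B0: "B \<noteq> {}"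
  proof
    assume "B = {}"
    then have "span B = {0}" by simp
    then show False using Bd(4) P0 by simp
  qed
  have act_sum: "act x (\<Sum>i\<in>I. g i) = (\<Sum>i\<in>I. act x (g i))" if "x \<in> M" "\<And>i. i \<in> I \<Longrightarrow> g i \<in> V"
    for x g and I :: "'b set"
    by (rule lin_on_sum[OF endoD(1)[OF d(4)[OF that(1)]] sV that(2)])
  have act_diff: "act x (u - v) = act x u - act x v" if "x \<in> M" "u \<in> V" "v \<in> V" for x u v
    by (rule lin_on_diff[OF endoD(1)[OF d(4)[OF that(1)]] sV that(2,3)])
  have comm: "act x (act b v) = act (c x b) v + act b (act x v)" if "x \<in> M" "b \<in> M" "v \<in> V" for x b v
    using d(6)[OF that] by simp
  define \<Gamma> where "\<Gamma> = (\<lambda>v. \<Sum>b\<in>B. act b (act (e b) v))"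
  have \<Gamma>: "endo V \<Gamma>" unfolding \<Gamma>_def
    by (rule endo_sum[OF sV]) (rule endo_comp[OF d(4)[OF bM] d(4)[OF eM]])
  have \<Gamma>_comm: "act x (\<Gamma> v) = \<Gamma> (act x v)" if x: "x \<in> M" and v: "v \<in> V" for x v
  proof -
    have "act x (\<Gamma> v) = (\<Sum>b\<in>B. act x (act b (act (e b) v)))" unfolding \<Gamma>_def
      by (rule act_sum[OF x]) (intro d(7) bM eM v)
    also have "\<dots> = (\<Sum>b\<in>B. act (c x b) (act (e b) v) + (act b (act (c x (e b)) v) + act b (act (e b) (act x v))))"
    proof (rule sum.cong[OF refl])
      fix b assume b: "b \<in> B"
      have "act x (act (e b) v) = act (c x (e b)) v + act (e b) (act x v)" by (rule comm[OF x eM[OF b] v])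
      then have "act b (act x (act (e b) v)) = act b (act (c x (e b)) v) + act b (act (e b) (act x v))"
        using lin_onD(1)[OF endoD(1)[OF d(4)[OF bM[OF b]]] d(7)[OF lie_closed[OF M(1) x eM[OF b]] v] d(7)[OF eM[OF b] d(7)[OF x v]]]
        by simp
      then show "act x (act b (act (e b) v)) = act (c x b) (act (e b) v) + (act b (act (c x (e b)) v) + act b (act (e b) (act x v)))"
        using comm[OF x bM[OF b] d(7)[OF eM[OF b] v]] by simp
    qed
    also have "\<dots> = (\<Sum>b\<in>B. act (c x b) (act (e b) v)) + ((\<Sum>b\<in>B. act b (act (c x (e b)) v)) + \<Gamma> (act x v))"
      by (simp add: sum.distrib \<Gamma>_def)
    also have "(\<Sum>b\<in>B. act (c x b) (act (e b) v)) = - (\<Sum>b\<in>B. act b (act (c x (e b)) v))"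
    proof (rule cas[OF x])
      fix u assume u: "u \<in> P"
      have uM: "u \<in> M" using u Pd(2) by blast
      show "lin_on P (\<lambda>w. act u (act w v))"
        by (rule lin_on_subset[OF lin_on_comp[OF endoD(1)[OF d(4)[OF uM]] d(5)[OF v] d(7)[OF _ v]] Pd(2)])
      show "lin_on P (\<lambda>w. act w (act u v))" by (rule lin_on_subset[OF d(5)[OF d(7)[OF uM v]] Pd(2)])
    qed
    finally show ?thesis by simp
  qed
  \<comment> \<open>Each dual pair contributes \<open>\<beta>(b, e b) = 1\<close>, so the trace is
    \<open>dim P\<close>; it is non-zero since \<open>P\<close> is and the characteristic is
    0.\<close>
  have tr: "trace_on V \<Gamma> = of_nat (card B)"
  proof -
    have "trace_on V \<Gamma> = (\<Sum>b\<in>B. ?\<beta> b (e b))" unfolding \<Gamma>_def trace_form_def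
      by (rule trace_sum[OF d(3)]) (rule endo_comp[OF d(4)[OF bM] d(4)[OF eM]])
    also have "\<dots> = (\<Sum>b\<in>B. 1)"
      by (rule sum.cong[OF refl]) (simp add: trace_form_sym[OF r bM eM] e2)
    finally show ?thesis by simp
  qed
  have ker0: "{v \<in> V. \<Gamma> v = 0} = {0}"
  proof -
    have "subspace {v \<in> V. \<Gamma> v \<in> {0}}"
      by (rule lin_on_kernel_subspace[OF endoD(1)[OF \<Gamma>] sV subspace_single_0])
    then have "subspace {v \<in> V. \<Gamma> v = 0}" by simp
    moreover have "act x u \<in> {v \<in> V. \<Gamma> v = 0}" if "x \<in> M" "u \<in> {v \<in> V. \<Gamma> v = 0}" for x u
      using \<Gamma>_comm[OF that(1), of u] that(2) d(7)[OF that(1), of u] lin_on_0[OF endoD(1)[OF d(4)[OF that(1)]] sV] by simp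
    ultimately have "{v \<in> V. \<Gamma> v = 0} = {0} \<or> {v \<in> V. \<Gamma> v = 0} = V" by (intro irr) auto
    moreover have "{v \<in> V. \<Gamma> v = 0} \<noteq> V"
    proof
      assume "{v \<in> V. \<Gamma> v = 0} = V"
      then have "trace_on V \<Gamma> = trace_on V (\<lambda>v. 0)" by (intro trace_cong[OF d(3) \<Gamma>]) blast
      then show False using tr trace_zero[OF d(3)] B0 Bd(1) by simp
    qed
    ultimately show ?thesis by blast
  qed
  have inj: "x = 0" if "x \<in> V" "\<Gamma> x = 0" for x using ker0 that by blast
  have surj: "\<Gamma> ` V = V" by (rule endo_inj_imp_surj[OF \<Gamma> d(3) inj])
  define g where "g = (\<lambda>x. \<Sum>b\<in>B. act b (f (e b) x))"
  have gV: "g x \<in> V" if "x \<in> M" for x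
    unfolding g_def by (rule subspace_sum[OF sV]) (intro d(7) bM fd(1) eM that)
  have glin: "lin_on M g" unfolding g_def
    by (rule lin_on_sum_fun) (rule lin_on_comp[OF endoD(1)[OF d(4)[OF bM]] fd(2)[OF eM] fd(1)[OF eM]])
  \<comment> \<open>Moving \<open>x\<close> past \<open>b\<close> leaves the commutator
    \<open>[x, b]\<close>, which the Casimir identity trades for \<open>- [x, e b]\<close> in the
    first argument of \<open>f\<close>.\<close>
  have xg: "act x (g y) = (\<Sum>b\<in>B. act b (act x (f (e b) y) - f (c x (e b)) y))" if x: "x \<in> M" and y: "y \<in> M" for x y
  proof -
    have "act x (g y) = (\<Sum>b\<in>B. act x (act b (f (e b) y)))" unfolding g_def
      by (rule act_sum[OF x]) (intro d(7) bM eM fd(1) y)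
    also have "\<dots> = (\<Sum>b\<in>B. act (c x b) (f (e b) y)) + (\<Sum>b\<in>B. act b (act x (f (e b) y)))"
      unfolding sum.distrib[symmetric]
      by (rule sum.cong[OF refl]) (rule comm[OF x bM fd(1)[OF eM y]])
    also have "(\<Sum>b\<in>B. act (c x b) (f (e b) y)) = - (\<Sum>b\<in>B. act b (f (c x (e b)) y))"
    proof (rule cas[OF x])
      fix u assume u: "u \<in> P"
      have uM: "u \<in> M" using u Pd(2) by blast
      show "lin_on P (\<lambda>w. act u (f w y))"
        by (rule lin_on_subset[OF lin_on_comp[OF endoD(1)[OF d(4)[OF uM]] fd(3)[OF y] fd(1)[OF _ y]] Pd(2)])
      show "lin_on P (\<lambda>w. act w (f u y))" by (rule lin_on_subset[OF d(5)[OF fd(1)[OF uM y]] Pd(2)])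
    qed
    also have "- (\<Sum>b\<in>B. act b (f (c x (e b)) y)) + (\<Sum>b\<in>B. act b (act x (f (e b) y)))
      = (\<Sum>b\<in>B. act b (act x (f (e b) y)) - act b (f (c x (e b)) y))" by (simp add: sum_subtractf)
    also have "\<dots> = (\<Sum>b\<in>B. act b (act x (f (e b) y) - f (c x (e b)) y))"
    proof (rule sum.cong[OF refl])
      fix b assume b: "b \<in> B"
      show "act b (act x (f (e b) y)) - act b (f (c x (e b)) y) = act b (act x (f (e b) y) - f (c x (e b)) y)"
        by (rule act_diff[OF bM[OF b] d(7)[OF x fd(1)[OF eM[OF b] y]] fd(1)[OF lie_closed[OF M(1) x eM[OF b]] y], symmetric])
    qed
    finally show ?thesis .
  qed
  have dg: "\<Gamma> (f x y) = act x (g y) - act y (g x) - g (c x y)" if x: "x \<in> M" and y: "y \<in> M" for x y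
  proof -
    have xy: "c x y \<in> M" by (rule lie_closed[OF M(1) x y])
    have "act x (g y) - act y (g x) - g (c x y)
      = (\<Sum>b\<in>B. act b (act x (f (e b) y) - f (c x (e b)) y) - act b (act y (f (e b) x) - f (c y (e b)) x) - act b (f (e b) (c x y)))"
      unfolding xg[OF x y] xg[OF y x] sum_subtractf unfolding g_def ..
    also have "\<dots> = (\<Sum>b\<in>B. act b (act (e b) (f x y)))"
    proof (rule sum.cong[OF refl])
      fix b assume b: "b \<in> B"
      note eb = eM[OF b] and bb = bM[OF b]
      have xe: "c x (e b) \<in> M" "c y (e b) \<in> M" "c (e b) x \<in> M" using lie_closed[OF M(1)] x y eb by auto
      let ?p = "act x (f (e b) y) - f (c x (e b)) y" and ?q = "act y (f (e b) x) - f (c y (e b)) x" and ?s = "f (e b) (c x y)"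
      have V1: "?p \<in> V" "?q \<in> V" "?s \<in> V"
        using x y eb xe xy by (auto intro!: subspace_diff[OF sV] d(7) fd(1))
      have neg: "act u (f y (e b)) = - act u (f (e b) y)" if "u \<in> M" for u
        unfolding fd(4)[OF y eb] by (rule lin_on_neg[OF endoD(1)[OF d(4)[OF that]] sV fd(1)[OF eb y]])
      have ex: "f (c (e b) x) y = - f (c x (e b)) y"
        unfolding lie_anti[OF M(1) eb x] by (rule lin_on_neg[OF fd(3)[OF y] sM xe(1)])
      \<comment> \<open>The cocycle identity for \<open>e b\<close>, \<open>x\<close>,
        \<open>y\<close>, to be solved for its first term.\<close>
      have "act (e b) (f x y) + act x (f y (e b)) + act y (f (e b) x) = f (c (e b) x) y + f (c x y) (e b) + f (c y (e b)) x"
        by (rule fd(5)[OF eb x y])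
      then have "act (e b) (f x y) = ?p - ?q - ?s"
        unfolding neg[OF x] ex fd(4)[OF xy eb] by (simp add: algebra_simps)
      then have "act b (act (e b) (f x y)) = act b (?p - ?q - ?s)" by simp
      also have "\<dots> = act b ?p - act b ?q - act b ?s"
        using act_diff[OF bb subspace_diff[OF sV V1(1,2)] V1(3)] act_diff[OF bb V1(1,2)] by simp
      finally show "act b ?p - act b ?q - act b ?s = act b (act (e b) (f x y))" by simp
    qed
    finally show ?thesis by (simp add: \<Gamma>_def)
  qed
  \<comment> \<open>The solution is \<open>h = \<Gamma>^-1 g\<close>. Its linearity and the
    coboundary equation are checked after applying \<open>\<Gamma>\<close>, which is injective and
    commutes with the action.\<close>
  have "\<forall>x\<in>M. g x \<in> \<Gamma> ` V" using gV surj by simp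
  then have "\<forall>x\<in>M. \<exists>v. v \<in> V \<and> \<Gamma> v = g x" by force
  from bchoice[OF this] obtain h where hV: "\<And>x. x \<in> M \<Longrightarrow> h x \<in> V" and hg: "\<And>x. x \<in> M \<Longrightarrow> \<Gamma> (h x) = g x"
    by blast
  note \<Gamma>l = lin_onD[OF endoD(1)[OF \<Gamma>]]
  have ext: "u = v" if "u \<in> V" "v \<in> V" "\<Gamma> u = \<Gamma> v" for u v
    by (rule endo_injective[OF \<Gamma> sV _ that]) (erule (1) inj)
  have "lin_on M h" unfolding lin_on_def
  proof (intro conjI ballI allI)
    fix x y assume xy: "x \<in> M" "y \<in> M"
    note s = subspace_add[OF sM xy]
    show "h (x + y) = h x + h y"
    proof (rule ext[OF hV[OF s] subspace_add[OF sV hV[OF xy(1)] hV[OF xy(2)]]])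
      show "\<Gamma> (h (x + y)) = \<Gamma> (h x + h y)"
        unfolding hg[OF s] \<Gamma>l(1)[OF hV[OF xy(1)] hV[OF xy(2)]] hg[OF xy(1)] hg[OF xy(2)]
        by (rule lin_onD(1)[OF glin xy])
    qed
  next
    fix a x assume x: "x \<in> M"
    note s = subspace_scale[OF sM x]
    show "h (scale a x) = scale a (h x)"
    proof (rule ext[OF hV[OF s] subspace_scale[OF sV hV[OF x]]])
      show "\<Gamma> (h (scale a x)) = \<Gamma> (scale a (h x))"
        unfolding hg[OF s] \<Gamma>l(2)[OF hV[OF x]] hg[OF x] by (rule lin_onD(2)[OF glin x])
    qed
  qed
  moreover have "f x y = act x (h y) - act y (h x) - h (c x y)" if x: "x \<in> M" and y: "y \<in> M" for x y
  proof -
    have xy: "c x y \<in> M" by (rule lie_closed[OF M(1) x y])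
    have V1: "act x (h y) \<in> V" "act y (h x) \<in> V" "h (c x y) \<in> V" using x y xy by (auto intro: d(7) hV)
    have V2: "act x (h y) - act y (h x) \<in> V" by (rule subspace_diff[OF sV V1(1,2)])
    show ?thesis
    proof (rule ext[OF fd(1)[OF x y] subspace_diff[OF sV V2 V1(3)]])
      have "\<Gamma> (act x (h y) - act y (h x) - h (c x y)) = \<Gamma> (act x (h y)) - \<Gamma> (act y (h x)) - \<Gamma> (h (c x y))"
        using lin_on_diff[OF endoD(1)[OF \<Gamma>] sV V2 V1(3)] lin_on_diff[OF endoD(1)[OF \<Gamma>] sV V1(1,2)] by simp
      also have "\<dots> = act x (g y) - act y (g x) - g (c x y)"
        using \<Gamma>_comm[OF x hV[OF y]] \<Gamma>_comm[OF y hV[OF x]] hg x y xy by simp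
      finally show "\<Gamma> (f x y) = \<Gamma> (act x (h y) - act y (h x) - h (c x y))" using dg[OF x y] by simp
    qed
  qed
  ultimately show ?thesis unfolding lie_coboundary_def using hV by blast
qed

end

section \<open>Levi decomposition\<close>

context vec_space
begin

lemma linear_section:
  assumes f: "lin_on L f" and L: "fin_subspace L"
  obtains \<sigma> where "lin_on (f ` L) \<sigma>" "\<And>m. m \<in> f ` L \<Longrightarrow> \<sigma> m \<in> L" "\<And>m. m \<in> f ` L \<Longrightarrow> f (\<sigma> m) = m"
proof -
  note sL = fin_subspace_subspace[OF L]
  obtain C where C: "basis_of (f ` L) C" using basis_of_exists[OF fin_subspace_image[OF f L]] .
  note Cd = basis_ofD[OF C]
  have "\<forall>m\<in>C. \<exists>x. x \<in> L \<and> f x = m" using Cd(3) by force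
  from bchoice[OF this] obtain g where g: "\<And>m. m \<in> C \<Longrightarrow> g m \<in> L" "\<And>m. m \<in> C \<Longrightarrow> f (g m) = m" by blast
  define \<sigma> where "\<sigma> = (\<lambda>m. \<Sum>k\<in>C. scale (representation C m k) (g k))"
  have "lin_on (f ` L) \<sigma>" unfolding \<sigma>_def by (rule lin_on_functional_sum[OF functional_representation[OF C]])
  moreover have "\<sigma> m \<in> L" for m
    unfolding \<sigma>_def by (rule subspace_sum[OF sL]) (rule subspace_scale[OF sL g(1)])
  moreover have "f (\<sigma> m) = m" if m: "m \<in> f ` L" for m
  proof -
    have "f (\<sigma> m) = (\<Sum>k\<in>C. f (scale (representation C m k) (g k)))"
      unfolding \<sigma>_def by (rule lin_on_sum[OF f sL]) (rule subspace_scale[OF sL g(1)])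
    also have "\<dots> = (\<Sum>k\<in>C. scale (representation C m k) k)"
      by (rule sum.cong[OF refl]) (simp add: lin_onD(2)[OF f g(1)] g(2))
    also have "\<dots> = m" by (rule basis_rep_sum[OF C m])
    finally show ?thesis .
  qed
  ultimately show ?thesis using that by blast
qed

section \<open>Complements of the radical\<close>

definition levi_complement :: "'b set \<Rightarrow> ('b \<Rightarrow> 'b \<Rightarrow> 'b) \<Rightarrow> 'b set \<Rightarrow> 'b set \<Rightarrow> bool" where
  "levi_complement L br R S \<longleftrightarrow> subalgebra L br S \<and> S \<inter> R = {0} \<and> ssum S R = L"

lemma solvable_derived_proper:
  assumes L: "lie L br" and s: "solvable L br" and "bracket br L L = L"
  shows "L = {0}"
proof -
  obtain n where n: "derived L br n = {0}" using s by (auto simp: solvable_lie_def)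
  have "derived L br n = L" by (induction n) (simp_all add: assms(3))
  then show ?thesis using n by simp
qed

text \<open>\<open>J\<close> is an ideal of \<open>K\<close> only, but \<open>J + R\<close> is one
  of \<open>L = K + R\<close>: brackets with \<open>K\<close> preserve \<open>J\<close> modulo
  \<open>R\<close>, and those with \<open>R\<close> stay in \<open>R\<close>. Being solvable,
  \<open>J + R\<close> lies in \<open>R\<close>. This makes complements semisimple and identifies
  the radical of a supplement.\<close>

lemma solvable_ideal_supplement:
  assumes L: "lie L br" and R: "max_solvable L br R"
    and K: "subalgebra L br K" "ssum K R = L" and J: "solvable_ideal scale K br J"
  shows "J \<subseteq> R"
proof -
  have Ji: "ideal K br J" and Js: "solvable J br" using J by (auto simp: solvable_ideal_def)
  note Ri = max_solvableD(1)[OF R] and Rs = max_solvableD(2)[OF R]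
  note Jd = idealD[OF Ji] and Rd = idealD[OF Ri] and Kd = subalgebraD[OF K(1)]
  have JL: "subalgebra L br J" using Jd Kd(2) by (intro subalgebraI) auto
  have "ideal L br (ssum J R)"
  proof (rule idealI)
    show "subspace (ssum J R)" by (rule subspace_sums[OF Jd(1) Rd(1)])
    show "ssum J R \<subseteq> L" by (rule subalgebraD(2)[OF ssum_subalgebra[OF L JL Ri]])
    fix x u assume "x \<in> L" "u \<in> ssum J R"
    then obtain s r j q where xu: "x = s + r" "s \<in> K" "r \<in> R" "u = j + q" "j \<in> J" "q \<in> R"
      using K(2) by blast
    have m: "s \<in> L" "r \<in> L" "j \<in> L" "q \<in> L" using xu Kd(2) Rd(2) Jd(2) by auto
    have "br x u = br s j + (br s q + (br r j + br r q))"
      unfolding xu(1,4) using m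
      by (simp add: lie_algebra.br_add_left[OF L] lie_algebra.br_add_right[OF L] add.assoc
          subspace_add[OF lie_subspace[OF L]])
    moreover have "br s q + (br r j + br r q) \<in> R"
      using m xu by (intro subspace_add[OF Rd(1)] Rd(3) ideal_right[OF L Ri])
    moreover have "br s j \<in> J" by (rule Jd(3)[OF xu(2,5)])
    ultimately show "br x u \<in> ssum J R" by blast
  qed
  then have "ssum J R \<subseteq> R"
    using ssum_solvable[OF L JL Ri Js Rs] R by (simp add: max_solvable_def solvable_ideal_def)
  then show ?thesis using ssum_superset[OF Jd(1) Rd(1)] by auto
qed

lemma levi_complement_radfree:
  assumes L: "lie L br" and R: "max_solvable L br R" and S: "levi_complement L br R S"
  shows "radfree S br"
  unfolding radfree_def
proof (intro allI impI)
  fix J assume J: "solvable_ideal scale S br J"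
  have Jd: "subspace J" "J \<subseteq> S" using idealD(1,2)[of S br J] J by (auto simp: solvable_ideal_def)
  have "J \<subseteq> R" using solvable_ideal_supplement[OF L R _ _ J] S by (simp add: levi_complement_def)
  then show "J = {0}" using S Jd(2) subspace_0[OF Jd(1)] by (auto simp: levi_complement_def)
qed

end

context ac_space
begin

text \<open>A linear section \<open>\<sigma>\<close> of \<open>L \<rightarrow> L/R\<close> fails to be a homomorphism by a cocycle with values in
  \<open>R\<close>; if this is the coboundary of \<open>h\<close>, then \<open>\<sigma> - h\<close> is a homomorphism.\<close>

lemma levi_minimal:
  assumes L: "lie L br" and fL: "fin_subspace L" and R: "max_solvable L br R"
    and ab: "\<And>x y. x \<in> R \<Longrightarrow> y \<in> R \<Longrightarrow> br x y = 0"
    and irr: "\<And>I. ideal L br I \<Longrightarrow> I \<subseteq> R \<Longrightarrow> I = {0} \<or> I = R"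
  shows "\<exists>S. levi_complement L br R S"
proof -
  note Ri = max_solvableD(1)[OF R]
  note Rd = idealD[OF Ri]
  note sL = lie_subspace[OF L]
  obtain M c f where M: "lie M c" and epi: "lie_epi scale L br M c f" and ker: "{x \<in> L. f x = 0} = R"
    using lie_algebra.quotient_exists[OF L Ri] by blast
  note ed = lie_epiD[OF epi]
  have fM: "fin_subspace M" using fin_subspace_image[OF ed(1) fL] ed(2) by simp
  note sM = fin_subspace_subspace[OF fM]
  have fR: "f ` R = {0}" using ker subspace_0[OF Rd(1)] by force
  have "max_solvable M c (f ` R)" by (rule epi_max_solvable[OF L M epi R]) (simp add: ker)
  then have rf: "radfree M c" unfolding radfree_def max_solvable_def fR
    using subspace_0[OF idealD(1)] by (fastforce simp: solvable_ideal_def)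
  obtain \<sigma> where "lin_on (f ` L) \<sigma>" "\<And>m. m \<in> f ` L \<Longrightarrow> \<sigma> m \<in> L" "\<And>m. m \<in> f ` L \<Longrightarrow> f (\<sigma> m) = m"
    using linear_section[OF ed(1) fL] by blast
  then have \<sigma>: "lin_on M \<sigma>" and \<sigma>L: "\<And>m. m \<in> M \<Longrightarrow> \<sigma> m \<in> L" and f\<sigma>: "\<And>m. m \<in> M \<Longrightarrow> f (\<sigma> m) = m"
    unfolding ed(2) by blast+
  have cM: "c x y \<in> M" if "x \<in> M" "y \<in> M" for x y by (rule lie_closed[OF M that])
  have brL: "br x y \<in> L" if "x \<in> L" "y \<in> L" for x y by (rule lie_closed[OF L that])
  have inR: "x \<in> R \<longleftrightarrow> x \<in> L \<and> f x = 0" for x using ker by blast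
  have RL: "x \<in> L" if "x \<in> R" for x using that Rd(2) by blast
  \<comment> \<open>The action of \<open>L/R\<close> on \<open>R\<close>. Another section would
    change it by brackets inside \<open>R\<close>, which vanish.\<close>
  define act where "act = (\<lambda>x. br (\<sigma> x))"
  define w where "w = (\<lambda>x y. br (\<sigma> x) (\<sigma> y) - \<sigma> (c x y))"
  have wR: "w x y \<in> R" if xy: "x \<in> M" "y \<in> M" for x y
  proof -
    have m: "br (\<sigma> x) (\<sigma> y) \<in> L" "\<sigma> (c x y) \<in> L" using \<sigma>L brL cM xy by auto
    have "f (br (\<sigma> x) (\<sigma> y)) = c x y" using ed(3)[OF \<sigma>L[OF xy(1)] \<sigma>L[OF xy(2)]] f\<sigma> xy by simp
    then have "f (w x y) = 0" unfolding w_def lin_on_diff[OF ed(1) sL m] using f\<sigma>[OF cM[OF xy]] by simp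
    then show ?thesis using inR subspace_diff[OF sL m] by (simp add: w_def)
  qed
  have br\<sigma>: "br (\<sigma> x) (\<sigma> y) = \<sigma> (c x y) + w x y" for x y by (simp add: w_def)
  note bl = lin_onD[OF lie_lin_left[OF L]] and brr = lin_onD[OF lie_lin_right[OF L]]
  have rep: "lie_rep M c R act"
    unfolding lie_rep_def
  proof (intro conjI ballI M fM)
    show "fin_subspace R" by (rule fin_subspace_mono[OF fL Rd(1,2)])
    fix x assume x: "x \<in> M"
    show "endo R (act x)" unfolding endo_def act_def
      using lin_on_subset[OF lie_lin_right[OF L \<sigma>L[OF x]] Rd(2)] Rd(3)[OF \<sigma>L[OF x]] by blast
  next
    fix v assume v: "v \<in> R"
    show "lin_on M (\<lambda>x. act x v)" unfolding lin_on_def act_def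
      by (simp add: lin_onD[OF \<sigma>] bl[OF RL[OF v]] \<sigma>L)
  next
    fix x y v assume x: "x \<in> M" and y: "y \<in> M" and v: "v \<in> R"
    have "br (\<sigma> x) (br (\<sigma> y) v) - br (\<sigma> y) (br (\<sigma> x) v) = br (br (\<sigma> x) (\<sigma> y)) v"
      using lie_jacobi[OF L \<sigma>L[OF x] \<sigma>L[OF y] RL[OF v]] by simp
    also have "\<dots> = br (\<sigma> (c x y)) v + br (w x y) v"
      unfolding br\<sigma> by (rule bl(1)[OF RL[OF v] \<sigma>L[OF cM[OF x y]] RL[OF wR[OF x y]]])
    also have "br (w x y) v = 0" by (rule ab[OF wR[OF x y] v])
    finally show "act (c x y) v = act x (act y v) - act y (act x v)" by (simp add: act_def)
  qed
  have coc: "lie_cocycle M c R act w"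
    unfolding lie_cocycle_def
  proof (intro conjI ballI)
    fix x y assume x: "x \<in> M" and y: "y \<in> M"
    show "w x y \<in> R" by (rule wR[OF x y])
    have "w x y = - br (\<sigma> y) (\<sigma> x) - - \<sigma> (c y x)"
      unfolding w_def lie_anti[OF L \<sigma>L[OF x] \<sigma>L[OF y]] lie_anti[OF M x y] lin_on_neg[OF \<sigma> sM cM[OF y x]] ..
    then show "w x y = - w y x" by (simp add: w_def)
  next
    fix x assume x: "x \<in> M"
    show "lin_on M (w x)" unfolding lin_on_def w_def
      by (simp add: lin_onD[OF \<sigma>] lin_onD[OF lie_lin_right[OF M x]] brr[OF \<sigma>L[OF x]] \<sigma>L cM[OF x] scale_right_diff_distrib)
    show "lin_on M (\<lambda>y. w y x)" unfolding lin_on_def w_def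
      by (simp add: lin_onD[OF \<sigma>] lin_onD[OF lie_lin_left[OF M x]] bl[OF \<sigma>L[OF x]] \<sigma>L cM[OF _ x] scale_right_diff_distrib)
  next
    fix x y z assume x: "x \<in> M" and y: "y \<in> M" and z: "z \<in> M"
    \<comment> \<open>A Jacobi term of \<open>L\<close>, split into a part in \<open>R\<close> and
      the section of the matching Jacobi term of \<open>M\<close>. In the cyclic sum the section
      parts cancel, and the cocycle identity remains.\<close>
    have J: "br (\<sigma> x) (br (\<sigma> y) (\<sigma> z)) = act x (w y z) - w (c y z) x + \<sigma> (c x (c y z))"
      if x: "x \<in> M" and y: "y \<in> M" and z: "z \<in> M" for x y z
    proof -
      have yz: "c y z \<in> M" by (rule cM[OF y z])
      have "br (\<sigma> x) (br (\<sigma> y) (\<sigma> z)) = br (\<sigma> x) (\<sigma> (c y z)) + br (\<sigma> x) (w y z)"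
        unfolding br\<sigma>[of y z] by (rule brr(1)[OF \<sigma>L[OF x] \<sigma>L[OF yz] RL[OF wR[OF y z]]])
      also have "br (\<sigma> x) (\<sigma> (c y z)) = - br (\<sigma> (c y z)) (\<sigma> x)" by (rule lie_anti[OF L \<sigma>L[OF x] \<sigma>L[OF yz]])
      also have "br (\<sigma> (c y z)) (\<sigma> x) = - \<sigma> (c x (c y z)) + w (c y z) x"
        unfolding br\<sigma> lie_anti[OF M yz x] lin_on_neg[OF \<sigma> sM cM[OF x yz]] ..
      finally show ?thesis by (simp add: act_def)
    qed
    have s: "\<sigma> (c x (c y z)) + \<sigma> (c y (c z x)) + \<sigma> (c z (c x y)) = 0"
    proof -
      have m: "c x (c y z) \<in> M" "c y (c z x) \<in> M" "c z (c x y) \<in> M" using cM x y z by auto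
      have "\<sigma> (c x (c y z)) + \<sigma> (c y (c z x)) + \<sigma> (c z (c x y)) = \<sigma> (c x (c y z) + c y (c z x) + c z (c x y))"
        using lin_onD(1)[OF \<sigma> m(1,2)] lin_onD(1)[OF \<sigma> subspace_add[OF sM m(1,2)] m(3)] by simp
      then show ?thesis using lie_algebra.jacobi[OF M x y z] lin_on_0[OF \<sigma> sM] by simp
    qed
    have "(act x (w y z) - w (c y z) x + \<sigma> (c x (c y z))) + (act y (w z x) - w (c z x) y + \<sigma> (c y (c z x)))
      + (act z (w x y) - w (c x y) z + \<sigma> (c z (c x y))) = 0"
      using lie_algebra.jacobi[OF L \<sigma>L[OF x] \<sigma>L[OF y] \<sigma>L[OF z]] unfolding J[OF x y z] J[OF y z x] J[OF z x y] .
    then have "(act x (w y z) + act y (w z x) + act z (w x y)) - (w (c x y) z + w (c y z) x + w (c z x) y)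
      + (\<sigma> (c x (c y z)) + \<sigma> (c y (c z x)) + \<sigma> (c z (c x y))) = 0"
      by (simp add: algebra_simps)
    then show "act x (w y z) + act y (w z x) + act z (w x y) = w (c x y) z + w (c y z) x + w (c z x) y"
      unfolding s by simp
  qed
  have "lie_coboundary M c R act w"
  proof (cases "\<exists>x\<in>M. \<exists>v\<in>R. act x v \<noteq> 0")
    case False
    then show ?thesis by (intro whitehead_trivial[OF rep rf coc]) blast
  next
    case True
    then obtain x0 v0 where nt: "x0 \<in> M" "v0 \<in> R" "act x0 v0 \<noteq> 0" by blast
    show ?thesis
    proof (rule whitehead_nontrivial[OF rep rf coc nt])
      fix U assume U: "subspace U" "U \<subseteq> R" and st: "\<And>x u. x \<in> M \<Longrightarrow> u \<in> U \<Longrightarrow> act x u \<in> U"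
      show "U = {0} \<or> U = R"
      proof (rule irr[OF idealI[OF U(1)] U(2)])
        show "U \<subseteq> L" using U(2) Rd(2) by blast
        fix x u assume x: "x \<in> L" and u: "u \<in> U"
        have fx: "f x \<in> M" by (rule ed(4)[OF x])
        have uR: "u \<in> R" using u U(2) by blast
        \<comment> \<open>Since \<open>x\<close> and \<open>\<sigma> (f x)\<close> differ by an
          element of the abelian \<open>R\<close>, they act alike on \<open>R\<close>, so submodules
          are ideals of \<open>L\<close>.\<close>
        have "f (x - \<sigma> (f x)) = 0" using lin_on_diff[OF ed(1) sL x \<sigma>L[OF fx]] f\<sigma>[OF fx] by simp
        then have r: "x - \<sigma> (f x) \<in> R" using inR subspace_diff[OF sL x \<sigma>L[OF fx]] by blast
        have "br x u - br (\<sigma> (f x)) u = br (x - \<sigma> (f x)) u"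
          using lin_on_diff[OF lie_lin_left[OF L RL[OF uR]] sL x \<sigma>L[OF fx]] by simp
        also have "\<dots> = 0" by (rule ab[OF r uR])
        finally have "br x u = act (f x) u" by (simp add: act_def)
        then show "br x u \<in> U" using st[OF fx u] by simp
      qed
    qed
  qed
  then obtain h where h: "lin_on M h" and hR: "\<And>x. x \<in> M \<Longrightarrow> h x \<in> R"
    and wh: "\<And>x y. x \<in> M \<Longrightarrow> y \<in> M \<Longrightarrow> w x y = act x (h y) - act y (h x) - h (c x y)"
    unfolding lie_coboundary_def by blast
  define \<tau> where "\<tau> = (\<lambda>x. \<sigma> x - h x)"
  have \<tau>L: "\<tau> x \<in> L" if "x \<in> M" for x unfolding \<tau>_def by (rule subspace_diff[OF sL \<sigma>L[OF that] RL[OF hR[OF that]]])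
  have f\<tau>: "f (\<tau> x) = x" if x: "x \<in> M" for x
    unfolding \<tau>_def using lin_on_diff[OF ed(1) sL \<sigma>L[OF x] RL[OF hR[OF x]]] f\<sigma>[OF x] hR[OF x] inR by simp
  have \<tau>: "lin_on M \<tau>" unfolding lin_on_def \<tau>_def
    by (simp add: lin_onD[OF \<sigma>] lin_onD[OF h] scale_right_diff_distrib)
  have \<tau>br: "br (\<tau> x) (\<tau> y) = \<tau> (c x y)" if x: "x \<in> M" and y: "y \<in> M" for x y
  proof -
    note m = \<sigma>L[OF x] \<sigma>L[OF y] RL[OF hR[OF x]] RL[OF hR[OF y]] \<tau>L[OF y]
    have "br (\<tau> x) (\<tau> y) = br (\<sigma> x) (\<tau> y) - br (h x) (\<tau> y)"
      using lin_on_diff[OF lie_lin_left[OF L m(5)] sL m(1,3)] by (simp add: \<tau>_def)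
    also have "br (\<sigma> x) (\<tau> y) = br (\<sigma> x) (\<sigma> y) - br (\<sigma> x) (h y)"
      unfolding \<tau>_def by (rule lin_on_diff[OF lie_lin_right[OF L m(1)] sL m(2,4)])
    also have "br (h x) (\<tau> y) = br (h x) (\<sigma> y) - br (h x) (h y)"
      unfolding \<tau>_def by (rule lin_on_diff[OF lie_lin_right[OF L m(3)] sL m(2,4)])
    also have "br (h x) (h y) = 0" by (rule ab[OF hR[OF x] hR[OF y]])
    also have "br (h x) (\<sigma> y) = - act y (h x)" unfolding act_def by (rule lie_anti[OF L m(3,2)])
    also have "br (\<sigma> x) (h y) = act x (h y)" by (simp add: act_def)
    finally show ?thesis unfolding br\<sigma> wh[OF x y] \<tau>_def by simp
  qed
  have "levi_complement L br R (\<tau> ` M)"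
    unfolding levi_complement_def
  proof (intro conjI)
    show "subalgebra L br (\<tau> ` M)"
    proof (rule subalgebraI[OF lin_on_image_subspace[OF \<tau> sM]])
      show "\<tau> ` M \<subseteq> L" using \<tau>L by blast
      fix u v assume "u \<in> \<tau> ` M" "v \<in> \<tau> ` M"
      then obtain x y where "x \<in> M" "y \<in> M" "u = \<tau> x" "v = \<tau> y" by blast
      then show "br u v \<in> \<tau> ` M" using \<tau>br cM by auto
    qed
    show "\<tau> ` M \<inter> R = {0}"
    proof
      show "\<tau> ` M \<inter> R \<subseteq> {0}"
      proof
        fix u assume "u \<in> \<tau> ` M \<inter> R"
        then obtain x where x: "x \<in> M" "u = \<tau> x" "u \<in> R" by blast
        then have "x = 0" using f\<tau>[OF x(1)] inR by simp
        then show "u \<in> {0}" using x(2) lin_on_0[OF \<tau> sM] by simp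
      qed
      have "\<tau> 0 = 0" by (rule lin_on_0[OF \<tau> sM])
      then show "{0} \<subseteq> \<tau> ` M \<inter> R" using subspace_0[OF sM] subspace_0[OF Rd(1)] by force
    qed
    show "ssum (\<tau> ` M) R = L"
    proof
      show "ssum (\<tau> ` M) R \<subseteq> L" by (rule ssum_subset[OF sL]) (use \<tau>L Rd(2) in auto)
      show "L \<subseteq> ssum (\<tau> ` M) R"
      proof
        fix x assume x: "x \<in> L"
        have fx: "f x \<in> M" by (rule ed(4)[OF x])
        have "f (x - \<tau> (f x)) = 0" using lin_on_diff[OF ed(1) sL x \<tau>L[OF fx]] f\<tau>[OF fx] by simp
        then have "x - \<tau> (f x) \<in> R" using inR subspace_diff[OF sL x \<tau>L[OF fx]] by blast
        moreover have "x = \<tau> (f x) + (x - \<tau> (f x))" by simp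
        ultimately show "x \<in> ssum (\<tau> ` M) R" using fx by blast
      qed
    qed
  qed
  then show ?thesis by blast
qed

text \<open>Suppose an ideal \<open>I\<close> lies strictly between 0 and \<open>R\<close>. As
  \<open>I \<noteq> {0}\<close>, induction gives a complement of \<open>R/I\<close> in
  \<open>L/I\<close>; let \<open>K\<close> be its preimage. Then \<open>K + R = L\<close> and
  \<open>K \<inter> R = I\<close>, so \<open>K \<noteq> L\<close> because
  \<open>I \<noteq> R\<close>, and \<open>I\<close> is the radical of \<open>K\<close>. By induction
  \<open>I\<close> has a complement in \<open>K\<close>, and it also complements \<open>R\<close> in
  \<open>L\<close>. The bracket is generalized in the induction because the quotient has its
  own.\<close>

theorem levi:
  assumes "lie L br" "fin_subspace L" "max_solvable L br R"
  shows "\<exists>S. levi_complement L br R S"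
  using assms
proof (induction "dim L" arbitrary: L br R rule: less_induct)
  case less
  note L = less.prems(1) and fL = less.prems(2) and R = less.prems(3)
  note sL = lie_subspace[OF L]
  note Ri = max_solvableD(1)[OF R] and Rs = max_solvableD(2)[OF R]
  note Rd = idealD[OF Ri]
  consider "\<exists>I. ideal L br I \<and> I \<subseteq> R \<and> I \<noteq> {0} \<and> I \<noteq> R"
    | "\<And>I. ideal L br I \<Longrightarrow> I \<subseteq> R \<Longrightarrow> I = {0} \<or> I = R" by blast
  then show ?case
  proof cases
    case 2
    \<comment> \<open>The ideal \<open>[R, R]\<close> of \<open>L\<close> is 0 or \<open>R\<close>
      by minimality, and \<open>[R, R] = R\<close> forces \<open>R = {0}\<close> by
      solvability.\<close>
    have "bracket br R R \<subseteq> R" by (rule bracket_space_least[OF Rd(1)]) (use Rd in blast)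
    then have "bracket br R R = {0} \<or> bracket br R R = R"
      by (rule 2[OF bracket_ideal[OF L Ri]])
    then have "bracket br R R \<subseteq> {0}"
      using solvable_derived_proper[OF ideal_lie[OF L Ri] Rs] by auto
    then have "br x y = 0" if "x \<in> R" "y \<in> R" for x y using bracket_space_in[OF that, of br] by blast
    then show ?thesis by (intro levi_minimal[OF L fL R]) (use 2 in blast)+
  next
    case 1
    then obtain I where I: "ideal L br I" "I \<subseteq> R" "I \<noteq> {0}" "I \<noteq> R" by blast
    note Id = idealD[OF I(1)]
    obtain M c f where M: "lie M c" and epi: "lie_epi scale L br M c f" and ker: "{x \<in> L. f x = 0} = I"
      using lie_algebra.quotient_exists[OF L I(1)] by blast
    note ed = lie_epiD[OF epi]
    have fM: "fin_subspace M" using fin_subspace_image[OF ed(1) fL] ed(2) by simp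
    have RM: "max_solvable M c (f ` R)" by (rule epi_max_solvable[OF L M epi R]) (simp add: ker I(2))
    obtain x0 where x0: "x0 \<in> I" "x0 \<noteq> 0" using I(3) subspace_0[OF Id(1)] by blast
    have "dim M < dim L" using dim_image_less[OF ed(1) fL, of x0] x0 ker ed(2) by blast
    then obtain S' where S': "levi_complement M c (f ` R) S'" using less.hyps[OF _ M fM RM] by blast
    then have S'd: "subalgebra M c S'" "S' \<inter> f ` R = {0}" "ssum S' (f ` R) = M"
      by (auto simp: levi_complement_def)
    define K where "K = {x \<in> L. f x \<in> S'}"
    have Ks: "subalgebra L br K" unfolding K_def by (rule epi_preimage_subalgebra[OF L epi S'd(1)])
    note Kd = subalgebraD[OF Ks]
    have lK: "lie K br" by (rule subalgebra_lie[OF L Ks])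
    have fK: "fin_subspace K" by (rule fin_subspace_mono[OF fL Kd(1,2)])
    have IK: "I \<subseteq> K" using ker subspace_0[OF subalgebraD(1)[OF S'd(1)]] by (auto simp: K_def)
    have KR: "K \<inter> R \<subseteq> I"
    proof
      fix x assume x: "x \<in> K \<inter> R"
      then have "f x \<in> S' \<inter> f ` R" by (auto simp: K_def)
      then have "f x = 0" using S'd(2) by blast
      then show "x \<in> I" using ker x Rd(2) by blast
    qed
    have KRL: "ssum K R = L"
    proof
      show "ssum K R \<subseteq> L" by (rule ssum_subset[OF sL Kd(2) Rd(2)])
      show "L \<subseteq> ssum K R"
      proof
        fix x assume x: "x \<in> L"
        then have "f x \<in> ssum S' (f ` R)" using S'd(3) ed(4) by simp
        then obtain s r where sr: "s \<in> S'" "r \<in> R" "f x = s + f r" by blast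
        have rL: "r \<in> L" using sr(2) Rd(2) by blast
        have "f (x - r) = s" using lin_on_diff[OF ed(1) sL x rL] sr(3) by simp
        then have "x - r \<in> K" using subspace_diff[OF sL x rL] sr(1) by (simp add: K_def)
        moreover have "x = (x - r) + r" by simp
        ultimately show "x \<in> ssum K R" using sr(2) by blast
      qed
    qed
    have "K \<noteq> L" using KR I(2,4) Rd(2) by blast
    then have dK: "dim K < dim L" using dim_less[OF fL Kd(1)] Kd(2) by blast
    have IKi: "ideal K br I" using Id IK Kd(2) by (intro idealI) auto
    have "solvable I br" by (rule solvable_sub[OF ideal_lie[OF L I(1)] I(2) Rs])
    moreover have "J \<subseteq> I" if J: "solvable_ideal scale K br J" for J
      using solvable_ideal_supplement[OF L R Ks KRL J] KR idealD(2)[of K br J] J by (auto simp: solvable_ideal_def)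
    ultimately have "max_solvable K br I" using IKi by (simp add: max_solvable_def solvable_ideal_def)
    then obtain S where S: "levi_complement K br I S" using less.hyps[OF dK lK fK] by blast
    then have Sd: "subalgebra K br S" "S \<inter> I = {0}" "ssum S I = K"
      by (auto simp: levi_complement_def)
    note Sd' = subalgebraD[OF Sd(1)]
    have "levi_complement L br R S" unfolding levi_complement_def
    proof (intro conjI)
      show "subalgebra L br S" using Sd' Kd(2) by (intro subalgebraI) auto
      show "S \<inter> R = {0}" using Sd(2) Sd'(2) KR I(2) by blast
      show "ssum S R = L"
      proof
        show "ssum S R \<subseteq> L" by (rule ssum_subset[OF sL _ Rd(2)]) (use Sd'(2) Kd(2) in blast)
        show "L \<subseteq> ssum S R"
        proof
          fix x assume "x \<in> L"
          then obtain k r where k: "k \<in> K" "r \<in> R" "x = k + r" using KRL by blast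
          obtain s i where s: "s \<in> S" "i \<in> I" "k = s + i" using k(1) Sd(3) by blast
          have "x = s + (i + r)" using k(3) s(3) by (simp add: add.assoc)
          moreover have "i + r \<in> R" using s(2) I(2) k(2) subspace_add[OF Rd(1)] by blast
          ultimately show "x \<in> ssum S R" using s(1) by blast
        qed
      qed
    qed
    then show ?thesis by blast
  qed
qed

end

section \<open>The Baer radical\<close>

text \<open>Well-order all elements but \<open>a\<close> and put \<open>a\<close> on top: the index
  set must have a maximal element, and with the whole type as its field it is as large as the type
  permits.\<close>

lemma well_order_with_greatest:
  fixes a b :: 'i
  assumes "a \<noteq> b"
  obtains r :: "'i rel" where "Well_order r" "Field r = UNIV" "\<And>x. (x, a) \<in> r"
proof -
  obtain s where s: "well_order_on (- {a}) s" using well_order_on by blast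
  then have s_in: "s \<subseteq> (- {a}) \<times> (- {a})" and s_refl: "\<And>x. x \<noteq> a \<Longrightarrow> (x, x) \<in> s"
    and s_trans: "trans s" and s_anti: "antisym s" and s_tot: "\<And>x y. x \<noteq> a \<Longrightarrow> y \<noteq> a \<Longrightarrow> x \<noteq> y \<Longrightarrow> (x, y) \<in> s \<or> (y, x) \<in> s"
    and s_wf: "wf (s - Id)"
    unfolding well_order_on_def linear_order_on_def partial_order_on_def preorder_on_def refl_on_def total_on_def
    by blast+
  define r where "r = s \<union> UNIV \<times> {a}"
  have F: "Field r = UNIV" by (auto simp: r_def Field_def)
  \<comment> \<open>An added pair leads down from \<open>a\<close> and nothing in \<open>s\<close>
    leads back to it, so it can start a descending chain but not continue one.\<close>
  have "wf ((UNIV - {a}) \<times> {a})" by (rule wf_subset[OF wf_measure[of "\<lambda>x. if x = a then 1 else 0"]]) (auto split: if_splits)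
  then have "wf ((s - Id) \<union> (UNIV - {a}) \<times> {a})"
    by (rule wf_Un[OF s_wf]) (use s_in in auto)
  then have "wf (r - Id)" by (rule wf_subset) (auto simp: r_def)
  moreover have "refl r" using s_refl by (auto simp: refl_on_def r_def)
  moreover have "trans r" using s_trans s_in unfolding trans_def r_def by blast
  moreover have "antisym r" using s_anti s_in unfolding antisym_def r_def by blast
  moreover have "total r" using s_tot unfolding total_on_def r_def by blast
  ultimately have "Well_order r"
    unfolding well_order_on_def linear_order_on_def partial_order_on_def preorder_on_def F by simp
  then show ?thesis using that[of r] F by (simp add: r_def)
qed

section \<open>Baer classes of finite dimensional algebras\<close>

context vec_space
begin

lemma nilpotent_solvable:
  assumes N: "nilpotent_lie scale L br"
  shows "solvable L br"
proof -
  have L: "lie L br" using N by (simp add: nilpotent_lie_def)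
  have *: "derived L br n \<subseteq> lower_central scale L br n" for n
  proof (induction n)
    case (Suc n)
    then show ?case using bracket_space_mono[OF derived_subset[OF L] Suc] by simp
  qed simp
  obtain n where "lower_central scale L br n = {0}" using N by (auto simp: nilpotent_lie_def)
  then show ?thesis using solvableI[OF L, of n] *[of n] by simp
qed

lemma solvable_image:
  assumes "lie_image scale L br M c" "solvable L br"
  shows "solvable M c"
proof -
  obtain f where L: "lie L br" and M: "lie M c" and e: "lie_epi scale L br M c f"
    using assms(1) by (auto simp: lie_image_def)
  have "solvable_ideal scale L br L" using ideal_self[OF L] assms(2) by (simp add: solvable_ideal_def)
  then show ?thesis using epi_image_solvable[OF L M e] lie_epiD(2)[OF e] by (auto simp: solvable_ideal_def)
qed

lemma lie_image_self:
  assumes "lie L br"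
  shows "lie_image scale L br L br"
  using assms unfolding lie_image_def lie_epi_def by (intro conjI exI[of _ id]) auto

lemma solvable_abelian_ideal:
  assumes L: "lie L br" and s: "solvable L br" and "L \<noteq> {0}"
  obtains J where "ideal L br J" "J \<noteq> {0}" "nilpotent_lie scale J br"
proof -
  let ?D = "derived L br"
  obtain k where k: "?D k = {0}" using s by (auto simp: solvable_lie_def)
  define n where "n = (LEAST n. ?D n = {0})"
  have n: "?D n = {0}" unfolding n_def using k by (rule LeastI)
  have "n \<noteq> 0" using n assms(3) by (cases n) auto
  then obtain m where m: "n = Suc m" by (cases n) auto
  have "?D m \<noteq> {0}" using not_less_Least[of m "\<lambda>n. ?D n = {0}"] m n_def by simp
  moreover have i: "ideal L br (?D m)" by (rule derived_ideal[OF L])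
  moreover have "lower_central scale (?D m) br 1 = {0}" using n m by simp
  then have "nilpotent_lie scale (?D m) br" unfolding nilpotent_lie_def using ideal_lie[OF L i] by blast
  ultimately show ?thesis using that by blast
qed

lemma baer_class_solvable:
  fixes r :: "'i rel"
  assumes r: "Well_order r" and J: "(J, br) \<in> baer_class scale r \<alpha>" and "fin_subspace J"
  shows "solvable J br"
proof -
  interpret wo_rel r by (rule wo_rel.intro[OF r])
  \<comment> \<open>Both the algebra and its bracket are generalized, since the hypothesis will be
    used for an ideal of a quotient.\<close>
  have "\<forall>J br. (J, br) \<in> baer_class scale r \<alpha> \<longrightarrow> fin_subspace J \<longrightarrow> solvable J br"
  proof (induction \<alpha> rule: well_order_induct)
    case (1 \<alpha>)
    have IH: "solvable J br"
      if "\<beta> \<in> underS \<alpha>" "(J, br) \<in> baer_class scale r \<beta>" "fin_subspace J" for \<beta> J br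
      using 1 that unfolding underS_def by blast
    show ?case
    proof (intro allI impI)
      fix J br assume J: "(J, br) \<in> baer_class scale r \<alpha>" and fJ: "fin_subspace J"
      consider "underS \<alpha> = {}" | p where "is_pred r p \<alpha>" | "underS \<alpha> \<noteq> {}" "\<nexists>p. is_pred r p \<alpha>" by blast
      then show "solvable J br"
      proof cases
        case 1
        then obtain N c where "nilpotent_lie scale N c" "lie_image scale N c J br"
          using baer_class_least[OF r] J by blast
        then show ?thesis using solvable_image nilpotent_solvable by blast
      next
        case 2
        have lJ: "lie J br"
          and succ: "\<And>M c. lie_image scale J br M c \<Longrightarrow> M \<noteq> {0} \<Longrightarrow>
            \<exists>I. ideal M c I \<and> I \<noteq> {0} \<and> (I, c) \<in> baer_class scale r p"
          using J unfolding baer_class_succ[OF r 2] by blast+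
        obtain R where R: "max_solvable J br R" using max_solvable_exists[OF lJ fJ] .
        note Ri = max_solvableD(1)[OF R]
        obtain M c f where M: "lie M c" and e: "lie_epi scale J br M c f" and ker: "{x \<in> J. f x = 0} = R"
          using lie_algebra.quotient_exists[OF lJ Ri] by blast
        have fM: "fin_subspace M" using fin_subspace_image[OF lie_epiD(1)[OF e] fJ] lie_epiD(2)[OF e] by simp
        have im: "lie_image scale J br M c" using lJ M e by (auto simp: lie_image_def)
        have "f ` R \<subseteq> {0}" using ker by blast
        then have maxM: "I \<subseteq> {0}" if "solvable_ideal scale M c I" for I
          using epi_max_solvable[OF lJ M e R] ker that unfolding max_solvable_def by blast
        have "M = {0}"
        proof (rule ccontr)
          assume "M \<noteq> {0}"
          then obtain I where I: "ideal M c I" "I \<noteq> {0}" "(I, c) \<in> baer_class scale r p"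
            using succ[OF im] by blast
          have "fin_subspace I" by (rule fin_subspace_mono[OF fM idealD(1,2)[OF I(1)]])
          then have "solvable I c" using IH[of p I c] I(3) 2 by (simp add: is_pred_def)
          then have "I \<subseteq> {0}" using maxM I(1) by (simp add: solvable_ideal_def)
          then show False using I(2) subspace_0[OF idealD(1)[OF I(1)]] by blast
        qed
        then have "R = J" using ker lie_epiD(4)[OF e] by blast
        then show ?thesis using max_solvableD(2)[OF R] by simp
      next
        case 3
        then show ?thesis using J IH[OF _ _ fJ] unfolding baer_class_lim[OF r 3] by blast
      qed
    qed
  qed
  then show ?thesis using assms(2,3) by blast
qed

text \<open>Two distinct indices ensure that the least index \<open>z\<close> has a successor
  \<open>u\<close>, and the class at \<open>u\<close> already contains \<open>L\<close>: solvability
  passes to images, and a non-zero solvable image has a non-zero abelian ideal.\<close>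

lemma solvable_baer_class:
  assumes r: "Well_order r" and F: "a \<in> Field r" "b \<in> Field r" "a \<noteq> b" and s: "solvable L br"
  obtains \<alpha> where "\<alpha> \<in> Field r" "(L, br) \<in> baer_class scale r \<alpha>"
proof -
  interpret wo_rel r by (rule wo_rel.intro[OF r])
  define z where "z = minim (Field r)"
  have z: "z \<in> Field r" "\<And>x. x \<in> Field r \<Longrightarrow> (z, x) \<in> r"
    unfolding z_def using minim_in[of "Field r"] minim_least[of "Field r"] F by auto
  define u where "u = minim (Field r - {z})"
  have ne: "Field r - {z} \<noteq> {}" using F by auto
  have u: "u \<in> Field r - {z}" "\<And>x. x \<in> Field r - {z} \<Longrightarrow> (u, x) \<in> r"
    unfolding u_def using minim_in[OF _ ne] minim_least[of "Field r - {z}"] by auto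
  have anti: "x = y" if "(x, y) \<in> r" "(y, x) \<in> r" for x y using ANTISYM that by (auto simp: antisym_def)
  have z0: "underS z = {}"
  proof (rule ccontr)
    assume "underS z \<noteq> {}"
    then obtain x where x: "x \<noteq> z" "(x, z) \<in> r" by (auto simp: underS_def)
    then have "x \<in> Field r" by (auto simp: Field_def)
    then show False using anti[OF x(2) z(2)] x(1) by blast
  qed
  have "(z, u) \<in> r" "z \<noteq> u" using z(2) u(1) by auto
  moreover have "x = z" if x: "x \<noteq> u" "(x, u) \<in> r" for x
  proof (rule ccontr)
    assume "x \<noteq> z"
    then have "x \<in> Field r - {z}" using x(2) by (auto simp: Field_def)
    then show False using anti[OF x(2) u(2)] x(1) by blast
  qed
  ultimately have pred: "is_pred r z u"
    unfolding is_pred_def underS_def using z(2)[OF z(1)] by blast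
  have L: "lie L br" using s by (rule solvable_lie_lie)
  have "(L, br) \<in> baer_class scale r u"
    unfolding baer_class_succ[OF r pred]
  proof (intro conjI L allI impI)
    fix M c assume "lie_image scale L br M c \<and> M \<noteq> {0}"
    then have im: "lie_image scale L br M c" and M0: "M \<noteq> {0}" by auto
    have M: "lie M c" using im by (simp add: lie_image_def)
    obtain J where J: "ideal M c J" "J \<noteq> {0}" "nilpotent_lie scale J c"
      by (rule solvable_abelian_ideal[OF M solvable_image[OF im s] M0])
    then have "(J, c) \<in> baer_class scale r z"
      unfolding baer_class_least[OF r z0] using lie_image_self[OF ideal_lie[OF M J(1)]] by blast
    then show "\<exists>J. ideal M c J \<and> J \<noteq> {0} \<and> (J, c) \<in> baer_class scale r z" using J by blast
  qed
  then show ?thesis using that u(1) by blast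
qed

lemma rb_algebra_iff_solvable:
  assumes J: "lie J br" "fin_subspace J" and index: "Pow J \<prec> (UNIV :: 'i set)"
  shows "rb_algebra TYPE('i) scale J br \<longleftrightarrow> solvable J br"
proof
  assume "rb_algebra TYPE('i) scale J br"
  then obtain r :: "'i rel" and \<alpha> where r: "Well_order r" "(J, br) \<in> baer_class scale r \<alpha>"
    unfolding rb_algebra_def by blast
  show "solvable J br" by (rule baer_class_solvable[OF r J(2)])
next
  assume s: "solvable J br"
  \<comment> \<open>\<open>Pow J\<close> contains at least the empty set, so a strictly larger type
    has two elements.\<close>
  have "\<exists>a b :: 'i. a \<noteq> b"
  proof (rule ccontr)
    assume "\<not> ?thesis"
    then have "inj_on (\<lambda>_. {}) (UNIV :: 'i set)" by (auto simp: inj_on_def)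
    then have "(UNIV :: 'i set) \<lesssim> Pow J" unfolding lepoll_def by blast
    then show False using index lepoll_antisym by (auto simp: lesspoll_def)
  qed
  then obtain a b :: 'i where ab: "a \<noteq> b" by blast
  \<comment> \<open>Ordering the whole type turns the required cardinal bound into the hypothesis
    \<open>index\<close>.\<close>
  obtain r :: "'i rel" where r: "Well_order r" "Field r = UNIV" "\<And>x. (x, a) \<in> r"
    using well_order_with_greatest[OF ab] by metis
  obtain \<alpha> where "(J, br) \<in> baer_class scale r \<alpha>"
    using solvable_baer_class[OF r(1) _ _ ab s] r(2) by auto
  then show "rb_algebra TYPE('i) scale J br"
    unfolding rb_algebra_def using r index by (intro exI[of _ r]) auto
qed

lemma baer_radical_eq:
  assumes L: "lie L br" "fin_subspace L" and index: "Pow L \<prec> (UNIV :: 'i set)" and R: "max_solvable L br R"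
  shows "baer_radical TYPE('i) scale L br = R"
proof -
  have iff: "rb_ideal TYPE('i) scale L br J \<longleftrightarrow> solvable_ideal scale L br J" for J
  proof (cases "ideal L br J")
    case True
    note Jd = idealD[OF True]
    \<comment> \<open>The cardinal bound is demanded for each ideal with its own power set; the
      bound for \<open>L\<close> dominates them all.\<close>
    have "Pow J \<lesssim> Pow L" by (rule subset_imp_lepoll) (use Jd(2) in auto)
    then have "Pow J \<prec> (UNIV :: 'i set)" using index by (rule lesspoll_trans1)
    then have "rb_algebra TYPE('i) scale J br \<longleftrightarrow> solvable J br"
      by (rule rb_algebra_iff_solvable[OF ideal_lie[OF L(1) True] fin_subspace_mono[OF L(2) Jd(1,2)]])
    then show ?thesis by (simp add: rb_ideal_def solvable_ideal_def)
  qed (simp add: rb_ideal_def solvable_ideal_def)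
  show ?thesis unfolding baer_radical_def iff
    by (rule Greatest_equality) (use R in \<open>auto simp: max_solvable_def\<close>)
qed

lemma radfree_semisimple:
  assumes L: "lie L br" and rf: "radfree L br"
  shows "semisimple_lie scale L br"
proof -
  have "\<Union>{J. solvable_ideal scale L br J} \<subseteq> {0}" using rf by (auto simp: radfree_def)
  then have "span (\<Union>{J. solvable_ideal scale L br J}) \<subseteq> {0}" using span_minimal subspace_single_0 by blast
  then have "span (\<Union>{J. solvable_ideal scale L br J}) = {0}" using span_zero by blast
  then show ?thesis using L by (simp add: semisimple_lie_def solvable_radical_def)
qed

end

theorem proposition4p3:
  fixes scale :: "'k::{alg_closed_field, field_char_0} \<Rightarrow> 'a::ab_group_add \<Rightarrow> 'a"
    and L :: "'a set" and br :: "'a \<Rightarrow> 'a \<Rightarrow> 'a"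
  assumes lie: "lie_algebra scale L br"
    and fin_dim: "\<exists>B. finite B \<and> module.span scale B = L"
    and index: "Pow L \<prec> (UNIV :: 'i set)"
  shows "solvable_ideal scale L br (baer_radical TYPE('i) scale L br) \<and>
    (\<forall>J. solvable_ideal scale L br J \<longrightarrow> J \<subseteq> baer_radical TYPE('i) scale L br) \<and>
    (\<exists>S. lie_subalgebra scale L br S \<and> semisimple_lie scale S br \<and>
       S \<inter> baer_radical TYPE('i) scale L br = {0} \<and>
       {x + y | x y. x \<in> S \<and> y \<in> baer_radical TYPE('i) scale L br} = L)"
proof -
  interpret ac_space scale
    by (intro ac_space.intro vec_space.intro lie_algebra.axioms(1)[OF lie])
  have fL: "fin_subspace L" unfolding fin_subspace_def using fin_dim lie_subspace[OF lie] by blast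
  obtain R where R: "max_solvable L br R" using max_solvable_exists[OF lie fL] .
  obtain S where S: "levi_complement L br R S" using levi[OF lie fL R] by blast
  have "semisimple_lie scale S br"
    using radfree_semisimple[OF subalgebra_lie[OF lie] levi_complement_radfree[OF lie R S]] S
    by (simp add: levi_complement_def)
  then show ?thesis
    unfolding baer_radical_eq[OF lie fL index R] using R S
    by (auto simp: max_solvable_def levi_complement_def)
qed

end
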